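(* Let $Q$ be a type $A$ quiver with vertex set $Q_0=\{1,\dots,n\}$, $n\ge 2$, such that every arrow of $Q$ lies in an oriented $3$-cycle of $Q$. Fix a vertex $i_0$ of $Q$ of degree $2$ in the underlying graph, and for $i\in Q_0$ let $d(i)$ be the length of a shortest directed path from $i_0$ to $i$. Let $\mathbf{a}=(a_1,\dots,a_n)\in\mathbb{Z}_{\ge 0}^n$ be the $\mathbf{d}$-vector of a cluster monomial of $\mathcal{A}(Q)$, and let $x[\mathbf{a}]$ be this cluster monomial. For $i\in Q_0$ let $\mathbf{s}_i=(s_{i,1},\dots,s_{i,a_i})\in\{0,1\}^{a_i}$, and put $|\mathbf{s}_i|=\sum_{r=1}^{a_i}s_{i,r}$, $|\bar{\mathbf{s}}_i|=a_i-|\mathbf{s}_i|$. Call $\mathbf{s}=(\mathbf{s}_1,\dots,\mathbf{s}_n)$ a globally compatible sequence (GCS) if for every $3$-cycle $i\to j\to k\to i$ of $Q$: - if $d(i)<d(j)<d(k)$, then $(s_{i,t},s_{j,t})\neq(1,0)$ for $1\le t\le\sigma_{ijk}$; - if $d(j)<d(k)<d(i)$, then $(s_{i,a_i+1-t},s_{j,a_j+1-t})\neq(1,0)$ for $1\le t\le\sigma_{ijk}$; - if $d(k)<d(i)<d(j)$, then $(s_{i,a_i+1-t},s_{j,t})\neq(1,0)$ for $1\le t\le\sigma_{ijk}$. Then $$x[\mathbf{a}]=\Big(\prod_{l=1}^n x_l^{-a_l}\Big)\sum_{\mathbf{s}}\prod_{i=1}^n x_i^{e_i},\qquad e_i=\sum_{i\to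 j}|\bar{\mathbf{s}}_j|+\sum_{k\to i}|\mathbf{s}_k|-\sum_{i\to j\to k\to i}\sigma_{jki},$$ where $\mathbf{s}$ runs over all GCSs, the first sum in $e_i$ is over arrows of $Q$ with tail $i$, the second over arrows with head $i$, and the third over the $3$-cycles $i\to j\to k\to i$ of $Q$ passing through $i$ (written starting from $i$).
   Context: A quiver is a finite directed graph without loops and without oriented $2$-cycles. For a quiver $R$ on vertices $\{1,\dots,N\}$, the coefficient-free cluster algebra $\mathcal{A}(R)\subset\mathbb{Q}(x_1,\dots,x_N)$ is defined as follows. A seed is a pair $(\mathbf{u},R')$ with $\mathbf{u}=(u_1,\dots,u_N)$ a free generating set of the field and $R'$ a quiver. Mutation at $k$ replaces $R'$ by $\mu_k(R')$: for each path $i\to k\to j$ add an arrow $i\to j$, reverse all arrows at $k$, and delete $2$-cycles. It also replaces $u_k$ by $u_k'=(\prod_{j\to k}u_j+\prod_{k\to j}u_j)/u_k$. Clusters are the tuples obtained from $((x_1,\dots,x_N),R)$ by iterated mutations. Cluster variables are their entries, and a cluster monomial is a product of nonnegative powers of cluster variables from one cluster. A type $A$ quiver is a quiver mutation-equivalent to $1\to2\to\cdots\to N$. Such a quiver arises from a triangulation of a convex $(N+3)$-gon by pairwise non-crossing diagonals $T_1,\dots,T_N$: there is an arrow $i\to j$ iff $T_i,T_j$ are two sides of a triangle of the triangulation and $T_j$ is obtained from $T_i$ by a counterclockwise rotation (by less than $180^\circ$) about their common endpoint. Fix such a triangulation. The cluster variables correspond bijectively to the diagonals, with $x_i\leftrightarrow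 T_i$. Cluster monomials correspond to collections $\{(D_1,d_1),\dots,(D_m,d_m)\}$ of pairwise distinct, pairwise non-crossing diagonals $D_j$ with positive integers $d_j$. For diagonals $D,E$ set $i(D,E)=1$ if they cross in the interior, $-1$ if $D=E$, and $0$ otherwise. The $\mathbf{d}$-vector of the monomial is $(a_1,\dots,a_N)$ with $a_i=\sum_j d_j\,i(D_j,T_i)$. Write $[x]_+=\max(x,0)$ and $\sigma(x,y,z)=\tfrac12\big([x+y-z]_+-[x-y-z]_+-[y-x-z]_+\big)$ for $x,y,z\ge0$. Set $\sigma_{ijk}=\sigma(a_i,a_j,a_k)$. *)

theory Defs
  imports Complex_Main
    "HOL-Library.FuncSet"
    "HOL-Library.Poly_Mapping"
    "HOL-Computational_Algebra.Fraction_Field"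
begin

(* Q i j is the number of arrows i -> j *)
type_synonym quiver = "nat \<Rightarrow> nat \<Rightarrow> nat"

definition is_quiver :: "nat \<Rightarrow> quiver \<Rightarrow> bool" where
  "is_quiver n Q \<longleftrightarrow>
     (\<forall>i j. Q i j > 0 \<longrightarrow> i \<in> {1..n} \<and> j \<in> {1..n}) \<and>
     (\<forall>i. Q i i = 0) \<and>
     (\<forall>i j. Q i j = 0 \<or> Q j i = 0)"

(* The truncated subtraction on nat performs the deletion of 2-cycles: between two vertices
   different from k there are p arrows one way and q arrows the other way after the paths
   through k have been composed, and p - q, q - p of them survive. *)
definition mutate_quiver :: "nat \<Rightarrow> quiver \<Rightarrow> quiver" where
  "mutate_quiver k Q = (\<lambda>i j.
     if i = k \<or> j = k then Q j i
     else (Q i j + Q i k * Q k j) - (Q j i + Q j k * Q k i))"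

definition mutation_equivalent :: "nat \<Rightarrow> quiver \<Rightarrow> quiver \<Rightarrow> bool" where
  "mutation_equivalent n = (\<lambda>Q Q'. \<exists>k\<in>{1..n}. Q' = mutate_quiver k Q)\<^sup>*\<^sup>*"

definition linear_quiver :: "nat \<Rightarrow> quiver" where
  "linear_quiver n = (\<lambda>i j. if 1 \<le> i \<and> j = Suc i \<and> j \<le> n then 1 else 0)"

definition type_A :: "nat \<Rightarrow> quiver \<Rightarrow> bool" where
  "type_A n Q \<longleftrightarrow> is_quiver n Q \<and> mutation_equivalent n (linear_quiver n) Q"

definition three_cycle :: "quiver \<Rightarrow> nat \<Rightarrow> nat \<Rightarrow> nat \<Rightarrow> bool" where
  "three_cycle Q i j k \<longleftrightarrow> Q i j > 0 \<and> Q j k > 0 \<and> Q k i > 0"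

definition vertex_degree :: "nat \<Rightarrow> quiver \<Rightarrow> nat \<Rightarrow> nat" where
  "vertex_degree n Q i = (\<Sum>j=1..n. Q i j + Q j i)"

definition path_dist :: "quiver \<Rightarrow> nat \<Rightarrow> nat \<Rightarrow> nat" where
  "path_dist Q i j = (LEAST m. (i, j) \<in> {(p, q). Q p q > 0} ^^ m)"

(* Rational functions over the rationals in the variables x_0, x_1, x_2, ...; for a quiver on
   {1..n} everything takes place in the subfield of rational functions in x_1, ..., x_n. *)
type_synonym ratfun = "((nat \<Rightarrow>\<^sub>0 nat) \<Rightarrow>\<^sub>0 rat) fract"

definition xvar :: "nat \<Rightarrow> ratfun" where
  "xvar i = Fract (Poly_Mapping.single (Poly_Mapping.single i 1) 1) 1"

definition mutate_cluster ::
  "nat \<Rightarrow> nat \<Rightarrow> quiver \<Rightarrow> (nat \<Rightarrow> ratfun) \<Rightarrow> (nat \<Rightarrow> ratfun)" where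
  "mutate_cluster n k R u =
     u(k := ((\<Prod>j=1..n. u j ^ R j k) + (\<Prod>j=1..n. u j ^ R k j)) / u k)"

(* Only u 1, ..., u n matter in a seed; the remaining values are never touched. *)
inductive seed :: "nat \<Rightarrow> quiver \<Rightarrow> (nat \<Rightarrow> ratfun) \<Rightarrow> quiver \<Rightarrow> bool"
  for n :: nat and Q :: quiver where
  initial: "seed n Q xvar Q"
| mutation: "seed n Q u R \<Longrightarrow> k \<in> {1..n} \<Longrightarrow>
    seed n Q (mutate_cluster n k R u) (mutate_quiver k R)"

definition cluster_monomial :: "nat \<Rightarrow> quiver \<Rightarrow> ratfun \<Rightarrow> bool" where
  "cluster_monomial n Q z \<longleftrightarrow>
     (\<exists>u R m. seed n Q u R \<and> z = (\<Prod>i=1..n. u i ^ m i))"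

(* The vertices of the convex (n + 3)-gon are 0, ..., n + 2 in counterclockwise order; sides
   and diagonals are the two-element sets of their endpoints. *)
definition polygon_sides :: "nat \<Rightarrow> nat set set" where
  "polygon_sides n = {{p, (p + 1) mod (n + 3)} | p. p < n + 3}"

definition diagonals :: "nat \<Rightarrow> nat set set" where
  "diagonals n = {{p, q} | p q. p < n + 3 \<and> q < n + 3 \<and> p \<noteq> q} - polygon_sides n"

definition crosses :: "nat set \<Rightarrow> nat set \<Rightarrow> bool" where
  "crosses D E \<longleftrightarrow>
     (\<exists>p r q s. p < r \<and> r < q \<and> q < s \<and>
        (D = {p, q} \<and> E = {r, s} \<or> D = {r, s} \<and> E = {p, q}))"

definition crossing_number :: "nat set \<Rightarrow> nat set \<Rightarrow> int" where
  "crossing_number D E = (if D = E then -1 else if crosses D E then 1 else 0)"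

(* n distinct pairwise non-crossing diagonals of an (n + 3)-gon always triangulate it. *)
definition triangulation :: "nat \<Rightarrow> (nat \<Rightarrow> nat set) \<Rightarrow> bool" where
  "triangulation n T \<longleftrightarrow>
     (\<forall>i\<in>{1..n}. T i \<in> diagonals n) \<and> inj_on T {1..n} \<and>
     (\<forall>i\<in>{1..n}. \<forall>j\<in>{1..n}. \<not> crosses (T i) (T j))"

definition ccw :: "nat \<Rightarrow> nat \<Rightarrow> nat \<Rightarrow> bool" where
  "ccw a b c \<longleftrightarrow> a < b \<and> b < c \<or> b < c \<and> c < a \<or> c < a \<and> a < b"

(* Rotating {a, b} counterclockwise about a by less than a straight angle sweeps over {a, c}
   exactly when a, b, c occur in this cyclic order on the boundary. *)
definition triangulation_quiver :: "nat \<Rightarrow> (nat \<Rightarrow> nat set) \<Rightarrow> quiver" where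
  "triangulation_quiver n T = (\<lambda>i j.
     if i \<in> {1..n} \<and> j \<in> {1..n} \<and>
        (\<exists>a b c. ccw a b c \<and> T i = {a, b} \<and> T j = {a, c} \<and>
           {b, c} \<in> polygon_sides n \<union> T ` {1..n})
     then 1 else 0)"

(* Seeds together with their triangulations: mutation of the seed at k is accompanied by the
   flip of the k-th diagonal. *)
inductive triangulated_seed ::
  "nat \<Rightarrow> quiver \<Rightarrow> (nat \<Rightarrow> nat set) \<Rightarrow>
     (nat \<Rightarrow> ratfun) \<Rightarrow> quiver \<Rightarrow> (nat \<Rightarrow> nat set) \<Rightarrow> bool"
  for n :: nat and Q :: quiver and T :: "nat \<Rightarrow> nat set" where
  initial: "triangulated_seed n Q T xvar Q T"
| flip: "triangulated_seed n Q T u R S \<Longrightarrow> k \<in> {1..n} \<Longrightarrow>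
    D \<noteq> S k \<Longrightarrow> triangulation n (S(k := D)) \<Longrightarrow>
    triangulated_seed n Q T (mutate_cluster n k R u) (mutate_quiver k R) (S(k := D))"

(* The bijection between diagonals and cluster variables that sends T i to x_i. *)
definition diagonal_variable ::
  "nat \<Rightarrow> quiver \<Rightarrow> (nat \<Rightarrow> nat set) \<Rightarrow> nat set \<Rightarrow> ratfun \<Rightarrow> bool" where
  "diagonal_variable n Q T D w \<longleftrightarrow>
     (\<exists>u R S. triangulated_seed n Q T u R S \<and> (\<exists>i\<in>{1..n}. S i = D \<and> u i = w))"

definition has_d_vector ::
  "nat \<Rightarrow> quiver \<Rightarrow> (nat \<Rightarrow> nat set) \<Rightarrow> ratfun \<Rightarrow> (nat \<Rightarrow> int) \<Rightarrow> bool" where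
  "has_d_vector n Q T z a \<longleftrightarrow>
     (\<exists>C mult X. C \<subseteq> diagonals n \<and> (\<forall>D\<in>C. \<forall>E\<in>C. \<not> crosses D E) \<and>
        (\<forall>D\<in>C. mult D > (0::nat) \<and> diagonal_variable n Q T D (X D)) \<and>
        z = (\<Prod>D\<in>C. X D ^ mult D) \<and>
        (\<forall>i\<in>{1..n}. a i = (\<Sum>D\<in>C. int (mult D) * crossing_number D (T i))))"

definition pos_part :: "real \<Rightarrow> real" where
  "pos_part x = max x 0"

definition sigma :: "real \<Rightarrow> real \<Rightarrow> real \<Rightarrow> real" where
  "sigma x y z = (pos_part (x + y - z) - pos_part (x - y - z) - pos_part (y - x - z)) / 2"

(* s i t is the t-th entry (t = 1, ..., a i) of the sequence attached to the vertex i. *)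
definition gcs ::
  "nat \<Rightarrow> quiver \<Rightarrow> nat \<Rightarrow> (nat \<Rightarrow> nat) \<Rightarrow> (nat \<Rightarrow> nat \<Rightarrow> nat) set" where
  "gcs n Q i0 a =
     {s \<in> (\<Pi>\<^sub>E i\<in>{1..n}. {1..a i} \<rightarrow>\<^sub>E {0, 1}).
        \<forall>i j k. three_cycle Q i j k \<longrightarrow>
          (let d = path_dist Q i0 in
           \<forall>t\<ge>1. real t \<le> sigma (a i) (a j) (a k) \<longrightarrow>
             (d i < d j \<and> d j < d k \<longrightarrow>
                (s i t, s j t) \<noteq> (1, 0)) \<and>
             (d j < d k \<and> d k < d i \<longrightarrow>
                (s i (a i + 1 - t), s j (a j + 1 - t)) \<noteq> (1, 0)) \<and>
             (d k < d i \<and> d i < d j \<longrightarrow>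
                (s i (a i + 1 - t), s j t) \<noteq> (1, 0)))}"

definition ones :: "(nat \<Rightarrow> nat) \<Rightarrow> (nat \<Rightarrow> nat \<Rightarrow> nat) \<Rightarrow> nat \<Rightarrow> nat" where
  "ones a s i = (\<Sum>r=1..a i. s i r)"

definition zeros :: "(nat \<Rightarrow> nat) \<Rightarrow> (nat \<Rightarrow> nat \<Rightarrow> nat) \<Rightarrow> nat \<Rightarrow> nat" where
  "zeros a s i = a i - ones a s i"

definition gcs_exponent ::
  "nat \<Rightarrow> quiver \<Rightarrow> (nat \<Rightarrow> nat) \<Rightarrow> (nat \<Rightarrow> nat \<Rightarrow> nat) \<Rightarrow> nat \<Rightarrow> real" where
  "gcs_exponent n Q a s i =
     (\<Sum>j=1..n. real (Q i j) * real (zeros a s j)) +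
     (\<Sum>k=1..n. real (Q k i) * real (ones a s k)) -
     (\<Sum>j=1..n. \<Sum>k=1..n. real (Q i j * Q j k * Q k i) * sigma (a j) (a k) (a i))"

end

theory Submission
  imports Defs "HOL-Library.Product_Lexorder"
begin

text \<open>The cluster variable of a diagonal is its lambda length: a triangulation determines vectors in a
  plane whose determinants are the initial variables on its edges, every flip is an instance of the
  Pluecker relation, and the determinants do not vanish because they are subtraction-free.

  Expanding the lambda length of a curve at each of its crossings with the triangulation in the basis
  of the two endpoints of the crossed diagonal gives a sum over 0/1-states along the curve. The factor
  between consecutive crossings is the determinant of two vertices of a triangle; it is a side of the
  triangle, or zero for the state (1, 0), since both vertices then coincide. This is the theorem for a
  single diagonal.

  For several curves, order the polygon vertices starting from the tip of the ear cut off by the root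
  diagonal, and number the crossings with each diagonal from its larger endpoint to its smaller one.
  With this numbering \<open>\<sigma>\<close> counts the curves around a corner of a triangle, and the pairs of
  positions constrained in a globally compatible sequence are precisely the consecutive crossings of a
  common curve. Hence the sum over these sequences is the product of the sums over the states of the
  individual curves.\<close>

section \<open>Triangulations of a polygon\<close>

text \<open>That every arrow lies in a 3-cycle means that a triangle with two diagonals among its
  sides has three. Together with degree 2 this makes one of the triangles at the root diagonal an
  ear. With the tip of that ear as vertex 0 each diagonal becomes an interval
  \<open>[lo i, hi i]\<close> inside the root interval \<open>[1, n + 2]\<close>, and each interval
  either has length 2 or splits into a right part q and a left part r: a full binary tree. The
  3-cycle of such a triangle is p -> q -> r -> p, and the distance from the root increases along p,
  q, r. Hence exactly one of the three compatibility conditions is active for each arrow of a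
  3-cycle, one per corner: p and q share their larger endpoint, so equal positions from the start
  match; r and p share the smaller one, so positions are counted from the end; q and r meet at the
  smaller end of q and the larger end of r, which gives the mixed condition. Nonnegativity of the
  d-vector keeps the diagonals \<open>T i\<close> out of the collection, so that \<open>a i\<close>
  is the number of crossings with \<open>T i\<close>.\<close>

lemma ccw_rotate: "ccw a b c \<Longrightarrow> ccw b c a"
  by (auto simp: ccw_def)

lemma ccw_distinct: "ccw a b c \<Longrightarrow> a \<noteq> b \<and> b \<noteq> c \<and> a \<noteq> c"
  by (auto simp: ccw_def)

lemma ccw_total: "a \<noteq> b \<Longrightarrow> b \<noteq> c \<Longrightarrow> a \<noteq> c \<Longrightarrow> ccw a b c \<or> ccw a c b"
  by (auto simp: ccw_def)

lemma ccw_asym: "ccw a b c \<Longrightarrow> \<not> ccw a c b"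
  by (auto simp: ccw_def)

lemma crosses_commute: "crosses D E \<longleftrightarrow> crosses E D"
  unfolding crosses_def by blast

lemma crosses_linear:
  assumes "a < c" "b < d"
  shows "crosses {a, c} {b, d} \<longleftrightarrow> a < b \<and> b < c \<and> c < d \<or> b < a \<and> a < d \<and> d < c"
proof
  assume "crosses {a, c} {b, d}"
  then show "a < b \<and> b < c \<and> c < d \<or> b < a \<and> a < d \<and> d < c"
    unfolding crosses_def doubleton_eq_iff using assms by auto
next
  assume "a < b \<and> b < c \<and> c < d \<or> b < a \<and> a < d \<and> d < c"
  then show "crosses {a, c} {b, d}"
    unfolding crosses_def by blast
qed

lemma crosses_doubleton: "crosses {a, c} {b, d} \<Longrightarrow> a \<noteq> c \<and> b \<noteq> d"
  unfolding crosses_def doubleton_eq_iff by auto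

text \<open>\<open>crosses\<close> refers to the linear order of the labels. The cyclic form does
  not depend on the label at which counting starts, as flips and the relabelling by
  \<open>rotate_vertex\<close> require.\<close>

lemma crosses_ccw:
  "crosses {a, c} {b, d} \<longleftrightarrow> ccw a b c \<and> ccw c d a \<or> ccw a d c \<and> ccw c b a"
proof (cases "a = c \<or> b = d")
  case True
  then show ?thesis
    using crosses_doubleton[of a c b d] ccw_distinct ccw_asym ccw_rotate by blast
next
  case False
  then consider "a < c" "b < d" | "a < c" "d < b" | "c < a" "b < d" | "c < a" "d < b"
    by linarith
  then show ?thesis
  proof cases
    case 1 then show ?thesis by (auto simp: crosses_linear ccw_def)
  next
    case 2 then show ?thesis
      using crosses_linear[of a c d b] by (auto simp: insert_commute ccw_def)
  next
    case 3 then show ?thesis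
      using crosses_linear[of c a b d] by (auto simp: insert_commute ccw_def)
  next
    case 4 then show ?thesis
      using crosses_linear[of c a d b] by (auto simp: insert_commute ccw_def)
  qed
qed

lemma succ_mod_wrap: "r < m \<Longrightarrow> \<not> r + 1 < m \<Longrightarrow> (r + 1) mod m = (0::nat)"
  by (metis Suc_eq_plus1 Suc_lessI mod_self)

lemma polygon_sidesE:
  assumes "D \<in> polygon_sides n"
  obtains p q where "D = {p, q}" "p < q" "q < n + 3" "q = p + 1 \<or> p = 0 \<and> q = n + 2"
proof -
  obtain r where r: "r < n + 3" "D = {r, (r + 1) mod (n + 3)}"
    using assms unfolding polygon_sides_def by blast
  show thesis
  proof (cases "r + 1 < n + 3")
    case True
    then have "D = {r, r + 1}" using r(2) by (simp only: mod_less)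
    then show thesis using True by (intro that[of r "r + 1"]) auto
  next
    case False
    then have "D = {r, 0}" using r(2) succ_mod_wrap[OF r(1) False] by (simp only:)
    moreover have "r = n + 2" using r(1) False by linarith
    ultimately show thesis by (intro that[of 0 "n + 2"]) (simp_all add: insert_commute)
  qed
qed

lemma polygon_sides_linear:
  assumes "p < q"
  shows "{p, q} \<in> polygon_sides n \<longleftrightarrow> q < n + 3 \<and> (q = p + 1 \<or> p = 0 \<and> q = n + 2)"
proof
  assume "{p, q} \<in> polygon_sides n"
  then obtain p' q' where "{p, q} = {p', q'}" "p' < q'" "q' < n + 3" "q' = p' + 1 \<or> p' = 0 \<and> q' = n + 2"
    by (rule polygon_sidesE)
  moreover from this have "p = p' \<and> q = q'" using assms by (auto simp: doubleton_eq_iff)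
  ultimately show "q < n + 3 \<and> (q = p + 1 \<or> p = 0 \<and> q = n + 2)" by simp
next
  assume *: "q < n + 3 \<and> (q = p + 1 \<or> p = 0 \<and> q = n + 2)"
  have side: "{r, (r + 1) mod (n + 3)} \<in> polygon_sides n" if "r < n + 3" for r
    unfolding polygon_sides_def using that by blast
  show "{p, q} \<in> polygon_sides n"
  proof (cases "q = p + 1")
    case True
    then have "p < n + 3" "(p + 1) mod (n + 3) = p + 1" using * by auto
    then show ?thesis using side[of p] True by (simp only:)
  next
    case False
    then have "{p, q} = {n + 2, 0}" using * by auto
    moreover have "(n + 2 + 1) mod (n + 3) = 0" by (rule succ_mod_wrap) linarith+
    moreover have "n + 2 < n + 3" by linarith
    ultimately show ?thesis using side[of "n + 2"] by (simp only:)
  qed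
qed

definition chords :: "nat \<Rightarrow> nat set set" where
  "chords n = {{p, q} | p q. p < q \<and> q < n + 3}"

lemma chords_iff: "{p, q} \<in> chords n \<longleftrightarrow> p \<noteq> q \<and> p < n + 3 \<and> q < n + 3"
proof
  assume "{p, q} \<in> chords n"
  then show "p \<noteq> q \<and> p < n + 3 \<and> q < n + 3"
    unfolding chords_def by (auto simp: doubleton_eq_iff)
next
  assume *: "p \<noteq> q \<and> p < n + 3 \<and> q < n + 3"
  then consider "p < q" | "q < p" by linarith
  then show "{p, q} \<in> chords n"
  proof cases
    case 1 then show ?thesis unfolding chords_def using * by blast
  next
    case 2
    have "{p, q} = {q, p}" by blast
    then show ?thesis unfolding chords_def using * 2 by blast
  qed
qed

lemma chordsE:
  assumes "D \<in> chords n"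
  obtains p q where "D = {p, q}" "p < q" "q < n + 3"
  using assms unfolding chords_def by blast

lemma diagonals_eq: "diagonals n = chords n - polygon_sides n"
proof -
  have "{{p, q} | p q. p < n + 3 \<and> q < n + 3 \<and> p \<noteq> q} = chords n" (is "?X = _")
  proof (intro set_eqI iffI)
    fix D assume "D \<in> ?X"
    then obtain p q where "D = {p, q}" "p < n + 3" "q < n + 3" "p \<noteq> q" by blast
    then show "D \<in> chords n" by (simp only: chords_iff simp_thms)
  next
    fix D assume "D \<in> chords n"
    then obtain p q where "D = {p, q}" "p < q" "q < n + 3" by (rule chordsE)
    then have "D = {p, q} \<and> p < n + 3 \<and> q < n + 3 \<and> p \<noteq> q" by simp
    then show "D \<in> ?X" by blast
  qed
  then show ?thesis unfolding diagonals_def by simp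
qed

lemma polygon_sides_subset_chords: "polygon_sides n \<subseteq> chords n"
proof
  fix D assume "D \<in> polygon_sides n"
  then obtain p q where "D = {p, q}" "p < q" "q < n + 3" by (rule polygon_sidesE)
  then show "D \<in> chords n" unfolding chords_def by blast
qed

lemma finite_diagonals: "finite (diagonals n)"
proof -
  have "chords n \<subseteq> Pow {..<n + 3}" by (auto elim!: chordsE)
  then show ?thesis
    unfolding diagonals_eq by (meson finite_Diff finite_Pow_iff finite_lessThan finite_subset)
qed

lemma side_not_crosses:
  assumes "D \<in> polygon_sides n" "E \<in> chords n"
  shows "\<not> crosses D E"
proof -
  obtain p q where "D = {p, q}" "p < q" "q < n + 3" "q = p + 1 \<or> p = 0 \<and> q = n + 2"
    using assms polygon_sidesE by blast
  moreover obtain r s where "E = {r, s}" "r < s" "s < n + 3"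
    using assms chordsE by blast
  ultimately show ?thesis by (auto simp: crosses_linear)
qed

text \<open>There is a vertex m inside the whole interval that no member other than
  \<open>(lo, hi)\<close> straddles. The bounds for the two halves and this one possible member add
  up.\<close>

lemma noncrossing_intervals_card:
  assumes "S \<subseteq> {(a, b). lo \<le> a \<and> a + 2 \<le> b \<and> b \<le> hi}"
    and "\<And>a b c d. (a, b) \<in> S \<Longrightarrow> (c, d) \<in> S \<Longrightarrow> \<not> (a < c \<and> c < b \<and> b < d)"
    and "lo < hi"
  shows "card S \<le> hi - lo - (1::nat)"
  using assms
proof (induction "hi - lo" arbitrary: lo hi S rule: less_induct)
  case less
  have sub: "S \<subseteq> {lo..hi} \<times> {lo..hi}" using less.prems(1) by auto
  then have fin: "finite S" by (rule finite_subset) simp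
  show ?case
  proof (cases "hi = lo + 1")
    case True
    then have "S \<subseteq> {}" using less.prems(1) by auto
    then show ?thesis by simp
  next
    case False
    \<comment> \<open>m becomes the right end of the longest member that starts at \<open>lo\<close>
      and is not the whole interval; \<open>lo + 1\<close> is the default if there is none, which
      makes the left half trivial.\<close>
    define M where "M = insert (lo + 1) {m. m < hi \<and> (lo, m) \<in> S}"
    have finM: "finite M" unfolding M_def by simp
    define m where "m = Max M"
    have mM: "m \<in> M" unfolding m_def using finM by (intro Max_in) (auto simp: M_def)
    have m_max: "k \<le> m" if "k < hi" "(lo, k) \<in> S" for k
      unfolding m_def using finM that by (intro Max_ge) (auto simp: M_def)
    have m: "lo < m" "m < hi" using mM False less.prems(1,3) by (auto simp: M_def)
    have msep: "\<not> (lo < a \<and> a < m \<and> m < b)" if "(a, b) \<in> S" for a b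
      using mM less.prems(2)[of lo m a b] that by (auto simp: M_def)
    define S1 where "S1 = S \<inter> {(a, b). b \<le> m}"
    define S2 where "S2 = S \<inter> {(a, b). m \<le> a}"
    have c1: "card S1 \<le> m - lo - 1"
      using less.prems(1,2) m by (intro less.hyps) (auto simp: S1_def)
    have c2: "card S2 \<le> hi - m - 1"
      using less.prems(1,2) m by (intro less.hyps) (auto simp: S2_def)
    have "S \<subseteq> insert (lo, hi) (S1 \<union> S2)"
    proof (rule subsetI, rule ccontr)
      fix ab0 assume ab0: "ab0 \<in> S" "ab0 \<notin> insert (lo, hi) (S1 \<union> S2)"
      obtain a b where "ab0 = (a, b)" by fastforce
      then have ab: "(a, b) \<in> S" "(a, b) \<notin> S1 \<union> S2" "\<not> (a = lo \<and> b = hi)"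
        using ab0 by auto
      have r: "lo \<le> a" "a + 2 \<le> b" "b \<le> hi" using ab less.prems(1) by auto
      have "a < m" "m < b" using ab by (auto simp: S1_def S2_def)
      then have "a = lo" using msep[OF ab(1)] r by auto
      then have "b \<le> m" using m_max[of b] ab r by auto
      then show False using \<open>m < b\<close> by simp
    qed
    then have "card S \<le> card (insert (lo, hi) (S1 \<union> S2))"
      using fin by (intro card_mono) (auto simp: S1_def S2_def)
    also have "\<dots> \<le> Suc (card (S1 \<union> S2))" by (simp add: card_insert_le_m1 card_insert_if fin S1_def S2_def)
    also have "\<dots> \<le> Suc (card S1 + card S2)" by (simp add: card_Un_le)
    also have "\<dots> \<le> hi - lo - 1" using c1 c2 m by linarith
    finally show ?thesis .
  qed
qed

lemma noncrossing_diagonals_card: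
  assumes "X \<subseteq> diagonals n" "\<And>D E. D \<in> X \<Longrightarrow> E \<in> X \<Longrightarrow> \<not> crosses D E"
  shows "card X \<le> n"
proof -
  define S where "S = {(a, b). a < b \<and> {a, b} \<in> X}"
  have lin: "a + 2 \<le> b \<and> b \<le> n + 2 \<and> (a, b) \<noteq> (0, n + 2)" if "(a, b) \<in> S" for a b
  proof -
    have "{a, b} \<in> chords n" "{a, b} \<notin> polygon_sides n" "a < b"
      using that assms(1) by (auto simp: S_def diagonals_eq)
    then show ?thesis
      using polygon_sides_linear[of a b n] chords_iff[of a b n] by auto
  qed
  have fin: "finite S"
    by (rule finite_subset[of _ "{..n + 2} \<times> {..n + 2}"]) (auto dest: lin)
  \<comment> \<open>The side \<open>{0, n + 2}\<close> is counted as an extra interval; the bound n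
    + 1 for the enlarged family leaves n diagonals.\<close>
  have "card (insert (0, n + 2) S) \<le> (n + 2) - 0 - 1"
  proof (rule noncrossing_intervals_card)
    show "insert (0, n + 2) S \<subseteq> {(a, b). 0 \<le> a \<and> a + 2 \<le> b \<and> b \<le> n + 2}"
      by (auto dest: lin)
    fix a b c d
    assume "(a, b) \<in> insert (0, n + 2) S" "(c, d) \<in> insert (0, n + 2) S"
    then show "\<not> (a < c \<and> c < b \<and> b < d)"
      using lin[of a b] lin[of c d] assms(2)[of "{a, b}" "{c, d}"]
        crosses_linear[of a b c d] unfolding S_def by fastforce
  qed auto
  moreover have "(0, n + 2) \<notin> S" using lin by blast
  ultimately have "card S \<le> n" using fin by simp
  moreover have "X \<subseteq> (\<lambda>(a, b). {a, b}) ` S"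
  proof
    fix D assume D: "D \<in> X"
    then have "D \<in> chords n" using assms(1) diagonals_eq by auto
    then obtain p q where "D = {p, q}" "p < q" by (rule chordsE)
    then show "D \<in> (\<lambda>(a, b). {a, b}) ` S" using D by (force simp: S_def)
  qed
  then have "card X \<le> card S" using fin surj_card_le by blast
  ultimately show ?thesis by simp
qed

definition edges :: "nat \<Rightarrow> (nat \<Rightarrow> nat set) \<Rightarrow> nat set set" where
  "edges n S = polygon_sides n \<union> S ` {1..n}"

lemma edges_subset_chords: "triangulation n S \<Longrightarrow> edges n S \<subseteq> chords n"
  using polygon_sides_subset_chords by (auto simp: edges_def triangulation_def diagonals_eq)

lemma edges_not_crosses:
  assumes "triangulation n S" "D \<in> edges n S" "E \<in> edges n S"
  shows "\<not> crosses D E"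
proof -
  have "D \<in> chords n" "E \<in> chords n" using assms edges_subset_chords by auto
  then have "D \<in> polygon_sides n \<or> E \<in> polygon_sides n \<Longrightarrow> \<not> crosses D E"
    using side_not_crosses crosses_commute by metis
  then show ?thesis using assms unfolding edges_def triangulation_def by blast
qed

lemma triangulation_card: "triangulation n S \<Longrightarrow> card (S ` {1..n}) = n"
  unfolding triangulation_def by (simp add: card_image)

text \<open>A chord that crosses no diagonal and is no edge would be diagonal number n + 1. The
  triangles adjacent to a chord are found through this maximality.\<close>

lemma edges_maximal:
  assumes "triangulation n S" "D \<in> chords n" "\<And>i. i \<in> {1..n} \<Longrightarrow> \<not> crosses D (S i)"
  shows "D \<in> edges n S"
proof (rule ccontr)
  assume D: "D \<notin> edges n S"
  have "\<not> crosses D D"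
    using assms(2) by (auto elim!: chordsE simp: crosses_linear)
  then have "card (insert D (S ` {1..n})) \<le> n"
    using assms D unfolding edges_def triangulation_def diagonals_eq
    by (intro noncrossing_diagonals_card) (auto simp: crosses_commute diagonals_eq)
  moreover have "card (insert D (S ` {1..n})) = Suc n"
    using D triangulation_card[OF assms(1)] by (simp add: edges_def)
  ultimately show False by simp
qed

section \<open>The two triangles adjacent to a chord\<close>

definition opposite_vertex :: "nat \<Rightarrow> (nat \<Rightarrow> nat set) \<Rightarrow> nat \<Rightarrow> nat \<Rightarrow> nat \<Rightarrow> bool" where
  "opposite_vertex n S a b c \<longleftrightarrow> ccw a b c \<and> {a, b} \<in> edges n S \<and> {b, c} \<in> edges n S"

lemma side_succ: "a < n + 3 \<Longrightarrow> {a, (a + 1) mod (n + 3)} \<in> polygon_sides n"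
  unfolding polygon_sides_def by blast

lemma ccw_succ:
  assumes "ccw a b c" "a < n + 3" "b < n + 3" "c < n + 3"
  shows "ccw a ((a + 1) mod (n + 3)) c"
proof (cases "a + 1 < n + 3")
  case True
  then have m: "(a + 1) mod (n + 3) = a + 1" by simp
  show ?thesis unfolding m using assms True unfolding ccw_def by linarith
next
  case False
  then have m: "(a + 1) mod (n + 3) = 0" "a = n + 2" using assms succ_mod_wrap by (blast, linarith)
  show ?thesis unfolding m(1) using assms m(2) unfolding ccw_def by linarith
qed

text \<open>Take b to be the last neighbour of a before c, counterclockwise from a. A diagonal
  crossing \<open>{b, c}\<close> would cross \<open>{a, b}\<close> or \<open>{a, c}\<close>, or end
  in a and give a later neighbour. The vertex e witnesses that the arc from a to c has an inner
  vertex; exchanging a and c yields the triangle on the other side of the chord.\<close>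

lemma opposite_vertex_exists:
  assumes S: "triangulation n S" and ac: "{a, c} \<in> edges n S" and e: "ccw a e c" "e < n + 3"
  shows "\<exists>b. opposite_vertex n S a b c"
proof -
  have "{a, c} \<in> chords n" using edges_subset_chords[OF S] ac by auto
  then have lt: "a < n + 3" "c < n + 3" "a \<noteq> c" unfolding chords_iff by auto
  \<comment> \<open>Linearizes the cyclic order so that a comes first: labels below a are shifted by
    a full turn.\<close>
  define rk where "rk = (\<lambda>b. if b \<ge> a then b else b + (n + 3))"
  define M where "M = {b. ccw a b c \<and> {a, b} \<in> edges n S}"
  have M_lt: "b < n + 3" if "b \<in> M" for b
    using edges_subset_chords[OF S] that by (auto simp: M_def chords_iff)
  have finM: "finite M" by (rule finite_subset[of _ "{..<n + 3}"]) (auto dest: M_lt)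
  have "(a + 1) mod (n + 3) \<in> M"
    using ccw_succ[OF e(1) lt(1) e(2) lt(2)] side_succ[OF lt(1)] by (auto simp: M_def edges_def)
  then have ne: "M \<noteq> {}" by auto
  obtain b where b: "b \<in> M" "\<And>b'. b' \<in> M \<Longrightarrow> rk b' \<le> rk b"
  proof -
    have "Max (rk ` M) \<in> rk ` M" using finM ne by (intro Max_in) auto
    then obtain b where "b \<in> M" "rk b = Max (rk ` M)" by auto
    then show thesis using finM that[of b] by auto
  qed
  have abc: "ccw a b c" "{a, b} \<in> edges n S" using b(1) by (auto simp: M_def)
  have "{b, c} \<in> edges n S"
  proof (rule edges_maximal[OF S])
    show "{b, c} \<in> chords n" using abc M_lt[OF b(1)] lt ccw_distinct by (auto simp: chords_iff)
    fix i assume i: "i \<in> {1..n}"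
    then have Si: "S i \<in> edges n S" by (auto simp: edges_def)
    show "\<not> crosses {b, c} (S i)"
    proof
      assume cr: "crosses {b, c} (S i)"
      have "S i \<in> chords n" using edges_subset_chords[OF S] Si by auto
      then obtain p q where pq: "S i = {p, q}" by (rule chordsE)
      then have "ccw b p c \<and> ccw c q b \<or> ccw b q c \<and> ccw c p b"
        using cr by (simp add: crosses_ccw)
      moreover have "S i = {q, p}" using pq by auto
      ultimately obtain x y where xy: "S i = {x, y}" "ccw b x c" "ccw c y b"
        using pq by blast
      have n1: "\<not> crosses {a, c} {x, y}" "\<not> crosses {a, b} {x, y}"
        using edges_not_crosses[OF S] ac abc Si xy by auto
      have xN: "x < n + 3" "y < n + 3"
        using edges_subset_chords[OF S] Si xy by (auto simp: chords_iff)
      have "y = a \<or> ccw a y b \<or> ccw c y a"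
        using xy(3) abc(1) unfolding ccw_def by linarith
      then show False
      proof (elim disjE)
        assume "y = a"
        then have "{a, x} \<in> edges n S" using xy(1) Si by (simp add: insert_commute)
        moreover have "ccw a x c" using xy(2) abc(1) unfolding ccw_def by linarith
        ultimately have "rk x \<le> rk b" using b(2) by (simp add: M_def)
        then show False using xy(2) abc(1) xN(1) M_lt[OF b(1)]
          unfolding rk_def ccw_def by (simp split: if_splits; linarith)
      next
        assume ayb: "ccw a y b"
        have "ccw b x a" using xy(2) abc(1) unfolding ccw_def by linarith
        then show False using n1(2) ayb unfolding crosses_ccw by blast
      next
        assume cya: "ccw c y a"
        have "ccw a x c" using xy(2) abc(1) unfolding ccw_def by linarith
        then show False using n1(1) cya unfolding crosses_ccw by blast
      qed
    qed
  qed
  then show ?thesis using abc by (auto simp: opposite_vertex_def)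
qed

text \<open>Of two candidates on the same arc, the edge from a to the farther one crosses the edge
  from the nearer one to c.\<close>

lemma opposite_vertex_unique:
  assumes S: "triangulation n S" and "opposite_vertex n S a b c" "opposite_vertex n S a b' c"
  shows "b = b'"
proof (rule ccontr)
  assume ne: "b \<noteq> b'"
  have h: "ccw a b c" "ccw a b' c" "\<not> crosses {a, b} {b', c}" "\<not> crosses {b, c} {a, b'}"
    using assms(2,3) edges_not_crosses[OF S] by (auto simp: opposite_vertex_def)
  consider "ccw a b b'" | "ccw a b' b"
    using ne h ccw_distinct ccw_total by metis
  then show False
  proof cases
    case 1
    have "ccw c a b" "ccw b b' c" using h(1,2) 1 unfolding ccw_def by linarith+
    then show False using h(4) unfolding crosses_ccw by blast
  next
    case 2
    have "ccw a b' b" "ccw b c a" using h(1,2) 2 unfolding ccw_def by linarith+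
    then show False using h(3) unfolding crosses_ccw by blast
  qed
qed

section \<open>Flips and quiver mutation\<close>

text \<open>The vertices a, b, c, d run counterclockwise around the two triangles that meet in
  \<open>S k\<close>, so the flipped diagonal is \<open>{b, d}\<close>.\<close>

definition quadrilateral ::
  "nat \<Rightarrow> (nat \<Rightarrow> nat set) \<Rightarrow> nat \<Rightarrow> nat \<Rightarrow> nat \<Rightarrow> nat \<Rightarrow> nat \<Rightarrow> bool" where
  "quadrilateral n S k a b c d \<longleftrightarrow> k \<in> {1..n} \<and> S k = {a, c} \<and> ccw a b c \<and> ccw c d a \<and>
     {a, b} \<in> edges n S \<and> {b, c} \<in> edges n S \<and> {c, d} \<in> edges n S \<and> {d, a} \<in> edges n S"

lemma quadrilateral_exists:
  assumes S: "triangulation n S" and k: "k \<in> {1..n}"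
  shows "\<exists>a b c d. quadrilateral n S k a b c d"
proof -
  have "S k \<in> chords n" "S k \<notin> polygon_sides n"
    using S k by (auto simp: triangulation_def diagonals_eq)
  then obtain a c where ac: "S k = {a, c}" "a < c" "c < n + 3" by (rule_tac chordsE)
  then have "\<not> (c = a + 1 \<or> a = 0 \<and> c = n + 2)"
    using \<open>S k \<notin> polygon_sides n\<close> polygon_sides_linear by simp
  then have lin: "a + 1 < c" "a \<noteq> 0 \<or> c \<noteq> n + 2" using ac by auto
  have E: "{a, c} \<in> edges n S" using ac k unfolding edges_def by (metis UnCI image_eqI)
  have E': "{c, a} \<in> edges n S" using E by (simp only: insert_commute)
  have 1: "ccw a (a + 1) c" "a + 1 < n + 3" using lin ac by (auto simp: ccw_def)
  obtain b where b: "opposite_vertex n S a b c"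
    using opposite_vertex_exists[OF S E 1] by blast
  have "\<exists>e. ccw c e a \<and> e < n + 3"
  proof (cases "a = 0")
    case True
    then show ?thesis using ac lin by (intro exI[of _ "c + 1"]) (auto simp: ccw_def)
  next
    case False
    then show ?thesis using ac by (intro exI[of _ 0]) (auto simp: ccw_def)
  qed
  then obtain d where d: "opposite_vertex n S c d a"
    using opposite_vertex_exists[OF S E'] by blast
  show ?thesis using b d ac k unfolding quadrilateral_def opposite_vertex_def by blast
qed

lemma edges_flip_new: "k \<in> {1..n} \<Longrightarrow> D \<in> edges n (S(k := D))"
  unfolding edges_def by (rule UnI2, rule image_eqI[of _ _ k]) simp_all

lemma edges_flip_keep:
  assumes "X \<in> edges n S" "X \<noteq> S k"
  shows "X \<in> edges n (S(k := D))"
proof (cases "X \<in> polygon_sides n")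
  case False
  then obtain i where i: "i \<in> {1..n}" "X = S i" using assms(1) unfolding edges_def by blast
  then have "i \<noteq> k" using assms(2) by blast
  then have "X = (S(k := D)) i" using i by simp
  then show ?thesis using i(1) unfolding edges_def by (rule UnI2[OF image_eqI])
qed (simp add: edges_def)

lemma edges_flip_back:
  assumes "X \<in> edges n (S(k := D))" "X \<noteq> D"
  shows "X \<in> edges n S"
proof (cases "X \<in> polygon_sides n")
  case False
  then obtain i where i: "i \<in> {1..n}" "X = (S(k := D)) i" using assms(1) unfolding edges_def by blast
  then have "X = S i" using assms(2) by (cases "i = k") simp_all
  then show ?thesis using i(1) unfolding edges_def by (rule UnI2[OF image_eqI])
qed (simp add: edges_def)

lemma edges_flip_old:
  assumes "triangulation n S" "k \<in> {1..n}" "D \<noteq> S k"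
  shows "S k \<notin> edges n (S(k := D))"
proof
  assume *: "S k \<in> edges n (S(k := D))"
  have "S k \<in> diagonals n" using assms(1,2) unfolding triangulation_def by simp
  then have "S k \<notin> polygon_sides n" by (simp add: diagonals_eq)
  then obtain i where i: "i \<in> {1..n}" "S k = (S(k := D)) i" using * unfolding edges_def by blast
  then have "i \<noteq> k" using assms(3) by (metis fun_upd_same)
  then have "S k = S i" using i(2) by (metis fun_upd_other)
  moreover have "inj_on S {1..n}" using assms(1) by (simp add: triangulation_def)
  ultimately show False using assms(2) i(1) \<open>i \<noteq> k\<close> by (metis inj_onD)
qed

text \<open>The new diagonal must cross \<open>S k\<close>, as otherwise maximality would make it an
  edge of the old triangulation. All other edges survive the flip, in particular the four sides of
  the quadrilateral, and a chord that crosses \<open>{a, c}\<close> but none of these sides joins b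
  to d.\<close>

lemma flip_quadrilateral:
  assumes S: "triangulation n S" and S': "triangulation n (S(k := D))"
    and k: "k \<in> {1..n}" and ne: "D \<noteq> S k"
  shows "\<exists>a b c d. quadrilateral n S k a b c d \<and> D = {b, d}"
proof -
  obtain a b c d where q: "quadrilateral n S k a b c d"
    using quadrilateral_exists[OF S k] by blast
  note q' = q[unfolded quadrilateral_def]
  have D: "D \<in> chords n" "D \<notin> polygon_sides n"
    using S' k unfolding triangulation_def diagonals_eq by (metis DiffE fun_upd_same)+
  have "crosses D (S k)"
  proof (rule ccontr)
    assume nc: "\<not> crosses D (S k)"
    have "D \<in> edges n S"
    proof (rule edges_maximal[OF S D(1)])
      fix i assume "i \<in> {1..n}"
      then show "\<not> crosses D (S i)"
        using nc S' k unfolding triangulation_def by (metis fun_upd_apply)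
    qed
    then obtain i where i: "i \<in> {1..n}" "D = S i" using D(2) by (auto simp: edges_def)
    then have "i \<noteq> k" using ne by auto
    then show False using S' i k unfolding triangulation_def inj_on_def
      by (metis fun_upd_apply)
  qed
  moreover obtain p r where pr: "D = {p, r}" using D(1) by (rule chordsE)
  ultimately have "ccw a p c \<and> ccw c r a \<or> ccw a r c \<and> ccw c p a"
    using q' by (metis crosses_ccw crosses_commute)
  moreover have "D = {r, p}" using pr by auto
  ultimately obtain e f where ef: "D = {e, f}" "ccw a e c" "ccw c f a"
    using pr by blast
  have dist: "a \<noteq> b" "b \<noteq> c" "a \<noteq> c" "c \<noteq> d" "d \<noteq> a"
    using q' ccw_distinct by blast+
  have nc: "\<not> crosses D X" if "X \<in> edges n S" "X \<noteq> S k" for X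
    using edges_not_crosses[OF S' edges_flip_new[OF k] edges_flip_keep[OF that]] .
  have ncs: "\<not> crosses {e, f} {a, b}" "\<not> crosses {e, f} {b, c}"
    "\<not> crosses {e, f} {c, d}" "\<not> crosses {e, f} {d, a}"
    using nc q' dist unfolding ef(1) by (simp_all add: doubleton_eq_iff)
  have "e = b"
  proof (rule ccontr)
    assume "e \<noteq> b"
    then consider "ccw a e b" | "ccw b e c"
      using ef(2) q' unfolding ccw_def by linarith
    then show False
    proof cases
      case 1
      have "ccw b f a" using ef(3) q' unfolding ccw_def by linarith
      then show False using ncs(1) 1 crosses_ccw[of a b e f] crosses_commute by blast
    next
      case 2
      have "ccw c f b" using ef(3) q' unfolding ccw_def by linarith
      then show False using ncs(2) 2 crosses_ccw[of b c e f] crosses_commute by blast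
    qed
  qed
  moreover have "f = d"
  proof (rule ccontr)
    assume "f \<noteq> d"
    then consider "ccw c f d" | "ccw d f a"
      using ef(3) q' unfolding ccw_def by linarith
    then show False
    proof cases
      case 1
      have "ccw d e c" using ef(2) q' unfolding ccw_def by linarith
      then show False using ncs(3) 1 crosses_ccw[of c d e f] crosses_commute by blast
    next
      case 2
      have "ccw a e d" using ef(2) q' unfolding ccw_def by linarith
      then show False using ncs(4) 2 crosses_ccw[of d a e f] crosses_commute by blast
    qed
  qed
  ultimately show ?thesis using q ef(1) by blast
qed

text \<open>The arrow condition of \<open>triangulation_quiver\<close> for edges instead of indices:
  the four sides of a quadrilateral can then be treated alike, whether they are diagonals or sides
  of the polygon.\<close>

definition triangle_arrow :: "nat \<Rightarrow> (nat \<Rightarrow> nat set) \<Rightarrow> nat set \<Rightarrow> nat set \<Rightarrow> bool" where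
  "triangle_arrow n S X Y \<longleftrightarrow>
     (\<exists>a b c. ccw a b c \<and> X = {a, b} \<and> Y = {a, c} \<and> {b, c} \<in> edges n S)"

lemma triangle_arrowI:
  "ccw a b c \<Longrightarrow> {b, c} \<in> edges n S \<Longrightarrow> X = {a, b} \<Longrightarrow> Y = {a, c} \<Longrightarrow> triangle_arrow n S X Y"
  unfolding triangle_arrow_def by blast

lemma triangulation_quiver_arrow:
  "triangulation_quiver n S i j =
     (if i \<in> {1..n} \<and> j \<in> {1..n} \<and> triangle_arrow n S (S i) (S j) then 1 else 0)"
  unfolding triangulation_quiver_def triangle_arrow_def edges_def by simp

lemma triangle_arrow_asym: "triangle_arrow n S X Y \<Longrightarrow> \<not> triangle_arrow n S Y X"
proof
  assume "triangle_arrow n S X Y" "triangle_arrow n S Y X"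
  then obtain a b c a' b' c' where *: "ccw a b c" "X = {a, b}" "Y = {a, c}"
    "ccw a' b' c'" "Y = {a', b'}" "X = {a', c'}"
    unfolding triangle_arrow_def by metis
  then have "a \<noteq> b" "b \<noteq> c" "a \<noteq> c" "{a, b} = {a', c'}" "{a, c} = {a', b'}"
    using ccw_distinct by auto
  then have "a' = a \<and> c' = b \<and> b' = c" by (auto simp: doubleton_eq_iff)
  then show False using * ccw_asym by blast
qed

lemma triangle_arrow_irrefl: "\<not> triangle_arrow n S X X"
  using triangle_arrow_asym by blast

text \<open>An arrow turns about an endpoint of the diagonal, and the third vertex is unique on each
  side. Outgoing arrows reach one pair of opposite sides of the quadrilateral, incoming ones start
  from the other pair (\<open>triangle_arrow_to\<close>); the pairs give the two monomials of the
  exchange relation.\<close>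

lemma triangle_arrow_from:
  assumes S: "triangulation n S" and q: "quadrilateral n S k a b c d" and Y: "Y \<in> edges n S"
  shows "triangle_arrow n S {a, c} Y \<longleftrightarrow> Y = {d, a} \<or> Y = {b, c}"
proof
  note q' = q[unfolded quadrilateral_def]
  assume "triangle_arrow n S {a, c} Y"
  then obtain p r s where *: "ccw p r s" "{a, c} = {p, r}" "Y = {p, s}" "{r, s} \<in> edges n S"
    unfolding triangle_arrow_def by blast
  from *(2) consider "a = p" "c = r" | "a = r" "c = p" unfolding doubleton_eq_iff by blast
  then show "Y = {d, a} \<or> Y = {b, c}"
  proof cases
    case 1
    then have "opposite_vertex n S c s a"
      using * Y ccw_rotate unfolding opposite_vertex_def by (metis insert_commute)
    moreover have "opposite_vertex n S c d a" using q' by (simp add: opposite_vertex_def)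
    ultimately have "s = d" using opposite_vertex_unique[OF S] by blast
    then show ?thesis using * 1 by auto
  next
    case 2
    then have "opposite_vertex n S a s c"
      using * Y ccw_rotate unfolding opposite_vertex_def by (metis insert_commute)
    moreover have "opposite_vertex n S a b c" using q' by (simp add: opposite_vertex_def)
    ultimately have "s = b" using opposite_vertex_unique[OF S] by blast
    then show ?thesis using * 2 by auto
  qed
next
  note q' = q[unfolded quadrilateral_def]
  assume "Y = {d, a} \<or> Y = {b, c}"
  then show "triangle_arrow n S {a, c} Y"
  proof
    assume "Y = {d, a}"
    moreover have "ccw a c d" using q' ccw_rotate by blast
    ultimately show ?thesis using q'
        by (intro triangle_arrowI[of a c d]) (metis insert_commute)+
  next
    assume "Y = {b, c}"
    moreover have "ccw c a b" using q' ccw_rotate by blast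
    ultimately show ?thesis using q'
        by (intro triangle_arrowI[of c a b]) (metis insert_commute)+
  qed
qed

lemma triangle_arrow_to:
  assumes S: "triangulation n S" and q: "quadrilateral n S k a b c d" and Y: "Y \<in> edges n S"
  shows "triangle_arrow n S Y {a, c} \<longleftrightarrow> Y = {a, b} \<or> Y = {c, d}"
proof
  note q' = q[unfolded quadrilateral_def]
  assume "triangle_arrow n S Y {a, c}"
  then obtain p r s where *: "ccw p r s" "{a, c} = {p, s}" "Y = {p, r}" "{r, s} \<in> edges n S"
    unfolding triangle_arrow_def by blast
  from *(2) consider "a = p" "c = s" | "a = s" "c = p" unfolding doubleton_eq_iff by blast
  then show "Y = {a, b} \<or> Y = {c, d}"
  proof cases
    case 1
    then have "opposite_vertex n S a r c"
      using * Y unfolding opposite_vertex_def by (metis insert_commute)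
    moreover have "opposite_vertex n S a b c" using q' by (simp add: opposite_vertex_def)
    ultimately have "r = b" using opposite_vertex_unique[OF S] by blast
    then show ?thesis using * 1 by auto
  next
    case 2
    then have "opposite_vertex n S c r a"
      using * Y unfolding opposite_vertex_def by (metis insert_commute)
    moreover have "opposite_vertex n S c d a" using q' by (simp add: opposite_vertex_def)
    ultimately have "r = d" using opposite_vertex_unique[OF S] by blast
    then show ?thesis using * 2 by auto
  qed
next
  note q' = q[unfolded quadrilateral_def]
  assume "Y = {a, b} \<or> Y = {c, d}"
  then show "triangle_arrow n S Y {a, c}"
  proof
    assume "Y = {a, b}"
    then show ?thesis using q'
        by (intro triangle_arrowI[of a b c]) (metis insert_commute)+
  next
    assume "Y = {c, d}"
    then show ?thesis using q'
        by (intro triangle_arrowI[of c d a]) (metis insert_commute)+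
  qed
qed

lemma quadrilateral_flip:
  assumes q: "quadrilateral n S k a b c d"
  shows "quadrilateral n (S(k := {b, d})) k b c d a"
proof -
  note q' = q[unfolded quadrilateral_def]
  have d: "a \<noteq> b" "b \<noteq> c" "a \<noteq> c" "c \<noteq> d" "d \<noteq> a" using q' ccw_distinct by blast+
  have "ccw b c d" "ccw d a b" using q' unfolding ccw_def by linarith+
  moreover have "{a, b} \<noteq> S k" "{b, c} \<noteq> S k" "{c, d} \<noteq> S k" "{d, a} \<noteq> S k"
    using q' d unfolding doubleton_eq_iff by (metis doubleton_eq_iff)+
  ultimately show ?thesis using q' edges_flip_keep unfolding quadrilateral_def fun_upd_same by blast
qed

text \<open>An arrow is witnessed by the third side of its triangle. The flip removes only the
  witness \<open>{a, c}\<close>, which serves the arrows from bc to ab and from da to cd, and adds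
  only the witness \<open>{b, d}\<close>.\<close>

lemma triangle_arrow_flip:
  assumes S: "triangulation n S" and q: "quadrilateral n S k a b c d"
    and X: "X \<in> edges n S" and Y: "Y \<in> edges n S"
  shows "triangle_arrow n (S(k := {b, d})) X Y \<longleftrightarrow>
    triangle_arrow n S X Y \<and> \<not> (X = {b, c} \<and> Y = {a, b}) \<and> \<not> (X = {d, a} \<and> Y = {c, d}) \<or>
    X = {a, b} \<and> Y = {d, a} \<or> X = {c, d} \<and> Y = {b, c}" (is "?L \<longleftrightarrow> ?R")
proof -
  note q' = q[unfolded quadrilateral_def]
  have kn: "k \<in> {1..n}" and Sk: "S k = {a, c}" using q' by auto
  have ccws: "ccw b c d" "ccw d a b" "ccw a b d" "ccw c d b" "ccw b c a" "ccw d a c"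
    using q' unfolding ccw_def by linarith+
  have d: "a \<noteq> b" "b \<noteq> c" "a \<noteq> c" "c \<noteq> d" "d \<noteq> a" "b \<noteq> d" using ccws ccw_distinct by blast+
  have ac: "{a, c} \<in> edges n S" using q' unfolding edges_def by (metis UnCI image_eqI)
  show ?thesis
  proof
    assume ?L
    then obtain p r s where *: "ccw p r s" "X = {p, r}" "Y = {p, s}"
      "{r, s} \<in> edges n (S(k := {b, d}))" unfolding triangle_arrow_def by blast
    show ?R
    proof (cases "{r, s} = {b, d}")
      case False
      then have rs: "{r, s} \<in> edges n S" using edges_flip_back[OF *(4)] by blast
      then have "triangle_arrow n S X Y" using * unfolding triangle_arrow_def by blast
      moreover have "{r, s} \<noteq> {a, c}"
      proof
        assume eq: "{r, s} = {a, c}"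
        have "{a, c} \<noteq> {b, d}" using d by (auto simp: doubleton_eq_iff)
        then have "S k \<notin> edges n (S(k := {b, d}))"
          using edges_flip_old[OF S kn, of "{b, d}"] Sk by simp
        then show False using * eq Sk by auto
      qed
      moreover have "{r, s} = {a, c}" if "X = {b, c}" "Y = {a, b}"
      proof -
        have "{p, r} = {b, c}" "{p, s} = {b, a}" using * that by auto
        then have "p = b \<and> r = c \<and> s = a" using d unfolding doubleton_eq_iff by metis
        then show ?thesis by auto
      qed
      moreover have "{r, s} = {a, c}" if "X = {d, a}" "Y = {c, d}"
      proof -
        have "{p, r} = {d, a}" "{p, s} = {d, c}" using * that by auto
        then have "p = d \<and> r = a \<and> s = c" using d unfolding doubleton_eq_iff by metis
        then show ?thesis by auto
      qed
      ultimately show ?thesis by blast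
    next
      case True
      \<comment> \<open>Both edges exist before the flip, so neither crosses \<open>{a, c}\<close>;
        a triangle over \<open>{b, d}\<close> therefore has its apex at a or c.\<close>
      have nc: "\<not> crosses {a, c} {p, r}" "\<not> crosses {a, c} {p, s}"
        using edges_not_crosses[OF S ac] X Y * by auto
      from True consider "r = b" "s = d" | "r = d" "s = b" unfolding doubleton_eq_iff by blast
      then show ?thesis
      proof cases
        case 1
        have "p = a"
        proof (rule ccontr)
          assume "p \<noteq> a"
          have "ccw a p c \<or> ccw c p a" using \<open>p \<noteq> a\<close> *(1)[unfolded 1] q' unfolding ccw_def by linarith
          then show False using nc q' unfolding 1 crosses_ccw by blast
        qed
        then show ?thesis using * 1 by auto
      next
        case 2
        have "p = c"
        proof (rule ccontr)
          assume "p \<noteq> c"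
          have "ccw a p c \<or> ccw c p a" using \<open>p \<noteq> c\<close> *(1)[unfolded 2] q' unfolding ccw_def by linarith
          then show False using nc q' unfolding 2 crosses_ccw by blast
        qed
        then show ?thesis using * 2 by auto
      qed
    qed
  next
    assume ?R
    then consider "triangle_arrow n S X Y" "\<not> (X = {b, c} \<and> Y = {a, b})" "\<not> (X = {d, a} \<and> Y = {c, d})"
      | "X = {a, b}" "Y = {d, a}" | "X = {c, d}" "Y = {b, c}" by blast
    then show ?L
    proof cases
      case 1
      then obtain p r s where *: "ccw p r s" "X = {p, r}" "Y = {p, s}" "{r, s} \<in> edges n S"
        unfolding triangle_arrow_def by blast
      have "{r, s} \<noteq> {a, c}"
      proof
        assume eq: "{r, s} = {a, c}"
        then consider "r = a" "s = c" | "r = c" "s = a" unfolding doubleton_eq_iff by blast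
        then show False
        proof cases
          assume rs: "r = a" "s = c"
          have "opposite_vertex n S c p a" "opposite_vertex n S c d a"
            using * X Y q' ccw_rotate rs unfolding opposite_vertex_def by (metis insert_commute)+
          then have "p = d" using opposite_vertex_unique[OF S] by blast
          then show False using 1(3) * rs by (metis insert_commute)
        next
          assume rs: "r = c" "s = a"
          have "opposite_vertex n S a p c" "opposite_vertex n S a b c"
            using * X Y q' ccw_rotate rs unfolding opposite_vertex_def by (metis insert_commute)+
          then have "p = b" using opposite_vertex_unique[OF S] by blast
          then show False using 1(2) * rs by (metis insert_commute)
        qed
      qed
      then have "{r, s} \<in> edges n (S(k := {b, d}))" using edges_flip_keep[OF *(4)] Sk by simp
      then show ?thesis using * unfolding triangle_arrow_def by blast
    next
      case 2
      then show ?thesis using edges_flip_new[OF kn, of "{b, d}" S] ccws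
        by (intro triangle_arrowI[of a b d]) (metis insert_commute)+
    next
      case 3
      moreover have "{d, b} \<in> edges n (S(k := {b, d}))" using edges_flip_new[OF kn, of "{b, d}" S] by (metis insert_commute)
      ultimately show ?thesis using ccws
        by (intro triangle_arrowI[of c d b]) (metis insert_commute)+
    qed
  qed
qed

text \<open>Away from k only arrows between sides of the quadrilateral can change. A path through k
  between two sides of an old triangle is opposite to an existing arrow, and both cancel; a path
  between two sides of a new triangle produces a new arrow, since these sides were not joined
  before.\<close>

lemma mutate_triangulation_quiver:
  assumes S: "triangulation n S" and q: "quadrilateral n S k a b c d"
    and S': "triangulation n (S(k := {b, d}))"
  shows "mutate_quiver k (triangulation_quiver n S) = triangulation_quiver n (S(k := {b, d}))"
proof (intro ext)
  fix i j
  note q' = q[unfolded quadrilateral_def]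
  have kn: "k \<in> {1..n}" and Sk: "S k = {a, c}" using q' by auto
  note qf = quadrilateral_flip[OF q]
  have ccws: "ccw b c d" "ccw d a b" "ccw b c a" "ccw d a c"
    using q' unfolding ccw_def by linarith+
  have d: "a \<noteq> b" "b \<noteq> c" "a \<noteq> c" "c \<noteq> d" "d \<noteq> a" "b \<noteq> d"
    using ccws ccw_distinct by blast+
  let ?Q = "triangulation_quiver n S" and ?Q' = "triangulation_quiver n (S(k := {b, d}))"
  let ?ar = "triangle_arrow n S"
  have E: "S i \<in> edges n S" if "i \<in> {1..n}" for i using that by (auto simp: edges_def)
  have ac: "{a, c} \<in> edges n S" using E[OF kn] Sk by simp
  have Ek: "S i \<noteq> S k" if "i \<noteq> k" "i \<in> {1..n}" for i
    using S that kn unfolding triangulation_def by (metis inj_onD)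
  show "mutate_quiver k ?Q i j = ?Q' i j"
  proof (cases "i \<in> {1..n} \<and> j \<in> {1..n}")
    case False
    then have "?Q i j = 0" "?Q j i = 0" "?Q i k * ?Q k j = 0" "?Q j k * ?Q k i = 0" "?Q' i j = 0"
      unfolding triangulation_quiver_arrow
      by (cases "i \<in> {1..n}"; simp del: atLeastAtMost_iff)+
    then show ?thesis unfolding mutate_quiver_def by auto
  next
    case True
    then have i: "i \<in> {1..n}" and j: "j \<in> {1..n}" by auto
    note out = triangle_arrow_from[OF S q] and inc = triangle_arrow_to[OF S q]
    note out' = triangle_arrow_from[OF S' qf] and inc' = triangle_arrow_to[OF S' qf]
    consider "i = k" "j = k" | "i = k" "j \<noteq> k" | "i \<noteq> k" "j = k" | "i \<noteq> k" "j \<noteq> k" by blast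
    then show ?thesis
    proof cases
      case 1
      then show ?thesis
        by (simp add: mutate_quiver_def triangulation_quiver_arrow triangle_arrow_irrefl)
    next
      case 2
      have "S j \<in> edges n (S(k := {b, d}))" using edges_flip_keep[OF E[OF j] Ek[OF 2(2) j]] .
      then have "triangle_arrow n (S(k := {b, d})) {b, d} (S j) \<longleftrightarrow> ?ar (S j) {a, c}"
        using out'[of "S j"] inc[OF E[OF j]] by (metis insert_commute)
      then show ?thesis using 2 Sk
        by (simp add: mutate_quiver_def triangulation_quiver_arrow)
    next
      case 3
      have "S i \<in> edges n (S(k := {b, d}))" using edges_flip_keep[OF E[OF i] Ek[OF 3(1) i]] .
      then have "triangle_arrow n (S(k := {b, d})) (S i) {b, d} \<longleftrightarrow> ?ar {a, c} (S i)"
        using inc'[of "S i"] out[OF E[OF i]] by (metis insert_commute)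
      then show ?thesis using 3 Sk
        by (simp add: mutate_quiver_def triangulation_quiver_arrow)
    next
      case 4
      define X Y where XY: "X = S i" "Y = S j"
      have XE: "X \<in> edges n S" "Y \<in> edges n S" using E i j XY by auto
      define AB BC CD DA where sides: "AB = {a, b}" "BC = {b, c}" "CD = {c, d}" "DA = {d, a}"
      have dist: "AB \<noteq> BC" "AB \<noteq> CD" "AB \<noteq> DA" "BC \<noteq> CD" "BC \<noteq> DA" "CD \<noteq> DA"
        unfolding sides doubleton_eq_iff using d by auto
      have "crosses {a, c} {b, d}" unfolding crosses_ccw using q' by blast
      then have bdS: "{b, d} \<notin> edges n S" using edges_not_crosses[OF S ac] by blast
      have F: "triangle_arrow n (S(k := {b, d})) X Y \<longleftrightarrow>
          ?ar X Y \<and> \<not> (X = BC \<and> Y = AB) \<and> \<not> (X = DA \<and> Y = CD) \<or>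
          X = AB \<and> Y = DA \<or> X = CD \<and> Y = BC"
        unfolding sides by (rule triangle_arrow_flip[OF S q XE])
      have t: "?ar X {a, c} \<longleftrightarrow> X = AB \<or> X = CD" "?ar Y {a, c} \<longleftrightarrow> Y = AB \<or> Y = CD"
        "?ar {a, c} X \<longleftrightarrow> X = DA \<or> X = BC" "?ar {a, c} Y \<longleftrightarrow> Y = DA \<or> Y = BC"
        unfolding sides using out inc XE by blast+
      have r: "?ar BC AB"
        unfolding sides using ccws ac
        by (intro triangle_arrowI[of b c a]) (metis insert_commute)+
      have r': "?ar DA CD"
        unfolding sides using ccws ac
        by (intro triangle_arrowI[of d a c]) (metis insert_commute)+
      \<comment> \<open>Two sides that meet in a or in c would need \<open>{b, d}\<close> as third
        side, which is not an edge before the flip.\<close>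
      have nr: "\<not> ?ar Z W" if "{Z, W} = {{p, b}, {p, d}}" "p \<noteq> b" "p \<noteq> d" for Z W p
      proof
        assume "?ar Z W"
        then obtain u v w where *: "ccw u v w" "Z = {u, v}" "W = {u, w}" "{v, w} \<in> edges n S"
          unfolding triangle_arrow_def by blast
        have "u \<noteq> v" "v \<noteq> w" "u \<noteq> w" using * ccw_distinct by auto
        moreover have "Z = {p, b} \<and> W = {p, d} \<or> Z = {p, d} \<and> W = {p, b}"
          using that(1) unfolding doubleton_eq_iff by blast
        ultimately have "{v, w} = {b, d}"
          using * that(2,3) d(6) by (metis doubleton_eq_iff)
        then show False using * bdS by simp
      qed
      have nr': "\<not> ?ar AB DA" "\<not> ?ar DA AB" "\<not> ?ar CD BC" "\<not> ?ar BC CD"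
        unfolding sides by (rule nr[of _ _ a] nr[of _ _ c]; use d in blast)+
      have as: "\<not> ?ar AB BC" "\<not> ?ar CD DA" using r r' triangle_arrow_asym by blast+
      have vals: "?Q i j = of_bool (?ar X Y)" "?Q j i = of_bool (?ar Y X)"
        "?Q i k = of_bool (X = AB \<or> X = CD)" "?Q k j = of_bool (Y = DA \<or> Y = BC)"
        "?Q j k = of_bool (Y = AB \<or> Y = CD)" "?Q k i = of_bool (X = DA \<or> X = BC)"
        "?Q' i j = of_bool (triangle_arrow n (S(k := {b, d})) X Y)"
        using i j kn 4 t Sk by (simp_all add: triangulation_quiver_arrow XY)
      have "mutate_quiver k ?Q i j = (?Q i j + ?Q i k * ?Q k j) - (?Q j i + ?Q j k * ?Q k i)"
        using 4 by (simp add: mutate_quiver_def)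
      also have "\<dots> = ?Q' i j"
      proof (cases "X \<in> {AB, BC, CD, DA} \<and> Y \<in> {AB, BC, CD, DA}")
        case True
        then show ?thesis unfolding vals F insert_iff empty_iff simp_thms
          using r r' nr' as dist triangle_arrow_irrefl[of n S]
            triangle_arrow_asym[of n S AB CD] triangle_arrow_asym[of n S BC DA]
          by (elim conjE disjE) (simp_all add: dist[symmetric])
      next
        case False
        then have z: "?Q i k * ?Q k j = 0" "?Q j k * ?Q k i = 0"
          and F': "triangle_arrow n (S(k := {b, d})) X Y \<longleftrightarrow> ?ar X Y"
          unfolding vals F by auto
        show ?thesis unfolding z vals(1,2,7) F' using triangle_arrow_asym[of n S X Y] by simp
      qed
      finally show ?thesis .
    qed
  qed
qed

section \<open>Lambda lengths\<close>

definition det2 :: "'a::comm_ring \<times> 'a \<Rightarrow> 'a \<times> 'a \<Rightarrow> 'a" where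
  "det2 u v = fst u * snd v - snd u * fst v"

lemma det2_plucker: "det2 a c * det2 b d = det2 a b * det2 c d + det2 a d * det2 b c"
  by (simp add: det2_def algebra_simps)

text \<open>Models subtraction-freeness in an arbitrary field: whatever is built from members by
  sums, products and quotients is nonzero.\<close>

definition positive_cone :: "'a::field set \<Rightarrow> bool" where
  "positive_cone P \<longleftrightarrow> 0 \<notin> P \<and> 1 \<in> P \<and>
     (\<forall>x\<in>P. \<forall>y\<in>P. x + y \<in> P \<and> x * y \<in> P \<and> x / y \<in> P)"

text \<open>Since the three determinants attached to a triangle determine its third vertex, the vectors
  can be chosen triangle by triangle.\<close>

lemma interval_vectors_exist:
  fixes w :: "nat set \<Rightarrow> 'a::field"
  assumes S: "triangulation n S" and P: "positive_cone P"
    and w: "\<And>D. D \<in> edges n S \<Longrightarrow> w D \<in> P"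
    and "{lo, hi} \<in> edges n S" "lo < hi" "hi < n + 3" "det2 u0 u1 = w {lo, hi}"
  shows "\<exists>v. v lo = u0 \<and> v hi = u1 \<and> (\<forall>a b. lo \<le> a \<longrightarrow> a < b \<longrightarrow> b \<le> hi \<longrightarrow>
    det2 (v a) (v b) \<in> P \<and> ({a, b} \<in> edges n S \<longrightarrow> det2 (v a) (v b) = w {a, b}))"
  using assms(4-)
proof (induction "hi - lo" arbitrary: lo hi u0 u1 rule: less_induct)
  case less
  have P0: "x \<noteq> 0" if "x \<in> P" for x using P that by (auto simp: positive_cone_def)
  have Padd: "x + y \<in> P" and Pmul: "x * y \<in> P" and Pdiv: "x / y \<in> P" if "x \<in> P" "y \<in> P" for x y
    using P that by (auto simp: positive_cone_def)
  show ?case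
  proof (cases "hi = lo + 1")
    case True
    have "det2 (((\<lambda>_. u0)(hi := u1)) a) (((\<lambda>_. u0)(hi := u1)) b) = w {a, b} \<and> {a, b} \<in> edges n S"
      if "lo \<le> a" "a < b" "b \<le> hi" for a b
    proof -
      have "a = lo" "b = hi" using that True by auto
      then show ?thesis using less.prems by simp
    qed
    then show ?thesis using True w less.prems(2)
      by (intro exI[of _ "(\<lambda>_. u0)(hi := u1)"]) auto
  next
    case False
    have "ccw lo (lo + 1) hi" "lo + 1 < n + 3" using less.prems False by (auto simp: ccw_def)
    then obtain m where "opposite_vertex n S lo m hi"
      using opposite_vertex_exists[OF S less.prems(1)] by blast
    then have m: "lo < m" "m < hi" "{lo, m} \<in> edges n S" "{m, hi} \<in> edges n S"
      using less.prems by (auto simp: opposite_vertex_def ccw_def)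
    \<comment> \<open>Cramer's rule: these coefficients are forced by the two prescribed
      determinants of u with \<open>u0\<close> and \<open>u1\<close>.\<close>
    define u where "u = (w {m, hi} / w {lo, hi} * fst u0 + w {lo, m} / w {lo, hi} * fst u1,
      w {m, hi} / w {lo, hi} * snd u0 + w {lo, m} / w {lo, hi} * snd u1)"
    have wp: "w {lo, hi} \<in> P" "w {lo, m} \<in> P" "w {m, hi} \<in> P" using w m less.prems by auto
    have "det2 u0 u = w {lo, m} / w {lo, hi} * det2 u0 u1"
      unfolding det2_def u_def by (simp add: algebra_simps diff_divide_distrib)
    then have d0: "det2 u0 u = w {lo, m}" using less.prems P0[OF wp(1)] by simp
    have "det2 u u1 = w {m, hi} / w {lo, hi} * det2 u0 u1"
      unfolding det2_def u_def by (simp add: algebra_simps diff_divide_distrib)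
    then have d1: "det2 u u1 = w {m, hi}" using less.prems P0[OF wp(1)] by simp
    have "\<exists>v. v lo = u0 \<and> v m = u \<and> (\<forall>a b. lo \<le> a \<longrightarrow> a < b \<longrightarrow> b \<le> m \<longrightarrow>
      det2 (v a) (v b) \<in> P \<and> ({a, b} \<in> edges n S \<longrightarrow> det2 (v a) (v b) = w {a, b}))"
      by (rule less.hyps) (use m d0 less.prems in auto)
    then obtain v1 where v1: "v1 lo = u0" "v1 m = u" "\<And>a b. lo \<le> a \<Longrightarrow> a < b \<Longrightarrow> b \<le> m \<Longrightarrow>
      det2 (v1 a) (v1 b) \<in> P \<and> ({a, b} \<in> edges n S \<longrightarrow> det2 (v1 a) (v1 b) = w {a, b})"
      by blast
    have "\<exists>v. v m = u \<and> v hi = u1 \<and> (\<forall>a b. m \<le> a \<longrightarrow> a < b \<longrightarrow> b \<le> hi \<longrightarrow>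
      det2 (v a) (v b) \<in> P \<and> ({a, b} \<in> edges n S \<longrightarrow> det2 (v a) (v b) = w {a, b}))"
      by (rule less.hyps) (use m d1 less.prems in auto)
    then obtain v2 where v2: "v2 m = u" "v2 hi = u1" "\<And>a b. m \<le> a \<Longrightarrow> a < b \<Longrightarrow> b \<le> hi \<Longrightarrow>
      det2 (v2 a) (v2 b) \<in> P \<and> ({a, b} \<in> edges n S \<longrightarrow> det2 (v2 a) (v2 b) = w {a, b})"
      by blast
    define v where "v = (\<lambda>k. if k \<le> m then v1 k else v2 k)"
    have vm: "v m = u" "v lo = u0" "v hi = u1" using v1 v2 m by (auto simp: v_def)
    have vl: "det2 (v a) (v b) \<in> P \<and> ({a, b} \<in> edges n S \<longrightarrow> det2 (v a) (v b) = w {a, b})"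
      if "lo \<le> a" "a < b" "b \<le> m" for a b using v1(3)[of a b] that by (simp add: v_def)
    have v_right: "v k = v2 k" if "m \<le> k" for k using that v1 v2 by (simp add: v_def)
    have vr: "det2 (v a) (v b) \<in> P \<and> ({a, b} \<in> edges n S \<longrightarrow> det2 (v a) (v b) = w {a, b})"
      if "m \<le> a" "a < b" "b \<le> hi" for a b using v2(3)[of a b] that by (simp add: v_right)
    have dlh: "det2 (v lo) (v hi) = w {lo, hi}" using vm less.prems by simp
    \<comment> \<open>Membership in P across m: the Pluecker relations for lo, m, b, hi and then for
      lo, a, m, b express these determinants without subtraction by known ones.\<close>
    have vlb: "det2 (v lo) (v b) \<in> P" if "m < b" "b \<le> hi" for b
    proof (cases "b = hi")
      case True
      then show ?thesis using dlh wp by simp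
    next
      case False
      have "det2 (v lo) (v b) * det2 (v m) (v hi) =
          det2 (v lo) (v m) * det2 (v b) (v hi) + det2 (v lo) (v hi) * det2 (v m) (v b)"
        by (rule det2_plucker)
      moreover have "\<dots> \<in> P"
        using vl[of lo m] vr[of b hi] vr[of m b] dlh wp m that False by (intro Padd Pmul) auto
      moreover have mh: "det2 (v m) (v hi) \<in> P" using vr[of m hi] m by blast
      ultimately have "det2 (v lo) (v b) * det2 (v m) (v hi) / det2 (v m) (v hi) \<in> P"
        using Pdiv by presburger
      then show ?thesis using P0[OF mh] by simp
    qed
    have vab: "det2 (v a) (v b) \<in> P" if "lo \<le> a" "a < m" "m < b" "b \<le> hi" for a b
    proof (cases "a = lo")
      case True
      then show ?thesis using vlb that by simp
    next
      case False
      have "det2 (v lo) (v m) * det2 (v a) (v b) =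
          det2 (v lo) (v a) * det2 (v m) (v b) + det2 (v lo) (v b) * det2 (v a) (v m)"
        by (rule det2_plucker)
      moreover have "\<dots> \<in> P"
        using vl[of lo a] vl[of a m] vr[of m b] vlb[of b] that False by (intro Padd Pmul) auto
      moreover have lm: "det2 (v lo) (v m) \<in> P" using vl[of lo m] m by blast
      ultimately have "det2 (v lo) (v m) * det2 (v a) (v b) / det2 (v lo) (v m) \<in> P"
        using Pdiv by presburger
      then show ?thesis using P0[OF lm] by simp
    qed
    have "det2 (v a) (v b) \<in> P \<and> ({a, b} \<in> edges n S \<longrightarrow> det2 (v a) (v b) = w {a, b})"
      if "lo \<le> a" "a < b" "b \<le> hi" for a b
    proof -
      consider "b \<le> m" | "m \<le> a" | "a < m" "m < b" by linarith
      then show ?thesis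
      proof cases
        case 3
        \<comment> \<open>\<open>{lo, hi}\<close> is the only edge within the interval that passes
          over m, so no other value is prescribed across m.\<close>
        have "a = lo \<and> b = hi" if e: "{a, b} \<in> edges n S"
        proof -
          have "\<not> crosses {lo, m} {a, b}" "\<not> crosses {a, b} {m, hi}"
            using edges_not_crosses[OF S] e m by auto
          then show ?thesis
            using 3 \<open>lo \<le> a\<close> \<open>b \<le> hi\<close> m crosses_linear[of lo m a b] crosses_linear[of a b m hi]
            by auto
        qed
        then show ?thesis using vab dlh 3 that by auto
      qed (use vl vr that in auto)
    qed
    then show ?thesis using vm by blast
  qed
qed

text \<open>Lambda lengths: Penner's coordinates with all sides of the polygon of length one.\<close>

definition lambda_lengths :: "nat \<Rightarrow> (nat set \<Rightarrow> 'a::field) \<Rightarrow> bool" where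
  "lambda_lengths n L \<longleftrightarrow>
     (\<forall>D\<in>polygon_sides n. L D = 1) \<and> (\<forall>D\<in>chords n. L D \<noteq> 0) \<and>
     (\<forall>a b c d. ccw a b c \<longrightarrow> ccw c d a \<longrightarrow> {a, c} \<in> chords n \<longrightarrow> {b, d} \<in> chords n \<longrightarrow>
        L {a, c} * L {b, d} = L {a, b} * L {c, d} + L {a, d} * L {b, c})"

lemma lambda_lengths_exist:
  fixes x :: "nat \<Rightarrow> 'a::field"
  assumes S: "triangulation n S" and P: "positive_cone P" and x: "\<And>i. x i \<in> P"
  shows "\<exists>L. lambda_lengths n L \<and> (\<forall>i\<in>{1..n}. L (S i) = x i)"
proof -
  define w where "w = (\<lambda>D. if D \<in> polygon_sides n then 1 else x (THE i. i \<in> {1..n} \<and> S i = D))"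
  have wS: "w (S i) = x i" if "i \<in> {1..n}" for i
  proof -
    have "(THE j. j \<in> {1..n} \<and> S j = S i) = i"
      using that S unfolding triangulation_def inj_on_def by (intro the_equality) blast+
    moreover have "S i \<notin> polygon_sides n" using S that by (auto simp: triangulation_def diagonals_eq)
    ultimately show ?thesis by (simp add: w_def)
  qed
  have wP: "w D \<in> P" if "D \<in> edges n S" for D
    using P x by (auto simp: w_def positive_cone_def)
  have side: "{0, n + 2} \<in> polygon_sides n" using polygon_sides_linear[of 0 "n + 2" n] by simp
  then have side': "{0, n + 2} \<in> edges n S" by (simp add: edges_def)
  have d01: "det2 (1, 0) (0, 1) = w {0, n + 2}" using side by (simp add: det2_def w_def)
  have "(0::nat) < n + 2" "n + 2 < n + 3" by simp_all
  from interval_vectors_exist[where w = w, OF S P wP side' this d01]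
  obtain v where v: "\<And>a b. a < b \<Longrightarrow> b \<le> n + 2 \<Longrightarrow> det2 (v a) (v b) \<in> P"
    "\<And>a b. a < b \<Longrightarrow> b \<le> n + 2 \<Longrightarrow> {a, b} \<in> edges n S \<Longrightarrow> det2 (v a) (v b) = w {a, b}"
    by auto
  \<comment> \<open>The determinant is antisymmetric; sorting the endpoints fixes the sign for which
    all values lie in P.\<close>
  define L where "L = (\<lambda>D. det2 (v (Min D)) (v (Max D)))"
  have L: "L {a, b} = det2 (v a) (v b)" "L {b, a} = det2 (v a) (v b)" if "a < b" for a b :: nat
    using that by (auto simp: L_def min_def max_def)
  have Lw: "L D = w D" if "D \<in> edges n S" for D
  proof -
    have "D \<in> chords n" using edges_subset_chords[OF S] that by blast
    then obtain p q where "D = {p, q}" "p < q" "q < n + 3" by (rule chordsE)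
    then show ?thesis using L v(2)[of p q] that by auto
  qed
  have "L {a, c} * L {b, d} = L {a, b} * L {c, d} + L {a, d} * L {b, c}"
    if "ccw a b c" "ccw c d a" for a b c d
  proof -
    \<comment> \<open>A cyclically ordered quadruple may have any of its four members as the
      smallest label; each case is the Pluecker relation of the sorted quadruple.\<close>
    have "a < b \<and> b < c \<and> c < d \<or> b < c \<and> c < d \<and> d < a \<or>
        c < d \<and> d < a \<and> a < b \<or> d < a \<and> a < b \<and> b < c"
      using that unfolding ccw_def by linarith
    then consider "a < b" "b < c" "c < d" | "b < c" "c < d" "d < a" | "c < d" "d < a" "a < b"
      | "d < a" "a < b" "b < c" by blast
    then show ?thesis
    proof cases
      case 1
      then have "a < c" "b < d" "a < d" by auto
      with 1 show ?thesis by (simp add: L det2_plucker[of "v a" "v c" "v b" "v d"])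
    next
      case 2
      then have "c < a" "b < d" "b < a" by auto
      with 2 show ?thesis using det2_plucker[of "v b" "v d" "v c" "v a"] by (simp add: L algebra_simps)
    next
      case 3
      then have "c < a" "d < b" "c < b" by auto
      with 3 show ?thesis using det2_plucker[of "v c" "v a" "v d" "v b"] by (simp add: L algebra_simps)
    next
      case 4
      then have "a < c" "d < b" "d < c" by auto
      with 4 show ?thesis using det2_plucker[of "v d" "v b" "v a" "v c"] by (simp add: L algebra_simps)
    qed
  qed
  moreover have "L D = 1" if "D \<in> polygon_sides n" for D
    using that Lw[of D] by (simp add: edges_def w_def)
  moreover have "L D \<noteq> 0" if D: "D \<in> chords n" for D
  proof -
    obtain p q where pq: "D = {p, q}" "p < q" "q < n + 3" using D by (rule chordsE)
    then have "L D \<in> P" using L v(1)[of p q] by auto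
    then show ?thesis using P by (auto simp: positive_cone_def)
  qed
  moreover have "L (S i) = x i" if "i \<in> {1..n}" for i
    using Lw[of "S i"] wS[OF that] that by (simp add: edges_def)
  ultimately have "lambda_lengths n L \<and> (\<forall>i\<in>{1..n}. L (S i) = x i)"
    unfolding lambda_lengths_def by blast
  then show ?thesis by blast
qed

section \<open>Subtraction-free rational functions\<close>

definition positive_polys :: "((nat \<Rightarrow>\<^sub>0 nat) \<Rightarrow>\<^sub>0 rat) set" where
  "positive_polys = {f. f \<noteq> 0 \<and> (\<forall>m. Poly_Mapping.lookup f m \<ge> 0)}"

lemma positive_polys_add: "f \<in> positive_polys \<Longrightarrow> g \<in> positive_polys \<Longrightarrow> f + g \<in> positive_polys"
proof -
  assume f: "f \<in> positive_polys" and g: "g \<in> positive_polys"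
  then obtain m where m: "Poly_Mapping.lookup f m \<noteq> 0"
    unfolding positive_polys_def by (metis (mono_tags, lifting) mem_Collect_eq poly_mapping_eqI lookup_zero)
  then have "Poly_Mapping.lookup (f + g) m \<noteq> 0"
    using f g unfolding positive_polys_def lookup_add
    by (metis (mono_tags, lifting) add_nonneg_eq_0_iff mem_Collect_eq)
  then have "f + g \<noteq> 0" by auto
  then show ?thesis using f g by (simp add: positive_polys_def lookup_add)
qed

lemma Sum_any_nonneg:
  fixes f :: "'a \<Rightarrow> 'b::ordered_comm_monoid_add"
  shows "(\<And>x. f x \<ge> 0) \<Longrightarrow> Sum_any f \<ge> 0"
  by (simp add: Sum_any.expand_set sum_nonneg)

lemma positive_polys_mult: "f \<in> positive_polys \<Longrightarrow> g \<in> positive_polys \<Longrightarrow> f * g \<in> positive_polys"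
  unfolding positive_polys_def
  by (auto simp: lookup_mult when_def intro!: Sum_any_nonneg mult_nonneg_nonneg)

definition positive_ratfuns :: "ratfun set" where
  "positive_ratfuns = {Fract f g | f g. f \<in> positive_polys \<and> g \<in> positive_polys}"

lemma positive_polys_single: "Poly_Mapping.single m 1 \<in> positive_polys"
  by (simp add: positive_polys_def lookup_single when_def) (metis lookup_single_eq lookup_zero zero_neq_one)

lemma positive_cone_ratfuns: "positive_cone positive_ratfuns"
proof -
  have ne: "f \<noteq> 0" if "f \<in> positive_polys" for f using that by (simp add: positive_polys_def)
  note closed = positive_polys_add positive_polys_mult
  have one: "1 \<in> positive_polys" using positive_polys_single[of 0] by (simp add: single_one)
  have "0 \<notin> positive_ratfuns"
  proof
    assume "0 \<in> positive_ratfuns"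
    then obtain f g where "0 = Fract f g" "f \<in> positive_polys" "g \<in> positive_polys"
      unfolding positive_ratfuns_def by blast
    then show False using ne[of f] ne[of g] by (simp add: Zero_fract_def eq_fract)
  qed
  moreover have "1 \<in> positive_ratfuns"
    unfolding positive_ratfuns_def One_fract_def using one by blast
  moreover have "x + y \<in> positive_ratfuns \<and> x * y \<in> positive_ratfuns \<and> x / y \<in> positive_ratfuns"
    if "x \<in> positive_ratfuns" "y \<in> positive_ratfuns" for x y
  proof -
    obtain f g where x: "x = Fract f g" "f \<in> positive_polys" "g \<in> positive_polys"
      using \<open>x \<in> positive_ratfuns\<close> unfolding positive_ratfuns_def by blast
    obtain f' g' where y: "y = Fract f' g'" "f' \<in> positive_polys" "g' \<in> positive_polys"
      using \<open>y \<in> positive_ratfuns\<close> unfolding positive_ratfuns_def by blast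
    have "x + y = Fract (f * g' + f' * g) (g * g')" "x * y = Fract (f * f') (g * g')"
      "x / y = Fract (f * g') (g * f')"
      using x y ne by (simp_all add: add_fract mult_fract divide_fract)
    then show ?thesis
      unfolding positive_ratfuns_def using closed x y by blast
  qed
  ultimately show ?thesis by (simp add: positive_cone_def)
qed

lemma xvar_positive: "xvar i \<in> positive_ratfuns"
  unfolding positive_ratfuns_def xvar_def using positive_polys_single[of 0] positive_polys_single
  by (auto simp: single_one)

text \<open>The exchange monomials multiply over diagonals only. Sides of the polygon have length 1,
  so the result is right even if X or Y is a side.\<close>

lemma prod_edge_lengths:
  assumes S: "triangulation n S" and L: "lambda_lengths n L"
    and "X \<in> edges n S" "Y \<in> edges n S" "X \<noteq> Y"
  shows "(\<Prod>j=1..n. L (S j) ^ of_bool (S j = X \<or> S j = Y)) = L X * L Y"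
proof -
  have one: "(\<Prod>j=1..n. L (S j) ^ of_bool (S j = Z)) = L Z" if "Z \<in> edges n S" for Z
  proof (cases "Z \<in> S ` {1..n}")
    case True
    then obtain i where i: "i \<in> {1..n}" "Z = S i" by blast
    have "S j = Z \<longleftrightarrow> j = i" if "j \<in> {1..n}" for j
      using S i that unfolding triangulation_def by (metis inj_onD)
    then have "(\<Prod>j=1..n. L (S j) ^ of_bool (S j = Z)) = (\<Prod>j=1..n. if j = i then L (S i) else 1)"
      by (intro prod.cong refl) (simp add: of_bool_def)
    then show ?thesis using i by simp
  next
    case False
    then have "L Z = 1" using that L by (auto simp: edges_def lambda_lengths_def)
    moreover have "(\<Prod>j=1..n. L (S j) ^ of_bool (S j = Z)) = 1"
    proof (rule prod.neutral, rule ballI)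
      fix j assume "j \<in> {1..n}"
      then have "S j \<noteq> Z" using False by blast
      then show "L (S j) ^ of_bool (S j = Z) = 1" by simp
    qed
    ultimately show ?thesis by simp
  qed
  have "(\<Prod>j=1..n. L (S j) ^ of_bool (S j = X \<or> S j = Y)) =
      (\<Prod>j=1..n. L (S j) ^ of_bool (S j = X) * L (S j) ^ of_bool (S j = Y))"
    using assms(5) by (intro prod.cong refl) (simp add: of_bool_def)
  then show ?thesis using one assms(3,4) by (simp add: prod.distrib)
qed

text \<open>Invariant along flips: the arrows at k pick out the two pairs of opposite sides of the
  quadrilateral, so the exchange relation is the Ptolemy relation of L. The variable of a diagonal
  is thus independent of the flips that lead to it.\<close>

lemma triangulated_seed_lambda_lengths:
  assumes L: "lambda_lengths n L" and T: "triangulation n T" and LT: "\<And>i. i \<in> {1..n} \<Longrightarrow> L (T i) = xvar i"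
    and seed: "triangulated_seed n Q T u R S" and Q: "triangulation_quiver n T = Q"
  shows "triangulation n S \<and> R = triangulation_quiver n S \<and> (\<forall>i\<in>{1..n}. u i = L (S i))"
  using seed
proof (induction rule: triangulated_seed.induct)
  case initial
  then show ?case using T LT Q by simp
next
  case (flip u R S k D)
  then have S: "triangulation n S" and R: "R = triangulation_quiver n S"
    and u: "\<And>i. i \<in> {1..n} \<Longrightarrow> u i = L (S i)" by auto
  obtain a b c d where q: "quadrilateral n S k a b c d" and D: "D = {b, d}"
    using flip_quadrilateral[OF S flip.hyps(4,2,3)] by blast
  note q' = q[unfolded quadrilateral_def]
  have S': "triangulation n (S(k := {b, d}))" using flip.hyps(4) D by simp
  have Sk: "S k = {a, c}" and kn: "k \<in> {1..n}" using q' by auto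
  have E: "S j \<in> edges n S" if "j \<in> {1..n}" for j using that by (simp add: edges_def)
  have ne: "a \<noteq> b" "b \<noteq> c" "a \<noteq> c" "c \<noteq> d" "d \<noteq> a" using q' ccw_distinct by blast+
  have "u k * L {b, d} = L {a, b} * L {c, d} + L {d, a} * L {b, c}"
  proof -
    have "{a, c} \<in> chords n" using edges_subset_chords[OF S] E[OF kn] Sk by auto
    moreover have "{b, d} \<in> chords n" using S' kn
      unfolding triangulation_def diagonals_eq by (metis DiffD1 fun_upd_same)
    moreover have "{d, a} = {a, d}" by blast
    ultimately show ?thesis using L q' u[OF kn] Sk unfolding lambda_lengths_def by metis
  qed
  moreover have "u k \<noteq> 0" using u[OF kn] L E[OF kn] edges_subset_chords[OF S]
    unfolding lambda_lengths_def by auto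
  ultimately have new: "(L {a, b} * L {c, d} + L {d, a} * L {b, c}) / u k = L {b, d}"
    by (simp add: nonzero_divide_eq_eq mult.commute)
  have in_k: "R j k = of_bool (S j = {a, b} \<or> S j = {c, d})"
    and out_k: "R k j = of_bool (S j = {d, a} \<or> S j = {b, c})" if "j \<in> {1..n}" for j
    using triangle_arrow_to[OF S q E[OF that]] triangle_arrow_from[OF S q E[OF that]] that kn
    unfolding R triangulation_quiver_arrow Sk by simp_all
  have "(\<Prod>j=1..n. u j ^ R j k) = (\<Prod>j=1..n. L (S j) ^ of_bool (S j = {a, b} \<or> S j = {c, d}))"
    using u in_k by (intro prod.cong refl) simp
  also have "\<dots> = L {a, b} * L {c, d}"
    using q' ne by (intro prod_edge_lengths S L) (auto simp: doubleton_eq_iff)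
  finally have p1: "(\<Prod>j=1..n. u j ^ R j k) = L {a, b} * L {c, d}" .
  have "(\<Prod>j=1..n. u j ^ R k j) = (\<Prod>j=1..n. L (S j) ^ of_bool (S j = {d, a} \<or> S j = {b, c}))"
    using u out_k by (intro prod.cong refl) simp
  also have "\<dots> = L {d, a} * L {b, c}"
    using q' ne by (intro prod_edge_lengths S L) (auto simp: doubleton_eq_iff)
  finally have p2: "(\<Prod>j=1..n. u j ^ R k j) = L {d, a} * L {b, c}" .
  have "mutate_cluster n k R u i = L ((S(k := D)) i)" if "i \<in> {1..n}" for i
    using u[OF that] new unfolding mutate_cluster_def p1 p2 D by (cases "i = k") simp_all
  moreover have "mutate_quiver k R = triangulation_quiver n (S(k := D))"
    unfolding R D by (rule mutate_triangulation_quiver[OF S q S'])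
  ultimately show ?case using S' unfolding D by blast
qed

lemma has_d_vector_lambda_lengths:
  assumes L: "lambda_lengths n L" and T: "triangulation n T" and LT: "\<And>i. i \<in> {1..n} \<Longrightarrow> L (T i) = xvar i"
    and Q: "triangulation_quiver n T = Q" and "has_d_vector n Q T z a"
  shows "\<exists>C mult. C \<subseteq> diagonals n \<and> (\<forall>D\<in>C. \<forall>E\<in>C. \<not> crosses D E) \<and> (\<forall>D\<in>C. mult D > 0) \<and>
    z = (\<Prod>D\<in>C. L D ^ mult D) \<and>
    (\<forall>i\<in>{1..n}. a i = (\<Sum>D\<in>C. int (mult D) * crossing_number D (T i)))"
proof -
  obtain C mult X where C: "C \<subseteq> diagonals n" "\<forall>D\<in>C. \<forall>E\<in>C. \<not> crosses D E"
    and X: "\<forall>D\<in>C. mult D > (0::nat) \<and> diagonal_variable n Q T D (X D)"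
    and z: "z = (\<Prod>D\<in>C. X D ^ mult D)"
    and a: "\<forall>i\<in>{1..n}. a i = (\<Sum>D\<in>C. int (mult D) * crossing_number D (T i))"
    using assms(5) unfolding has_d_vector_def by blast
  have "X D = L D" if "D \<in> C" for D
  proof -
    have "diagonal_variable n Q T D (X D)" using X that by simp
    then obtain u R S i where *: "triangulated_seed n Q T u R S" "i \<in> {1..n}" "S i = D" "u i = X D"
      unfolding diagonal_variable_def by metis
    have "u i = L (S i)" using triangulated_seed_lambda_lengths[OF L T LT *(1) Q] *(2) by blast
    then show ?thesis using *(3,4) by metis
  qed
  then have "z = (\<Prod>D\<in>C. L D ^ mult D)" unfolding z by (intro prod.cong) simp_all
  moreover have "\<forall>D\<in>C. mult D > 0" using X by simp
  ultimately show ?thesis using C a by (intro exI[of _ C] exI[of _ mult]) simp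
qed

section \<open>Expansion of a single curve\<close>

lemma sum_PiE_insert:
  assumes "p \<notin> A"
  shows "(\<Sum>s\<in>insert p A \<rightarrow>\<^sub>E B. f s) = (\<Sum>b\<in>B. \<Sum>s\<in>A \<rightarrow>\<^sub>E B. f (s(p := b)))"
proof -
  have "(\<Sum>s\<in>insert p A \<rightarrow>\<^sub>E B. f s) = (\<Sum>(b, s)\<in>B \<times> (A \<rightarrow>\<^sub>E B). f (s(p := b)))"
    unfolding PiE_insert_eq
    by (subst sum.reindex) (use inj_combinator[OF assms, of "\<lambda>_. B"] in \<open>auto simp: case_prod_unfold\<close>)
  then show ?thesis by (simp add: sum.cartesian_product)
qed

lemma sum_PiE_Un:
  assumes "A \<inter> B = {}"
  shows "(\<Sum>s\<in>A \<union> B \<rightarrow>\<^sub>E C. f s) =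
    (\<Sum>u\<in>A \<rightarrow>\<^sub>E C. \<Sum>v\<in>B \<rightarrow>\<^sub>E C. f (\<lambda>i. if i \<in> A then u i else v i))"
proof -
  have "(\<Sum>s\<in>A \<union> B \<rightarrow>\<^sub>E C. f s) =
      (\<Sum>(u, v)\<in>(A \<rightarrow>\<^sub>E C) \<times> (B \<rightarrow>\<^sub>E C). f (\<lambda>i. if i \<in> A then u i else v i))"
  proof (rule sum.reindex_bij_witness[where j = "\<lambda>s. (restrict s A, restrict s B)"
        and i = "\<lambda>(u, v) i. if i \<in> A then u i else v i"])
    fix s assume s: "s \<in> A \<union> B \<rightarrow>\<^sub>E C"
    show *: "(case (restrict s A, restrict s B) of (u, v) \<Rightarrow> \<lambda>i. if i \<in> A then u i else v i) = s"
      using s by (auto simp: fun_eq_iff PiE_def extensional_def)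
    show "(restrict s A, restrict s B) \<in> (A \<rightarrow>\<^sub>E C) \<times> (B \<rightarrow>\<^sub>E C)" using s by auto
    show "(case (restrict s A, restrict s B) of (u, v) \<Rightarrow> f (\<lambda>i. if i \<in> A then u i else v i)) = f s"
      using * by simp
  next
    fix w assume w: "w \<in> (A \<rightarrow>\<^sub>E C) \<times> (B \<rightarrow>\<^sub>E C)"
    obtain u v where uv: "w = (u, v)" by fastforce
    then have u: "u \<in> A \<rightarrow>\<^sub>E C" and v: "v \<in> B \<rightarrow>\<^sub>E C" using w by auto
    show "(restrict (case w of (u, v) \<Rightarrow> \<lambda>i. if i \<in> A then u i else v i) A,
        restrict (case w of (u, v) \<Rightarrow> \<lambda>i. if i \<in> A then u i else v i) B) = w"
      using uv u v assms by (auto simp: fun_eq_iff PiE_def extensional_def)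
    show "(case w of (u, v) \<Rightarrow> \<lambda>i. if i \<in> A then u i else v i) \<in> A \<union> B \<rightarrow>\<^sub>E C"
      using uv u v by (auto simp: PiE_def extensional_def)
  qed
  then show ?thesis by (simp add: sum.cartesian_product)
qed

text \<open>The triangulation seen from the tip 0 of the root ear: diagonals are intervals of
  vertices, non-crossing is laminarity, and \<open>triangles\<close> says that below a diagonal lie
  either two polygon sides or two further diagonals. Of the lengths \<open>lam a b\<close>, used for
  a < b, only the Ptolemy relation, the value 1 on sides and nonvanishing on diagonals are
  kept.\<close>

locale rooted_dissection =
  fixes n i0 :: nat and lo hi :: "nat \<Rightarrow> nat" and lam :: "nat \<Rightarrow> nat \<Rightarrow> 'k::field"
  assumes bounds: "i \<in> {1..n} \<Longrightarrow> 1 \<le> lo i \<and> lo i + 2 \<le> hi i \<and> hi i \<le> n + 2"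
    and intervals_inj: "i \<in> {1..n} \<Longrightarrow> j \<in> {1..n} \<Longrightarrow> lo i = lo j \<Longrightarrow> hi i = hi j \<Longrightarrow> i = j"
    and laminar: "i \<in> {1..n} \<Longrightarrow> j \<in> {1..n} \<Longrightarrow> \<not> (lo i < lo j \<and> lo j < hi i \<and> hi i < hi j)"
    and root: "i0 \<in> {1..n}" "lo i0 = 1" "hi i0 = n + 2"
    and triangles: "i \<in> {1..n} \<Longrightarrow> hi i = lo i + 2 \<or> (\<exists>q\<in>{1..n}. \<exists>r\<in>{1..n}.
          hi q = hi i \<and> lo r = lo i \<and> lo q = hi r)"
    and ptolemy: "a < b \<Longrightarrow> b < c \<Longrightarrow> c < d \<Longrightarrow> d \<le> n + 2 \<Longrightarrow>
          lam a c * lam b d = lam a b * lam c d + lam a d * lam b c"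
    and lam_side: "a \<le> n + 1 \<Longrightarrow> lam a (Suc a) = 1" "lam 0 (n + 2) = 1"
    and lam_nonzero: "i \<in> {1..n} \<Longrightarrow> lam (lo i) (hi i) \<noteq> 0"
begin

definition x :: "nat \<Rightarrow> 'k" where
  "x i = lam (lo i) (hi i)"

text \<open>p is the top side, q its right and r its left part, \<open>hi r\<close> the vertex
  opposite to p. The order of the arguments is that of the 3-cycle p -> q -> r -> p of the
  quiver.\<close>

definition tri :: "nat \<Rightarrow> nat \<Rightarrow> nat \<Rightarrow> bool" where
  "tri p q r \<longleftrightarrow> p \<in> {1..n} \<and> q \<in> {1..n} \<and> r \<in> {1..n} \<and> hi q = hi p \<and> lo r = lo p \<and> lo q = hi r"

lemma triD:
  assumes "tri p q r"
  shows "p \<in> {1..n}" "q \<in> {1..n}" "r \<in> {1..n}" "hi q = hi p" "lo r = lo p" "lo q = hi r"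
    "lo p + 2 \<le> hi r" "hi r + 2 \<le> hi p" "1 \<le> lo p" "hi p \<le> n + 2"
  using assms bounds[of p] bounds[of q] bounds[of r] by (auto simp: tri_def)

lemma tri_or_leaf: "i \<in> {1..n} \<Longrightarrow> hi i = lo i + 2 \<or> (\<exists>q r. tri i q r)"
  using triangles[of i] unfolding tri_def by blast

text \<open>The vertex opposite to p separates everything strictly below p: laminarity against r
  forces the left end of j to be that of p, laminarity against q the right end.\<close>

lemma straddle:
  assumes t: "tri p q r" and j: "j \<in> {1..n}" "lo p \<le> lo j" "lo j < hi r" "hi r < hi j" "hi j \<le> hi p"
  shows "j = p"
proof -
  note d = triD[OF t]
  have "lo j = lo p" using laminar[OF d(3) j(1)] j d by linarith
  moreover have "hi j = hi p" using laminar[OF j(1) d(2)] j d by linarith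
  ultimately show ?thesis using intervals_inj j(1) d(1) by blast
qed

lemma tri_unique:
  assumes t: "tri p q r" "tri p q' r'"
  shows "q = q'" "r = r'"
proof -
  note d = triD[OF t(1)] and d' = triD[OF t(2)]
  have "hi r = hi r'"
    using laminar[OF d(3) d'(2)] laminar[OF d'(3) d(2)] d d' by linarith
  then show "q = q'" "r = r'"
    using intervals_inj[OF d(2) d'(2)] intervals_inj[OF d(3) d'(3)] d d' by simp_all
qed

text \<open>Laminarity leaves an interval at most one parent and one side on which it hangs, so the
  triangles form a binary tree.\<close>

lemma tri_parent_unique:
  "tri p q r \<Longrightarrow> tri p' q r' \<Longrightarrow> p = p'" "tri p q r \<Longrightarrow> tri p' q' r \<Longrightarrow> p = p'"
  "tri p q r \<Longrightarrow> tri p' q' q \<Longrightarrow> False"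
proof -
  assume t: "tri p q r" "tri p' q r'"
  note d = triD[OF t(1)] and d' = triD[OF t(2)]
  have "lo p = lo p'" using laminar[OF d(3) d'(1)] laminar[OF d'(3) d(1)] d d' by linarith
  then show "p = p'" using intervals_inj[OF d(1) d'(1)] d d' by simp
next
  assume t: "tri p q r" "tri p' q' r"
  note d = triD[OF t(1)] and d' = triD[OF t(2)]
  have "hi p = hi p'" using laminar[OF d(1) d'(2)] laminar[OF d'(1) d(2)] d d' by linarith
  then show "p = p'" using intervals_inj[OF d(1) d'(1)] d d' by simp
next
  assume t: "tri p q r" "tri p' q' q"
  note d = triD[OF t(1)] and d' = triD[OF t(2)]
  show False using laminar[OF d(1) d'(1)] d d' by linarith
qed

text \<open>The shortest other interval around i is too long for a leaf, and its middle vertex does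
  not lie inside i. So i is contained in one of the two parts, and minimality makes it that
  part.\<close>

lemma parent_exists:
  assumes i: "i \<in> {1..n}" "i \<noteq> i0"
  shows "\<exists>p j. tri p i j \<or> tri p j i"
proof -
  let ?A = "\<lambda>p. p \<in> {1..n} \<and> lo p \<le> lo i \<and> hi i \<le> hi p \<and> p \<noteq> i"
  have "?A i0" using root bounds[OF i(1)] i by simp
  then obtain p where p: "?A p" and min: "\<And>p'. ?A p' \<Longrightarrow> hi p - lo p \<le> hi p' - lo p'"
    using ex_has_least_nat[of ?A i0 "\<lambda>p. hi p - lo p"] by blast
  have "hi p \<noteq> lo p + 2"
    using p bounds[OF i(1)] intervals_inj[OF i(1), of p] by auto
  then obtain q r where t: "tri p q r" using tri_or_leaf p by blast
  note d = triD[OF t]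
  consider "hi r \<le> lo i" | "hi i \<le> hi r" | "lo i < hi r" "hi r < hi i" by linarith
  then show ?thesis
  proof cases
    case 1
    then have "q = i" using min[of q] d p by fastforce
    then show ?thesis using t by blast
  next
    case 2
    then have "r = i" using min[of r] d p by fastforce
    then show ?thesis using t by blast
  next
    case 3
    then show ?thesis using straddle[OF t i(1)] p by blast
  qed
qed

text \<open>The diagonals met by a curve that comes from above p, enters through p and ends at the
  vertex y below it.\<close>

definition cuts :: "nat \<Rightarrow> nat \<Rightarrow> nat set" where
  "cuts p y = {j \<in> {1..n}. lo p \<le> lo j \<and> lo j < y \<and> y < hi j \<and> hi j \<le> hi p}"

lemma finite_cuts: "finite (cuts p y)"
  by (simp add: cuts_def)

lemma cuts_leaf: "p \<in> {1..n} \<Longrightarrow> hi p = lo p + 2 \<Longrightarrow> lo p < y \<Longrightarrow> y < hi p \<Longrightarrow> cuts p y = {p}"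
  using intervals_inj[of p] bounds by (force simp: cuts_def)

lemma cuts_mid:
  assumes t: "tri p q r"
  shows "cuts p (hi r) = {p}"
proof -
  note d = triD[OF t]
  show ?thesis using d straddle[OF t] by (auto simp: cuts_def)
qed

lemma cuts_right:
  assumes t: "tri p q r" and y: "hi r < y" "y < hi p"
  shows "cuts p y = insert p (cuts q y)" "p \<notin> cuts q y"
proof -
  note d = triD[OF t]
  have "j = p \<or> hi r \<le> lo j" if "j \<in> cuts p y" for j
    using straddle[OF t, of j] that y by (force simp: cuts_def)
  then show "cuts p y = insert p (cuts q y)" using d y by (auto simp: cuts_def)
  show "p \<notin> cuts q y" using d by (simp add: cuts_def)
qed

lemma cuts_left:
  assumes t: "tri p q r" and y: "lo p < y" "y < hi r"
  shows "cuts p y = insert p (cuts r y)" "p \<notin> cuts r y"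
proof -
  note d = triD[OF t]
  have "j = p \<or> hi j \<le> hi r" if "j \<in> cuts p y" for j
    using straddle[OF t, of j] that y by (force simp: cuts_def)
  then show "cuts p y = insert p (cuts r y)" using d y by (auto simp: cuts_def)
  show "p \<notin> cuts r y" using d by (simp add: cuts_def)
qed

text \<open>Contribution of one 3-cycle i -> j -> k -> i and one curve to the exponent of
  \<open>x i\<close>. The last term is the \<open>sigma\<close> of a single curve, 1 exactly if it
  crosses both j and k; the value is then \<open>s k - s j\<close>, which is -1 only in the
  forbidden state.\<close>

definition corner_exponent :: "nat set \<Rightarrow> (nat \<Rightarrow> nat) \<Rightarrow> nat \<Rightarrow> nat \<Rightarrow> int" where
  "corner_exponent J s j k = (if j \<in> J then 1 - int (s j) else 0) + (if k \<in> J then int (s k) else 0)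
     - (if j \<in> J \<and> k \<in> J then 1 else 0)"

definition bad :: "nat set \<Rightarrow> (nat \<Rightarrow> nat) \<Rightarrow> nat \<Rightarrow> nat \<Rightarrow> bool" where
  "bad J s i j \<longleftrightarrow> i \<in> J \<and> j \<in> J \<and> s i = 1 \<and> s j = 0"

text \<open>For an allowed state of a curve the three exponents select a single side of the
  triangle: with p and q crossed, the states (0,0), (0,1), (1,1) give \<open>x p\<close>,
  \<open>x r\<close>, \<open>x q\<close>. A triangle that is missed has weight 1.\<close>

definition triangle_weight :: "nat set \<Rightarrow> (nat \<Rightarrow> nat) \<Rightarrow> nat \<Rightarrow> nat \<Rightarrow> nat \<Rightarrow> 'k" where
  "triangle_weight J s p q r = (if bad J s p q \<or> bad J s q r \<or> bad J s r p then 0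
     else x p powi corner_exponent J s q r * x q powi corner_exponent J s r p
        * x r powi corner_exponent J s p q)"

text \<open>A triangle is booked at its top side, so that a product over all diagonals runs over all
  triangles; a leaf is bounded below by two sides of length 1.\<close>

definition weight :: "nat set \<Rightarrow> (nat \<Rightarrow> nat) \<Rightarrow> nat \<Rightarrow> 'k" where
  "weight J s p = (if \<exists>q r. tri p q r
     then triangle_weight J s p (THE q. \<exists>r. tri p q r) (THE r. \<exists>q. tri p q r) else 1)"

lemma weight_tri: "tri p q r \<Longrightarrow> weight J s p = triangle_weight J s p q r"
proof -
  assume t: "tri p q r"
  then have "(THE q. \<exists>r. tri p q r) = q" "(THE r. \<exists>q. tri p q r) = r"
    using tri_unique by (intro the_equality; blast)+
  then show ?thesis using t by (auto simp: weight_def)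
qed

lemma weight_leaf: "hi p = lo p + 2 \<Longrightarrow> weight J s p = 1"
  using triD(7,8)[of p] by (fastforce simp: weight_def)

lemma weight_cong:
  assumes "\<And>k. k \<in> {1..n} \<Longrightarrow> lo p \<le> lo k \<Longrightarrow> hi k \<le> hi p \<Longrightarrow> s k = s' k"
  shows "weight J s p = weight J s' p"
proof (cases "\<exists>q r. tri p q r")
  case True
  then obtain q r where t: "tri p q r" by blast
  note d = triD[OF t]
  have "s p = s' p" "s q = s' q" "s r = s' r" using d by (auto intro!: assms)
  then show ?thesis
    by (simp add: weight_tri[OF t] triangle_weight_def bad_def corner_exponent_def)
qed (simp add: weight_def)

lemma weight_trivial:
  assumes "\<And>q r. tri p q r \<Longrightarrow> p \<notin> J \<and> q \<notin> J \<and> r \<notin> J"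
  shows "weight J s p = 1"
proof (cases "\<exists>q r. tri p q r")
  case True
  then obtain q r where t: "tri p q r" by blast
  then show ?thesis using assms[OF t]
    by (simp add: weight_tri[OF t] triangle_weight_def bad_def corner_exponent_def)
qed (simp add: weight_def)

text \<open>The state on a crossed interval \<open>p\<close> records the endpoint at which the crossing is resolved:
  seen from below, state 0 selects \<open>lo p\<close> and state 1 selects \<open>hi p\<close>.\<close>

lemma state_sum_below:
  assumes "p \<in> {1..n}" "lo p < y" "y < hi p"
    and "\<And>j. j \<in> {1..n} \<Longrightarrow> lo p \<le> lo j \<Longrightarrow> hi j \<le> hi p \<Longrightarrow> j \<in> J \<longleftrightarrow> lo j < y \<and> y < hi j"
  shows "(\<Sum>s\<in>cuts p y \<rightarrow>\<^sub>E {0, 1}. g (s p) * (\<Prod>j\<in>cuts p y. weight J s j)) =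
    (g 0 * lam (lo p) y + g 1 * lam y (hi p)) * (\<Prod>j\<in>cuts p y - {p}. x j)"
  using assms
proof (induction "hi p - lo p" arbitrary: p g rule: less_induct)
  case less
  note J = less.prems(4)
  have pJ: "p \<in> J" using J less.prems by auto
  consider "hi p = lo p + 2" | q r where "tri p q r" using tri_or_leaf less.prems(1) by blast
  then show ?case
  proof cases
    case 1
    then have c: "cuts p y = {p}" using cuts_leaf less.prems by blast
    have "y = Suc (lo p)" "hi p = Suc y" "hi p \<le> n + 2" using 1 less.prems bounds[of p] by auto
    then have "lam (lo p) y = 1" "lam y (hi p) = 1" using lam_side(1) by auto
    then show ?thesis unfolding c by (simp add: sum_PiE_insert weight_leaf[OF 1])
  next
    case 2
    note t = 2
    note d = triD[OF t]
    have qJ: "q \<in> J \<longleftrightarrow> hi r < y" and rJ: "r \<in> J \<longleftrightarrow> y < hi r"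
      using J[of q] J[of r] d less.prems by auto
    have w: "weight J s p = triangle_weight J s p q r" for s by (rule weight_tri[OF t])
    have pq: "p \<noteq> q" "p \<noteq> r" "q \<noteq> r" using d by auto
    consider "y = hi r" | "hi r < y" | "y < hi r" by linarith
    then show ?thesis
    proof cases
      case 1
      then have c: "cuts p y = {p}" using cuts_mid[OF t] by simp
      have "lam (lo p) y = x r" "lam y (hi p) = x q" using 1 d by (simp_all add: x_def)
      then show ?thesis unfolding c using 1 pJ qJ rJ pq
        by (simp add: sum_PiE_insert w triangle_weight_def bad_def corner_exponent_def)
    next
      case 2
      note c = cuts_right[OF t 2 less.prems(3)]
      have qc: "q \<in> cuts q y" using d 2 less.prems by (simp add: cuts_def)
      let ?P = "\<lambda>s. \<Prod>j\<in>cuts q y. weight J s j"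
      have P: "?P (s(p := b)) = ?P s" for s b
        using d by (intro prod.cong refl weight_cong) (auto simp: cuts_def)
      \<comment> \<open>Only the states of p and of the part entered next occur in the weight of
        this triangle; h tabulates it.\<close>
      define h where "h = (\<lambda>b b'. weight J ((\<lambda>_. b')(p := b)) p)"
      have h: "weight J (s(p := b)) p = h b (s q)" for s b
        using pq rJ 2 unfolding h_def w triangle_weight_def bad_def corner_exponent_def by auto
      have hv: "h 0 0 = x p" "h 0 1 = x r" "h 1 0 = 0" "h 1 1 = x q"
        using pq pJ qJ rJ 2 unfolding h_def w triangle_weight_def bad_def corner_exponent_def by auto
      \<comment> \<open>The coefficient function is arbitrary so that the weight of the triangle
        above q can be absorbed into it.\<close>
      have IH: "(\<Sum>s\<in>cuts q y \<rightarrow>\<^sub>E {0, 1}. k (s q) * ?P s) =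
          (k 0 * lam (lo q) y + k 1 * lam y (hi q)) * (\<Prod>j\<in>cuts q y - {q}. x j)" for k
        using d 2 less.prems by (intro less.hyps) auto
      have ins: "(\<Prod>j\<in>insert p (cuts q y). weight J (s(p := b)) j) = h b (s q) * ?P s" for s b
        using c(2) finite_cuts P h by simp
      have "(\<Sum>s\<in>cuts p y \<rightarrow>\<^sub>E {0, 1}. g (s p) * (\<Prod>j\<in>cuts p y. weight J s j)) =
          (\<Sum>b\<in>{0, 1}. \<Sum>s\<in>cuts q y \<rightarrow>\<^sub>E {0, 1}. (g b * h b (s q)) * ?P s)"
        unfolding c(1) sum_PiE_insert[OF c(2)] ins by (simp add: mult.assoc)
      also have "\<dots> = (\<Sum>b\<in>{0, 1}. (g b * h b 0 * lam (lo q) y + g b * h b 1 * lam y (hi q)) *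
          (\<Prod>j\<in>cuts q y - {q}. x j))"
        unfolding IH[of "\<lambda>b'. g _ * h _ b'"] ..
      also have "\<dots> = (g 0 * (x p * lam (lo q) y + x r * lam y (hi q)) + g 1 * (x q * lam y (hi q))) *
          (\<Prod>j\<in>cuts q y - {q}. x j)"
        using hv by (simp add: algebra_simps)
      also have "x p * lam (lo q) y + x r * lam y (hi q) = lam (lo p) y * x q"
        using ptolemy[of "lo p" "hi r" y "hi p"] d 2 less.prems by (simp add: x_def algebra_simps)
      also have "(g 0 * (lam (lo p) y * x q) + g 1 * (x q * lam y (hi q))) *
          (\<Prod>j\<in>cuts q y - {q}. x j) =
          (g 0 * lam (lo p) y + g 1 * lam y (hi p)) * (x q * (\<Prod>j\<in>cuts q y - {q}. x j))"
        using d by (simp add: algebra_simps)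
      also have "x q * (\<Prod>j\<in>cuts q y - {q}. x j) = (\<Prod>j\<in>cuts p y - {p}. x j)"
        using c qc finite_cuts by (simp add: prod.remove[of _ q])
      finally show ?thesis .
    next
      case 3
      note c = cuts_left[OF t less.prems(2) 3]
      have rc: "r \<in> cuts r y" using d 3 less.prems by (simp add: cuts_def)
      let ?P = "\<lambda>s. \<Prod>j\<in>cuts r y. weight J s j"
      have P: "?P (s(p := b)) = ?P s" for s b
        using d by (intro prod.cong refl weight_cong) (auto simp: cuts_def)
      define h where "h = (\<lambda>b b'. weight J ((\<lambda>_. b')(p := b)) p)"
      have h: "weight J (s(p := b)) p = h b (s r)" for s b
        using pq qJ 3 unfolding h_def w triangle_weight_def bad_def corner_exponent_def by auto
      have hv: "h 0 0 = x r" "h 0 1 = 0" "h 1 0 = x q" "h 1 1 = x p"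
        using pq pJ qJ rJ 3 unfolding h_def w triangle_weight_def bad_def corner_exponent_def by auto
      have IH: "(\<Sum>s\<in>cuts r y \<rightarrow>\<^sub>E {0, 1}. k (s r) * ?P s) =
          (k 0 * lam (lo r) y + k 1 * lam y (hi r)) * (\<Prod>j\<in>cuts r y - {r}. x j)" for k
        using d 3 less.prems by (intro less.hyps) auto
      have ins: "(\<Prod>j\<in>insert p (cuts r y). weight J (s(p := b)) j) = h b (s r) * ?P s" for s b
        using c(2) finite_cuts P h by simp
      have "(\<Sum>s\<in>cuts p y \<rightarrow>\<^sub>E {0, 1}. g (s p) * (\<Prod>j\<in>cuts p y. weight J s j)) =
          (\<Sum>b\<in>{0, 1}. \<Sum>s\<in>cuts r y \<rightarrow>\<^sub>E {0, 1}. (g b * h b (s r)) * ?P s)"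
        unfolding c(1) sum_PiE_insert[OF c(2)] ins by (simp add: mult.assoc)
      also have "\<dots> = (\<Sum>b\<in>{0, 1}. (g b * h b 0 * lam (lo r) y + g b * h b 1 * lam y (hi r)) *
          (\<Prod>j\<in>cuts r y - {r}. x j))"
        unfolding IH[of "\<lambda>b'. g _ * h _ b'"] ..
      also have "\<dots> = (g 0 * (x r * lam (lo r) y) + g 1 * (x q * lam (lo r) y + x p * lam y (hi r))) *
          (\<Prod>j\<in>cuts r y - {r}. x j)"
        using hv by (simp add: algebra_simps)
      also have "x q * lam (lo r) y + x p * lam y (hi r) = lam y (hi p) * x r"
        using ptolemy[of "lo p" y "hi r" "hi p"] d 3 less.prems by (simp add: x_def algebra_simps)
      also have "(g 0 * (x r * lam (lo r) y) + g 1 * (lam y (hi p) * x r)) *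
          (\<Prod>j\<in>cuts r y - {r}. x j) =
          (g 0 * lam (lo p) y + g 1 * lam y (hi p)) * (x r * (\<Prod>j\<in>cuts r y - {r}. x j))"
        using d by (simp add: algebra_simps)
      also have "x r * (\<Prod>j\<in>cuts r y - {r}. x j) = (\<Prod>j\<in>cuts p y - {p}. x j)"
        using c rc finite_cuts by (simp add: prod.remove[of _ r])
      finally show ?thesis .
    qed
  qed
qed

end

context rooted_dissection
begin

section \<open>Expansion of the length of a chord\<close>

definition crossed :: "nat \<Rightarrow> nat \<Rightarrow> nat set" where
  "crossed X Y = {i \<in> {1..n}. X < lo i \<and> lo i < Y \<and> Y < hi i \<or> lo i < X \<and> X < hi i \<and> hi i < Y}"

definition admissible :: "nat \<Rightarrow> nat \<Rightarrow> bool" where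
  "admissible X Y \<longleftrightarrow> X + 2 \<le> Y \<and> Y \<le> n + 2 \<and> (X, Y) \<noteq> (0, n + 2) \<and>
     (\<forall>i\<in>{1..n}. (X, Y) \<noteq> (lo i, hi i))"

text \<open>Take the shortest interval containing both X and Y: its middle vertex lies strictly
  between them, as otherwise one of its parts would be a shorter choice. Its triangle is the topmost
  one met by the curve.\<close>

lemma top_triangle_exists:
  assumes "admissible X Y" "1 \<le> X"
  shows "\<exists>p q r. tri p q r \<and> lo p \<le> X \<and> Y \<le> hi p \<and> X < hi r \<and> hi r < Y"
proof -
  let ?A = "\<lambda>p. p \<in> {1..n} \<and> lo p \<le> X \<and> Y \<le> hi p"
  have "?A i0" using root assms by (simp add: admissible_def)
  then obtain p where p: "?A p" and min: "\<And>p'. ?A p' \<Longrightarrow> hi p - lo p \<le> hi p' - lo p'"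
    using ex_has_least_nat[of ?A i0 "\<lambda>p. hi p - lo p"] by blast
  have "hi p \<noteq> lo p + 2"
  proof
    assume "hi p = lo p + 2"
    then have "X = lo p \<and> Y = hi p" using p assms(1) unfolding admissible_def by linarith
    then show False using p assms(1) by (auto simp: admissible_def)
  qed
  then obtain q r where t: "tri p q r" using tri_or_leaf p by blast
  note d = triD[OF t]
  have "X < hi r" using min[of q] p d by fastforce
  moreover have "hi r < Y" using min[of r] p d by fastforce
  ultimately show ?thesis using t p by blast
qed

text \<open>From its topmost triangle the curve descends on both sides, through q towards Y and
  through r towards X; a branch is empty if the curve ends in that corner of the triangle.\<close>

lemma crossed_top:
  assumes t: "tri p q r" and p: "lo p \<le> X" "Y \<le> hi p" and m: "X < hi r" "hi r < Y"
  shows "crossed X Y = (if Y < hi p then cuts q Y else {}) \<union> (if lo p < X then cuts r X else {})"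
proof (intro equalityI subsetI)
  note d = triD[OF t]
  fix j assume "j \<in> crossed X Y"
  then have j: "j \<in> {1..n}" and "X < lo j \<and> lo j < Y \<and> Y < hi j \<or> lo j < X \<and> X < hi j \<and> hi j < Y"
    by (auto simp: crossed_def)
  then consider "X < lo j" "lo j < Y" "Y < hi j" | "lo j < X" "X < hi j" "hi j < Y" by blast
  then show "j \<in> (if Y < hi p then cuts q Y else {}) \<union> (if lo p < X then cuts r X else {})"
  proof cases
    case 1
    then have "hi j \<le> hi p" using laminar[OF d(1) j] p by linarith
    moreover have "hi r \<le> lo j" using straddle[OF t j] 1 m p \<open>hi j \<le> hi p\<close> by fastforce
    ultimately show ?thesis using 1 d j by (auto simp: cuts_def)
  next
    case 2
    then have "lo p \<le> lo j" using laminar[OF j d(1)] p by linarith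
    moreover have "hi j \<le> hi r" using straddle[OF t j] 2 m p \<open>lo p \<le> lo j\<close> by fastforce
    ultimately show ?thesis using 2 d j by (auto simp: cuts_def)
  qed
next
  note d = triD[OF t]
  fix j assume "j \<in> (if Y < hi p then cuts q Y else {}) \<union> (if lo p < X then cuts r X else {})"
  then show "j \<in> crossed X Y" using d p m by (auto simp: cuts_def crossed_def split: if_splits)
qed

text \<open>The parents of crossed intervals are crossed until the topmost triangle is reached. So
  only the triangles booked at crossed intervals and the topmost one can have a nontrivial
  weight.\<close>

lemma crossed_parent:
  assumes t: "tri p q r" and p: "lo p \<le> X" "Y \<le> hi p" and m: "X < hi r" "hi r < Y"
    and t': "tri p' q' r'"
    and "q' \<in> crossed X Y \<or> r' \<in> crossed X Y"
  shows "p' \<in> crossed X Y \<or> p' = p"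
proof -
  note d = triD[OF t] and d' = triD[OF t']
  have nested: "p' = p" if *: "lo p' \<le> X" "Y \<le> hi p'" "X < hi r'" "hi r' < Y"
  proof -
    have "lo p \<le> lo p' \<and> hi p' \<le> hi p \<or> lo p' \<le> lo p \<and> hi p \<le> hi p'"
      using laminar[OF d(1) d'(1)] laminar[OF d'(1) d(1)] p * by linarith
    then show ?thesis
    proof
      assume "lo p' \<le> lo p \<and> hi p \<le> hi p'"
      then show ?thesis using straddle[OF t' d(1)] p * by simp
    next
      assume "lo p \<le> lo p' \<and> hi p' \<le> hi p"
      then show ?thesis using straddle[OF t d'(1)] m * by simp
    qed
  qed
  have A: "p' \<in> crossed X Y \<or> p' = p" if "q' \<in> crossed X Y"
  proof -
    have "X < hi r' \<and> hi r' < Y \<and> Y < hi p' \<or> hi r' < X \<and> X < hi p' \<and> hi p' < Y"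
      using d' that by (auto simp: crossed_def)
    then show ?thesis using nested d' by (cases "X < lo p'") (auto simp: crossed_def)
  qed
  have B: "p' \<in> crossed X Y \<or> p' = p" if "r' \<in> crossed X Y"
  proof -
    have "X < lo p' \<and> lo p' < Y \<and> Y < hi r' \<or> lo p' < X \<and> X < hi r' \<and> hi r' < Y"
      using d' that by (auto simp: crossed_def)
    then show ?thesis using nested d' by (cases "hi p' < Y") (auto simp: crossed_def)
  qed
  show ?thesis using A B assms(7) by blast
qed

text \<open>If X is the tip 0, the curve enters through the root, and \<open>state_sum_below\<close>
  applies with constant coefficients. Otherwise the topmost triangle joins up to two descending
  branches, whose sums are glued by one or two Ptolemy relations.\<close>

theorem curve_expansion:
  assumes adm: "admissible X Y"
  shows "(\<Sum>s\<in>crossed X Y \<rightarrow>\<^sub>E {0, 1}. \<Prod>p=1..n. weight (crossed X Y) s p) =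
    lam X Y * (\<Prod>i\<in>crossed X Y. x i)"
proof (cases "X = 0")
  case True
  let ?J = "crossed X Y"
  have "X + 2 \<le> Y" "Y \<le> n + 2" "Y \<noteq> n + 2" using adm True unfolding admissible_def by simp_all
  then have Y: "1 < Y" "Y < n + 2" by linarith+
  have J: "?J = cuts i0 Y"
    unfolding crossed_def cuts_def root(2,3) True using bounds by (intro Collect_cong) fastforce
  have "p \<in> ?J" if t: "tri p q r" "q \<in> ?J \<or> r \<in> ?J" for p q r
    using t(2) triD[OF t(1)] unfolding True crossed_def by auto
  then have "weight ?J s p = 1" if "p \<notin> ?J" for s p
    using that by (intro weight_trivial) blast
  then have "(\<Prod>p=1..n. weight ?J s p) = (\<Prod>p\<in>?J. weight ?J s p)" for s
    by (intro prod.mono_neutral_right) (auto simp: crossed_def)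
  then have "(\<Sum>s\<in>?J \<rightarrow>\<^sub>E {0, 1}. \<Prod>p=1..n. weight ?J s p) =
      (\<Sum>s\<in>cuts i0 Y \<rightarrow>\<^sub>E {0, 1}. (\<lambda>_. 1) (s i0) * (\<Prod>j\<in>cuts i0 Y. weight ?J s j))"
    using J by simp
  also have "\<dots> = (lam 1 Y + lam Y (n + 2)) * (\<Prod>j\<in>?J - {i0}. x j)"
    using state_sum_below[of i0 Y ?J "\<lambda>_. 1"] root Y True unfolding J by (auto simp: cuts_def)
  \<comment> \<open>Ptolemy in the quadrilateral 0, 1, Y, n + 2, whose two sides at the tip 0 have
    length 1.\<close>
  also have "lam 1 Y + lam Y (n + 2) = lam X Y * x i0"
    using ptolemy[of 0 1 Y "n + 2"] Y True root lam_side(1)[of 0] lam_side(2) by (simp add: x_def)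
  also have "lam X Y * x i0 * (\<Prod>j\<in>?J - {i0}. x j) = lam X Y * (\<Prod>j\<in>?J. x j)"
    using root Y by (simp add: J cuts_def prod.remove[of _ i0])
  finally show ?thesis .
next
  case False
  let ?J = "crossed X Y"
  obtain p q r where t: "tri p q r" and p: "lo p \<le> X" "Y \<le> hi p" and m: "X < hi r" "hi r < Y"
    using top_triangle_exists[OF adm] False by auto
  note d = triD[OF t]
  have w: "weight J s p = triangle_weight J s p q r" for J s by (rule weight_tri[OF t])
  have pq: "p \<noteq> q" "p \<noteq> r" "q \<noteq> r" using d by auto
  have pJ: "p \<notin> ?J" using p by (auto simp: crossed_def)
  have qJ: "q \<in> ?J \<longleftrightarrow> Y < hi p" and rJ: "r \<in> ?J \<longleftrightarrow> lo p < X"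
    using d p m by (auto simp: crossed_def)
  note J = crossed_top[OF t p m]
  have finJ: "finite ?J" by (simp add: crossed_def)
  have "weight ?J s p' = 1" if "p' \<notin> insert p ?J" for s p'
    using that crossed_parent[OF t p m] by (intro weight_trivial) blast
  then have "(\<Prod>p'=1..n. weight ?J s p') = (\<Prod>p'\<in>insert p ?J. weight ?J s p')" for s
    using d by (intro prod.mono_neutral_right) (auto simp: crossed_def)
  then have total: "(\<Prod>p'=1..n. weight ?J s p') = weight ?J s p * (\<Prod>j\<in>?J. weight ?J s j)" for s
    using pJ finJ by simp
  have below_q: "(\<Sum>s\<in>cuts q Y \<rightarrow>\<^sub>E {0, 1}. g (s q) * (\<Prod>j\<in>cuts q Y. weight ?J s j)) =
      (g 0 * lam (hi r) Y + g 1 * lam Y (hi p)) * (\<Prod>j\<in>cuts q Y - {q}. x j)" if "Y < hi p" for g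
    using state_sum_below[of q Y ?J g] d m that by (auto simp: crossed_def)
  have below_r: "(\<Sum>s\<in>cuts r X \<rightarrow>\<^sub>E {0, 1}. g (s r) * (\<Prod>j\<in>cuts r X. weight ?J s j)) =
      (g 0 * lam (lo p) X + g 1 * lam X (hi r)) * (\<Prod>j\<in>cuts r X - {r}. x j)" if "lo p < X" for g
    using state_sum_below[of r X ?J g] d m that by (auto simp: crossed_def)
  have xq: "x q * (\<Prod>j\<in>cuts q Y - {q}. x j) = (\<Prod>j\<in>cuts q Y. x j)" if "Y < hi p"
    using d m that finite_cuts by (subst prod.remove[of "cuts q Y" q]) (auto simp: cuts_def)
  have xr: "x r * (\<Prod>j\<in>cuts r X - {r}. x j) = (\<Prod>j\<in>cuts r X. x j)" if "lo p < X"
    using d m that finite_cuts by (subst prod.remove[of "cuts r X" r]) (auto simp: cuts_def)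
  have "\<not> (X = lo p \<and> Y = hi p)" using adm d by (auto simp: admissible_def)
  then consider "X = lo p" "Y < hi p" | "lo p < X" "Y = hi p" | "lo p < X" "Y < hi p"
    using p by linarith
  then show ?thesis
  proof cases
    case 1
    then have Jq: "?J = cuts q Y" using J by simp
    define h where "h = (\<lambda>b. weight ?J (\<lambda>_. b) p)"
    have h: "weight ?J s p = h (s q)" for s
      using pJ qJ rJ 1 unfolding h_def w triangle_weight_def bad_def corner_exponent_def by auto
    have hv: "h 0 = x p" "h 1 = x r"
      using pJ qJ rJ 1 unfolding h_def w triangle_weight_def bad_def corner_exponent_def by auto
    have "(\<Sum>s\<in>?J \<rightarrow>\<^sub>E {0, 1}. \<Prod>p=1..n. weight ?J s p) =
        (\<Sum>s\<in>cuts q Y \<rightarrow>\<^sub>E {0, 1}. h (s q) * (\<Prod>j\<in>cuts q Y. weight ?J s j))"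
      unfolding total h using Jq by simp
    also have "\<dots> = (x p * lam (hi r) Y + x r * lam Y (hi p)) * (\<Prod>j\<in>cuts q Y - {q}. x j)"
      using below_q 1 hv by simp
    also have "x p * lam (hi r) Y + x r * lam Y (hi p) = lam X Y * x q"
      using ptolemy[of "lo p" "hi r" Y "hi p"] d m 1 by (simp add: x_def algebra_simps)
    finally show ?thesis using xq 1 Jq by (simp add: mult.assoc)
  next
    case 2
    then have Jr: "?J = cuts r X" using J by simp
    define h where "h = (\<lambda>b. weight ?J (\<lambda>_. b) p)"
    have h: "weight ?J s p = h (s r)" for s
      using pJ qJ rJ 2 unfolding h_def w triangle_weight_def bad_def corner_exponent_def by auto
    have hv: "h 0 = x q" "h 1 = x p"
      using pJ qJ rJ 2 unfolding h_def w triangle_weight_def bad_def corner_exponent_def by auto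
    have "(\<Sum>s\<in>?J \<rightarrow>\<^sub>E {0, 1}. \<Prod>p=1..n. weight ?J s p) =
        (\<Sum>s\<in>cuts r X \<rightarrow>\<^sub>E {0, 1}. h (s r) * (\<Prod>j\<in>cuts r X. weight ?J s j))"
      unfolding total h using Jr by simp
    also have "\<dots> = (x q * lam (lo p) X + x p * lam X (hi r)) * (\<Prod>j\<in>cuts r X - {r}. x j)"
      using below_r 2 hv by simp
    also have "x q * lam (lo p) X + x p * lam X (hi r) = lam X Y * x r"
      using ptolemy[of "lo p" X "hi r" "hi p"] d m 2 by (simp add: x_def algebra_simps)
    finally show ?thesis using xr 2 Jr by (simp add: mult.assoc)
  next
    case 3
    let ?A = "cuts q Y" and ?B = "cuts r X"
    have JAB: "?J = ?A \<union> ?B" using J 3 by simp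
    have dis: "?A \<inter> ?B = {}" using d bounds by (force simp: cuts_def)
    define h where "h = (\<lambda>a b. weight ?J ((\<lambda>_. b)(q := a)) p)"
    have h: "weight ?J s p = h (s q) (s r)" for s
      using pJ qJ rJ pq 3 unfolding h_def w triangle_weight_def bad_def corner_exponent_def by auto
    have hv: "h 0 0 = x q" "h 0 1 = x p" "h 1 0 = 0" "h 1 1 = x r"
      using pJ qJ rJ pq 3 unfolding h_def w triangle_weight_def bad_def corner_exponent_def by auto
    define mg where "mg = (\<lambda>u v i. if i \<in> ?A then u i else v i :: nat)"
    \<comment> \<open>The branches lie on different sides of the vertex \<open>hi r\<close>, so each
      branch product sees only its own states.\<close>
    have A_below: "k \<notin> ?B" if "j \<in> ?A" "k \<in> {1..n}" "lo j \<le> lo k" for j k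
      using that d bounds by (fastforce simp: cuts_def)
    have B_below: "k \<notin> ?A" if "j \<in> ?B" "k \<in> {1..n}" "hi k \<le> hi j" for j k
      using that d bounds by (fastforce simp: cuts_def)
    have PA: "(\<Prod>j\<in>?A. weight ?J (mg u v) j) = (\<Prod>j\<in>?A. weight ?J u j)"
      if "u \<in> ?A \<rightarrow>\<^sub>E {0, 1}" "v \<in> ?B \<rightarrow>\<^sub>E {0, 1}" for u v
    proof (intro prod.cong refl weight_cong)
      fix j k assume "j \<in> ?A" "k \<in> {1..n}" "lo j \<le> lo k"
      then have "k \<notin> ?B" using A_below by blast
      then show "mg u v k = u k" using that by (auto simp: mg_def PiE_def extensional_def)
    qed
    have PB: "(\<Prod>j\<in>?B. weight ?J (mg u v) j) = (\<Prod>j\<in>?B. weight ?J v j)" for u v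
      using B_below by (intro prod.cong refl weight_cong) (auto simp: mg_def)
    have qr: "q \<in> ?A" "r \<in> ?B" "r \<notin> ?A" using d m 3 by (auto simp: cuts_def)
    have "(\<Sum>s\<in>?J \<rightarrow>\<^sub>E {0, 1}. \<Prod>p=1..n. weight ?J s p) =
        (\<Sum>u\<in>?A \<rightarrow>\<^sub>E {0, 1}. \<Sum>v\<in>?B \<rightarrow>\<^sub>E {0, 1}.
          h (u q) (v r) * ((\<Prod>j\<in>?A. weight ?J u j) * (\<Prod>j\<in>?B. weight ?J v j)))"
    proof -
      have split: "(\<Prod>j\<in>?J. weight ?J s j) = (\<Prod>j\<in>?A. weight ?J s j) * (\<Prod>j\<in>?B. weight ?J s j)" for s
        using prod.union_disjoint[OF finite_cuts finite_cuts dis, of "weight ?J s"]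
        unfolding JAB[symmetric] .
      have merge: "(\<Sum>s\<in>?J \<rightarrow>\<^sub>E C. f s) = (\<Sum>u\<in>?A \<rightarrow>\<^sub>E C. \<Sum>v\<in>?B \<rightarrow>\<^sub>E C. f (mg u v))"
        for C and f :: "(nat \<Rightarrow> nat) \<Rightarrow> 'k"
        using sum_PiE_Un[OF dis, of f C] unfolding JAB[symmetric] mg_def .
      have "mg u v q = u q" "mg u v r = v r" for u v using qr by (simp_all add: mg_def)
      then show ?thesis
        unfolding total h split merge by (intro sum.cong refl) (simp only: PA PB)
    qed
    \<comment> \<open>The left branch is summed first; its value depends on the state of q alone and
      becomes part of the coefficient function for the right branch.\<close>
    also have "\<dots> = (\<Sum>u\<in>?A \<rightarrow>\<^sub>E {0, 1}.
        (\<Sum>v\<in>?B \<rightarrow>\<^sub>E {0, 1}. h (u q) (v r) * (\<Prod>j\<in>?B. weight ?J v j)) * (\<Prod>j\<in>?A. weight ?J u j))"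
      by (simp add: sum_distrib_right sum_distrib_left mult_ac)
    also have "\<dots> = (\<Sum>u\<in>?A \<rightarrow>\<^sub>E {0, 1}. ((h (u q) 0 * lam (lo p) X + h (u q) 1 * lam X (hi r)) *
        (\<Prod>j\<in>?B - {r}. x j)) * (\<Prod>j\<in>?A. weight ?J u j))"
      using 3 below_r[of "h _"] by simp
    also have "\<dots> = (x q * lam (lo p) X + x p * lam X (hi r)) * (\<Prod>j\<in>?B - {r}. x j) * lam (hi r) Y *
          (\<Prod>j\<in>?A - {q}. x j) +
        (x r * lam X (hi r)) * (\<Prod>j\<in>?B - {r}. x j) * lam Y (hi p) * (\<Prod>j\<in>?A - {q}. x j)"
      using 3 below_q[of "\<lambda>a. (h a 0 * lam (lo p) X + h a 1 * lam X (hi r)) * (\<Prod>j\<in>?B - {r}. x j)"] hv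
      by (simp add: algebra_simps)
    also have "x q * lam (lo p) X + x p * lam X (hi r) = lam X (hi p) * x r"
      using ptolemy[of "lo p" X "hi r" "hi p"] d m 3 by (simp add: x_def algebra_simps)
    also have "lam X (hi p) * x r * (\<Prod>j\<in>?B - {r}. x j) * lam (hi r) Y * (\<Prod>j\<in>?A - {q}. x j) +
        (x r * lam X (hi r)) * (\<Prod>j\<in>?B - {r}. x j) * lam Y (hi p) * (\<Prod>j\<in>?A - {q}. x j) =
        (lam X (hi p) * lam (hi r) Y + lam X (hi r) * lam Y (hi p)) *
        (x r * (\<Prod>j\<in>?B - {r}. x j)) * (\<Prod>j\<in>?A - {q}. x j)"
      by (simp add: algebra_simps)
    also have "lam X (hi p) * lam (hi r) Y + lam X (hi r) * lam Y (hi p) = lam X Y * x q"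
      using ptolemy[of X "hi r" Y "hi p"] d m 3 by (simp add: x_def algebra_simps)
    also have "lam X Y * x q * (x r * (\<Prod>j\<in>?B - {r}. x j)) * (\<Prod>j\<in>?A - {q}. x j) =
        lam X Y * ((x q * (\<Prod>j\<in>?A - {q}. x j)) * (x r * (\<Prod>j\<in>?B - {r}. x j)))"
      by (simp add: algebra_simps)
    also have "\<dots> = lam X Y * (\<Prod>j\<in>?J. x j)"
      using 3 xq xr dis finite_cuts unfolding JAB by (simp add: prod.union_disjoint)
    finally show ?thesis .
  qed
qed

end

section \<open>Monomials and quivers of a rooted dissection\<close>

lemma power_int_sum:
  fixes z :: "'a::field"
  assumes "z \<noteq> 0"
  shows "z powi (\<Sum>i\<in>A. f i) = (\<Prod>i\<in>A. z powi f i)"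
  by (induction A rule: infinite_finite_induct) (auto simp: power_int_add assms)

context rooted_dissection
begin

definition cyc :: "nat \<Rightarrow> nat \<Rightarrow> nat \<Rightarrow> bool" where
  "cyc i j k \<longleftrightarrow> tri i j k \<or> tri j k i \<or> tri k i j"

lemma cyc_rotate: "cyc i j k \<longleftrightarrow> cyc j k i"
  unfolding cyc_def by blast

lemma cyc_carrier: "cyc i j k \<Longrightarrow> i \<in> {1..n} \<and> j \<in> {1..n} \<and> k \<in> {1..n}"
  unfolding cyc_def tri_def by blast

definition len :: "nat \<Rightarrow> nat" where
  "len i = hi i - lo i"

lemma tri_len: "tri p q r \<Longrightarrow> len q < len p \<and> len r < len p"
  using triD[of p q r] unfolding len_def by linarith

lemma cyc_unique: "cyc i j k \<Longrightarrow> cyc i j k' \<Longrightarrow> k = k'"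
  unfolding cyc_def
  by (elim disjE) (metis tri_unique tri_parent_unique tri_len less_asym' less_trans less_irrefl_nat)+

text \<open>Arrows are read off full triangles of diagonals. Density ensures, in
  \<open>triangulation_quiver_arrows\<close>, that no arrow of the triangulation quiver is
  lost.\<close>

definition arrows :: quiver where
  "arrows i j = (if \<exists>k. cyc i j k then 1 else 0)"

text \<open>The three arrows could come from three different triangles; uniqueness of parents and
  comparison of lengths along the tree exclude this.\<close>

lemma three_cycle_arrows: "three_cycle arrows i j k \<longleftrightarrow> cyc i j k"
proof
  assume "cyc i j k"
  then show "three_cycle arrows i j k"
    using cyc_rotate unfolding three_cycle_def arrows_def by (metis zero_less_one)
next
  assume "three_cycle arrows i j k"
  then obtain i' j' k' where *: "cyc i j k'" "cyc j k i'" "cyc k i j'"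
    unfolding three_cycle_def arrows_def by (auto split: if_splits)
  show "cyc i j k"
  proof (rule ccontr)
    assume n: "\<not> cyc i j k"
    then have nt: "\<not> tri i j k" "\<not> tri j k i" "\<not> tri k i j" unfolding cyc_def by auto
    from *[unfolded cyc_def] nt show False
      by (elim disjE) (metis tri_unique tri_parent_unique tri_len less_trans less_irrefl_nat)+
  qed
qed

text \<open>Each arrow into or out of i lies in exactly one 3-cycle, so the three sums in
  \<open>gcs_exponent\<close> can all be taken over this one index set.\<close>

definition cyc_pairs :: "nat \<Rightarrow> (nat \<times> nat) set" where
  "cyc_pairs i = {(j, k). cyc i j k}"

lemma finite_cyc_pairs: "finite (cyc_pairs i)"
  by (rule finite_subset[of _ "{1..n} \<times> {1..n}"]) (auto simp: cyc_pairs_def dest: cyc_carrier)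

lemma sum_arrows_out:
  "(\<Sum>j=1..n. real (arrows i j) * f j) = (\<Sum>(j, k)\<in>cyc_pairs i. f j)"
proof -
  have inj: "inj_on fst (cyc_pairs i)"
    using cyc_unique by (auto simp: inj_on_def cyc_pairs_def)
  have "(\<Sum>(j, k)\<in>cyc_pairs i. f j) = (\<Sum>j\<in>fst ` cyc_pairs i. real (arrows i j) * f j)"
    unfolding sum.reindex[OF inj] by (intro sum.cong refl) (auto simp: cyc_pairs_def arrows_def)
  also have "\<dots> = (\<Sum>j=1..n. real (arrows i j) * f j)"
    by (rule sum.mono_neutral_left) (force simp: cyc_pairs_def arrows_def dest: cyc_carrier)+
  finally show ?thesis ..
qed

lemma sum_arrows_in:
  "(\<Sum>k=1..n. real (arrows k i) * f k) = (\<Sum>(j, k)\<in>cyc_pairs i. f k)"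
proof -
  have rot: "cyc i j k \<longleftrightarrow> cyc k i j" for j k using cyc_rotate by blast
  have inj: "inj_on snd (cyc_pairs i)"
    using cyc_unique rot by (fastforce simp: inj_on_def cyc_pairs_def)
  have "(\<Sum>(j, k)\<in>cyc_pairs i. f k) = (\<Sum>k\<in>snd ` cyc_pairs i. real (arrows k i) * f k)"
    unfolding sum.reindex[OF inj] by (intro sum.cong refl) (auto simp: cyc_pairs_def arrows_def rot)
  also have "\<dots> = (\<Sum>k=1..n. real (arrows k i) * f k)"
    by (rule sum.mono_neutral_left) (force simp: cyc_pairs_def arrows_def rot dest: cyc_carrier)+
  finally show ?thesis ..
qed

lemma sum_arrows_cycle:
  "(\<Sum>j=1..n. \<Sum>k=1..n. real (arrows i j * arrows j k * arrows k i) * f j k) =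
     (\<Sum>(j, k)\<in>cyc_pairs i. f j k)"
proof -
  have v: "arrows i j * arrows j k * arrows k i = of_bool (cyc i j k)" for j k
  proof (cases "cyc i j k")
    case True
    then have "arrows i j = 1" "arrows j k = 1" "arrows k i = 1"
      using cyc_rotate unfolding arrows_def by metis+
    then show ?thesis using True by simp
  next
    case False
    then show ?thesis using three_cycle_arrows[of i j k] by (simp add: three_cycle_def)
  qed
  have "(\<Sum>(j, k)\<in>cyc_pairs i. f j k) =
      (\<Sum>(j, k)\<in>{1..n} \<times> {1..n}. real (arrows i j * arrows j k * arrows k i) * f j k)"
    unfolding v
    by (rule sum.mono_neutral_cong_left) (force simp: cyc_pairs_def dest: cyc_carrier)+
  then show ?thesis by (simp add: sum.cartesian_product)
qed

definition triangles_set :: "(nat \<times> nat \<times> nat) set" where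
  "triangles_set = {(p, q, r). tri p q r}"

lemma finite_triangles_set: "finite triangles_set"
  by (rule finite_subset[of _ "{1..n} \<times> {1..n} \<times> {1..n}"]) (auto simp: triangles_set_def dest: triD)

lemma prod_cyc_pairs:
  "(\<Prod>i=1..n. \<Prod>(j, k)\<in>cyc_pairs i. f i j k) =
    (\<Prod>(p, q, r)\<in>triangles_set. f p q r * f q r p * f r p q)" for f :: "nat \<Rightarrow> nat \<Rightarrow> nat \<Rightarrow> 'k"
proof -
  let ?T = triangles_set
  let ?r = "\<lambda>(p, q, r). (q, r, p :: nat)" and ?s = "\<lambda>(p, q, r). (r :: nat, p :: nat, q :: nat)"
  let ?F = "\<lambda>(i, j, k). f i j k"
  have "(\<Prod>i=1..n. \<Prod>(j, k)\<in>cyc_pairs i. f i j k) = prod ?F (Sigma {1..n} cyc_pairs)"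
    by (subst prod.Sigma) (auto simp: finite_cyc_pairs case_prod_unfold)
  also have "Sigma {1..n} cyc_pairs = ?T \<union> (?r ` ?T \<union> ?s ` ?T)"
  proof (intro equalityI subsetI)
    fix c assume "c \<in> Sigma {1..n} cyc_pairs"
    then obtain i j k where c: "c = (i, j, k)" "cyc i j k" by (auto simp: cyc_pairs_def)
    then consider "tri i j k" | "tri j k i" | "tri k i j" by (auto simp: cyc_def)
    then show "c \<in> ?T \<union> (?r ` ?T \<union> ?s ` ?T)"
      by cases (force simp: c triangles_set_def)+
  qed (auto simp: triangles_set_def cyc_pairs_def cyc_def dest: triD)
  also have "prod ?F \<dots> = prod ?F ?T * (prod ?F (?r ` ?T) * prod ?F (?s ` ?T))"
  proof -
    have "?T \<inter> (?r ` ?T \<union> ?s ` ?T) = {}" "?r ` ?T \<inter> ?s ` ?T = {}"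
      by (auto simp: triangles_set_def dest!: tri_len)
    then show ?thesis using finite_triangles_set by (simp add: prod.union_disjoint)
  qed
  also have "prod ?F (?r ` ?T) = (\<Prod>(p, q, r)\<in>?T. f q r p)"
    by (subst prod.reindex) (auto simp: inj_on_def case_prod_unfold)
  also have "prod ?F (?s ` ?T) = (\<Prod>(p, q, r)\<in>?T. f r p q)"
    by (subst prod.reindex) (auto simp: inj_on_def case_prod_unfold)
  finally show ?thesis by (simp add: prod.distrib case_prod_unfold mult.assoc)
qed

definition curve_exponent :: "nat set \<Rightarrow> (nat \<Rightarrow> nat) \<Rightarrow> nat \<Rightarrow> int" where
  "curve_exponent J s i = (\<Sum>(j, k)\<in>cyc_pairs i. corner_exponent J s j k)"

definition compatible :: "nat set \<Rightarrow> (nat \<Rightarrow> nat) set" where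
  "compatible J = {s \<in> J \<rightarrow>\<^sub>E {0, 1}. \<forall>i j k. cyc i j k \<longrightarrow> \<not> bad J s i j}"

lemma x_nonzero: "i \<in> {1..n} \<Longrightarrow> x i \<noteq> 0"
  unfolding x_def by (rule lam_nonzero)

text \<open>Sorting the factors by vertex instead of by triangle turns the product into a monomial
  in the \<open>x i\<close>; one forbidden pair anywhere makes it vanish.\<close>

lemma prod_weight:
  "(\<Prod>p=1..n. weight J s p) =
    (if \<forall>i j k. cyc i j k \<longrightarrow> \<not> bad J s i j then \<Prod>i=1..n. x i powi curve_exponent J s i else 0)"
proof -
  have inj: "inj_on fst triangles_set"
    using tri_unique by (fastforce simp: inj_on_def triangles_set_def)
  have "(\<Prod>p=1..n. weight J s p) = (\<Prod>p\<in>fst ` triangles_set. weight J s p)"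
    by (rule prod.mono_neutral_right)
      (force simp: triangles_set_def weight_def dest: triD(1))+
  then have eq: "(\<Prod>p=1..n. weight J s p) = (\<Prod>(p, q, r)\<in>triangles_set. triangle_weight J s p q r)"
    unfolding prod.reindex[OF inj]
    by (simp, intro prod.cong) (auto simp: triangles_set_def weight_tri)
  show ?thesis
  proof (cases "\<forall>i j k. cyc i j k \<longrightarrow> \<not> bad J s i j")
    case True
    have "(\<Prod>i=1..n. x i powi curve_exponent J s i) =
        (\<Prod>i=1..n. \<Prod>(j, k)\<in>cyc_pairs i. x i powi corner_exponent J s j k)"
      using x_nonzero unfolding curve_exponent_def
      by (intro prod.cong refl) (simp add: power_int_sum case_prod_unfold)
    also have "\<dots> = (\<Prod>(p, q, r)\<in>triangles_set. triangle_weight J s p q r)"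
      unfolding prod_cyc_pairs using True
      by (intro prod.cong) (auto simp: triangles_set_def triangle_weight_def cyc_def)
    finally show ?thesis using True eq by simp
  next
    case False
    then obtain p q r where "tri p q r" "triangle_weight J s p q r = 0"
      by (auto simp: triangle_weight_def cyc_def)
    then have "(\<Prod>(p, q, r)\<in>triangles_set. triangle_weight J s p q r) = 0"
      using finite_triangles_set by (force simp: triangles_set_def)
    then show ?thesis unfolding if_not_P[OF False] using eq by simp
  qed
qed

lemma finite_crossed: "finite (crossed X Y)"
  by (simp add: crossed_def)

lemma curve_expansion_monomials:
  assumes "admissible X Y"
  shows "lam X Y * (\<Prod>i\<in>crossed X Y. x i) =
    (\<Sum>s\<in>compatible (crossed X Y). \<Prod>i=1..n. x i powi curve_exponent (crossed X Y) s i)"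
  unfolding curve_expansion[OF assms, symmetric] prod_weight compatible_def
  by (rule sum.inter_filter[symmetric]) (simp add: finite_PiE finite_crossed)

end

section \<open>Ranks in a finite linearly ordered set\<close>

lemma rank_bij:
  fixes f :: "'a \<Rightarrow> 'b::linorder"
  assumes fin: "finite A" and inj: "inj_on f A"
  shows "bij_betw (\<lambda>c. card {c'\<in>A. f c' \<le> f c}) A {1..card A}"
proof -
  let ?rk = "\<lambda>c. card {c'\<in>A. f c' \<le> f c}"
  have lt: "?rk c < ?rk c'" if "c \<in> A" "c' \<in> A" "f c < f c'" for c c'
  proof (rule psubset_card_mono)
    show "finite {a \<in> A. f a \<le> f c'}" using fin by simp
    have "c' \<in> {a \<in> A. f a \<le> f c'}" "c' \<notin> {a \<in> A. f a \<le> f c}" using that by auto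
    moreover have "{a \<in> A. f a \<le> f c} \<subseteq> {a \<in> A. f a \<le> f c'}" using that(3) by auto
    ultimately show "{a \<in> A. f a \<le> f c} \<subset> {a \<in> A. f a \<le> f c'}" by blast
  qed
  have "inj_on ?rk A"
  proof (rule inj_onI, rule ccontr)
    fix c c' assume *: "c \<in> A" "c' \<in> A" "?rk c = ?rk c'" "c \<noteq> c'"
    then have "f c \<noteq> f c'" using inj by (meson inj_onD)
    then consider "f c < f c'" | "f c' < f c" by fastforce
    then show False
    proof cases
      case 1
      then show ?thesis using lt[OF *(1,2)] *(3) by simp
    next
      case 2
      then show ?thesis using lt[OF *(2,1)] *(3) by simp
    qed
  qed
  moreover have "?rk ` A \<subseteq> {1..card A}"
  proof
    fix t assume "t \<in> ?rk ` A"
    then obtain c where c: "c \<in> A" "t = ?rk c" by blast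
    then have "{c} \<subseteq> {c'\<in>A. f c' \<le> f c}" by auto
    then have "card {c} \<le> ?rk c" using fin by (intro card_mono) auto
    moreover have "?rk c \<le> card A" using fin by (intro card_mono) auto
    ultimately show "t \<in> {1..card A}" using c by simp
  qed
  ultimately show ?thesis
    unfolding bij_betw_def using card_subset_eq[of "{1..card A}" "?rk ` A"] card_image[of ?rk A]
    by simp
qed

lemma rank_initial_segment:
  fixes f :: "'a \<Rightarrow> 'b::linorder"
  assumes fin: "finite A" and inj: "inj_on f A" and "B \<subseteq> A"
    and down: "\<And>c c'. c \<in> B \<Longrightarrow> c' \<in> A \<Longrightarrow> f c' \<le> f c \<Longrightarrow> c' \<in> B"
  shows "(\<lambda>c. card {c'\<in>A. f c' \<le> f c}) ` B = {1..card B}"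
proof -
  have "{c'\<in>A. f c' \<le> f c} = {c'\<in>B. f c' \<le> f c}" if "c \<in> B" for c
    using down that \<open>B \<subseteq> A\<close> by blast
  then have "(\<lambda>c. card {c'\<in>A. f c' \<le> f c}) ` B = (\<lambda>c. card {c'\<in>B. f c' \<le> f c}) ` B"
    by (intro image_cong) auto
  also have "\<dots> = {1..card B}"
    using rank_bij[of B f] assms by (simp add: bij_betw_def finite_subset inj_on_subset)
  finally show ?thesis .
qed

lemma rank_reverse:
  fixes f :: "'a \<Rightarrow> 'b::linorder"
  assumes fin: "finite A" and inj: "inj_on f A" and "c \<in> A"
  shows "card {c'\<in>A. f c' \<le> f c} + card {c'\<in>A. f c \<le> f c'} = card A + 1"
proof -
  have "{c'\<in>A. f c' \<le> f c} \<inter> {c'\<in>A. f c \<le> f c'} = {c}"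
    using inj \<open>c \<in> A\<close> by (auto dest: inj_onD)
  moreover have "{c'\<in>A. f c' \<le> f c} \<union> {c'\<in>A. f c \<le> f c'} = A" by auto
  ultimately show ?thesis
    using card_Un_Int[of "{c'\<in>A. f c' \<le> f c}" "{c'\<in>A. f c \<le> f c'}"] fin by simp
qed

section \<open>Numbering the crossings of a family of curves\<close>

lemma corank_final_segment:
  fixes f :: "'a \<Rightarrow> 'b::linorder"
  assumes fin: "finite A" and inj: "inj_on f A" and "B \<subseteq> A"
    and up: "\<And>c c'. c \<in> B \<Longrightarrow> c' \<in> A \<Longrightarrow> f c \<le> f c' \<Longrightarrow> c' \<in> B"
  shows "(\<lambda>c. card {c'\<in>A. f c \<le> f c'}) ` B = {1..card B}"
proof -
  have finB: "finite B" and injB: "inj_on f B"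
    using fin inj \<open>B \<subseteq> A\<close> finite_subset inj_on_subset by blast+
  let ?rk = "\<lambda>c. card {c'\<in>B. f c' \<le> f c}"
  have "card {c'\<in>A. f c \<le> f c'} = card B + 1 - ?rk c" if "c \<in> B" for c
  proof -
    have "{c'\<in>A. f c \<le> f c'} = {c'\<in>B. f c \<le> f c'}" using up that \<open>B \<subseteq> A\<close> by blast
    then show ?thesis using rank_reverse[OF finB injB that] by simp
  qed
  then have "(\<lambda>c. card {c'\<in>A. f c \<le> f c'}) ` B = (\<lambda>t. card B + 1 - t) ` (?rk ` B)"
    unfolding image_image by (intro image_cong) auto
  also have "?rk ` B = {1..card B}" using rank_bij[OF finB injB] by (simp add: bij_betw_def)
  also have "(\<lambda>t. card B + 1 - t) ` {1..card B} = {1..card B}"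
  proof (intro equalityI subsetI)
    fix t assume "t \<in> {1..card B}"
    then have "t = card B + 1 - (card B + 1 - t)" "card B + 1 - t \<in> {1..card B}" by auto
    then show "t \<in> (\<lambda>t. card B + 1 - t) ` {1..card B}" by (rule image_eqI)
  qed auto
  finally show ?thesis .
qed

text \<open>A, B, C count the curves that cut off the three corners of a triangle, and P, q, r those
  that cross a single side and end at the opposite vertex. An ending curve blocks the corner at its
  end and the other two kinds of ending; the subtracted terms of \<open>sigma\<close> remove the
  ending curves from the count.\<close>

lemma sigma_eq_corner_count:
  fixes A B C P q r :: nat
  assumes "P > 0 \<Longrightarrow> B = 0 \<and> q = 0 \<and> r = 0" "q > 0 \<Longrightarrow> C = 0 \<and> P = 0 \<and> r = 0"
    "r > 0 \<Longrightarrow> A = 0 \<and> P = 0 \<and> q = 0"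
  shows "sigma (real (A + C + P)) (real (A + B + q)) (real (B + C + r)) = real A"
proof -
  consider "P = 0" "q = 0" "r = 0" | "P > 0" "B = 0" "q = 0" "r = 0"
    | "q > 0" "C = 0" "P = 0" "r = 0" | "r > 0" "A = 0" "P = 0" "q = 0"
    using assms by blast
  then show ?thesis
    by cases (simp_all add: sigma_def pos_part_def max_def)
qed

text \<open>In coordinates rather than indices, for use with the sides [l, h], [m, h], [l, m] of a
  triangle. In the first alternative Y is the endpoint inside the interval, in the second X.\<close>

definition passes :: "nat \<Rightarrow> nat \<Rightarrow> nat \<Rightarrow> nat \<Rightarrow> bool" where
  "passes l h X Y \<longleftrightarrow> X < l \<and> l < Y \<and> Y < h \<or> l < X \<and> X < h \<and> h < Y"

text \<open>The lexicographic comparison of \<open>key\<close> written out, see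
  \<open>key_precedes\<close>; the last component tells parallel copies apart.\<close>

definition precedes :: "nat \<Rightarrow> nat \<Rightarrow> nat \<Rightarrow> nat \<Rightarrow> nat \<Rightarrow> nat \<Rightarrow> nat \<Rightarrow> bool" where
  "precedes l X' Y' k' X Y k =
    (if X' < l then if X < l then Y < Y' \<or> Y' = Y \<and> (X' < X \<or> X' = X \<and> k' \<le> k) else X < Y'
     else if X < l then Y \<le> X' else X < X' \<or> X = X' \<and> (Y' < Y \<or> Y' = Y \<and> k \<le> k'))"

text \<open>Corner at h: a curve that meets one of the two sides between the given curve and h has
  to meet the other as well, because it cannot cross the given curve. Likewise
  \<open>precedes_left\<close> treats the corner at l, and \<open>precedes_opposite\<close> the
  corner at m, where the direction of counting is reversed.\<close>

lemma precedes_right: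
  assumes "passes l h X Y" "passes m h X Y" "\<not> (X < X' \<and> X' < Y \<and> Y < Y')"
    "\<not> (X' < X \<and> X < Y' \<and> Y' < Y)" "l < m" "m < h" "X < Y" "X' < Y'"
  shows "passes l h X' Y' \<and> precedes l X' Y' k' X Y k \<longleftrightarrow> passes m h X' Y' \<and> precedes m X' Y' k' X Y k"
proof (cases "X < l")
  case True
  then show ?thesis using assms unfolding passes_def precedes_def
    by (cases "X' < l"; cases "X' < m"; simp; linarith)
next
  case False
  then show ?thesis using assms unfolding passes_def precedes_def
    by (cases "X' < l"; cases "X' < m"; simp; linarith)
qed

lemma precedes_left:
  assumes "passes l h X Y" "passes l m X Y" "\<not> (X < X' \<and> X' < Y \<and> Y < Y')"
    "\<not> (X' < X \<and> X < Y' \<and> Y' < Y)" "l < m" "m < h" "X < Y" "X' < Y'"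
  shows "passes l m X' Y' \<and> precedes l X Y k X' Y' k' \<longleftrightarrow> passes l h X' Y' \<and> precedes l X Y k X' Y' k'"
proof (cases "X < l")
  case True
  then show ?thesis using assms unfolding passes_def precedes_def
    by (cases "X' < l"; cases "X' < m"; simp; linarith)
next
  case False
  then show ?thesis using assms unfolding passes_def precedes_def
    by (cases "X' < l"; cases "X' < m"; simp; linarith)
qed

lemma precedes_opposite:
  assumes "passes m h X Y" "passes l m X Y" "\<not> (X < X' \<and> X' < Y \<and> Y < Y')"
    "\<not> (X' < X \<and> X < Y' \<and> Y' < Y)" "l < m" "m < h" "X < Y" "X' < Y'"
  shows "passes m h X' Y' \<and> precedes m X Y k X' Y' k' \<longleftrightarrow> passes l m X' Y' \<and> precedes l X' Y' k' X Y k"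
proof -
  have "l < X" "X < m" "m < Y" "Y < h" using assms unfolding passes_def by linarith+
  then show ?thesis using assms unfolding passes_def precedes_def
    by (cases "X' < l"; cases "X' < m"; simp; linarith)
qed

text \<open>A curve that crosses exactly one side of a triangle ends at the opposite vertex.\<close>

lemma passes_shapes:
  assumes "l < m" "m < h" "X < Y"
  shows "passes l h X Y \<Longrightarrow> \<not> passes m h X Y \<Longrightarrow> \<not> passes l m X Y \<Longrightarrow>
      X < l \<and> Y = m \<or> X = m \<and> h < Y"
    and "passes m h X Y \<Longrightarrow> \<not> passes l h X Y \<Longrightarrow> \<not> passes l m X Y \<Longrightarrow> X = l \<and> m < Y \<and> Y < h"
    and "passes l m X Y \<Longrightarrow> \<not> passes l h X Y \<Longrightarrow> \<not> passes m h X Y \<Longrightarrow> Y = h \<and> l < X \<and> X < m"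
    and "passes l h X Y \<Longrightarrow> passes m h X Y \<Longrightarrow> X < l \<and> m < Y \<and> Y < h \<or> m < X \<and> X < h \<and> h < Y"
    and "passes l m X Y \<Longrightarrow> passes l h X Y \<Longrightarrow> X < l \<and> l < Y \<and> Y < m \<or> l < X \<and> X < m \<and> h < Y"
    and "passes m h X Y \<Longrightarrow> passes l m X Y \<Longrightarrow> l < X \<and> X < m \<and> m < Y \<and> Y < h"
  using assms unfolding passes_def by linarith+

text \<open>Supplies the hypotheses of \<open>sigma_eq_corner_count\<close>: by
  \<open>passes_shapes\<close> a curve crossing only one side ends at a vertex of the triangle, and
  any curve of an excluded kind would have to cross it.\<close>

lemma passes_exclusive:
  assumes lmh: "l < m" "m < h" and X: "X < Y" and X': "X' < Y'"
    and nc: "\<not> (X < X' \<and> X' < Y \<and> Y < Y')" "\<not> (X' < X \<and> X < Y' \<and> Y' < Y)"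
  shows "\<not> (passes l h X Y \<and> passes m h X Y \<and> passes l m X Y)"
    and "passes l h X Y \<Longrightarrow> \<not> passes m h X Y \<Longrightarrow> \<not> passes l m X Y \<Longrightarrow>
      \<not> (passes m h X' Y' \<and> passes l m X' Y')"
    and "passes l h X Y \<Longrightarrow> \<not> passes m h X Y \<Longrightarrow> \<not> passes l m X Y \<Longrightarrow>
      \<not> (passes m h X' Y' \<and> \<not> passes l h X' Y' \<and> \<not> passes l m X' Y')"
    and "passes l h X Y \<Longrightarrow> \<not> passes m h X Y \<Longrightarrow> \<not> passes l m X Y \<Longrightarrow>
      \<not> (passes l m X' Y' \<and> \<not> passes l h X' Y' \<and> \<not> passes m h X' Y')"
    and "passes m h X Y \<Longrightarrow> \<not> passes l h X Y \<Longrightarrow> \<not> passes l m X Y \<Longrightarrow>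
      \<not> (passes l m X' Y' \<and> passes l h X' Y')"
    and "passes m h X Y \<Longrightarrow> \<not> passes l h X Y \<Longrightarrow> \<not> passes l m X Y \<Longrightarrow>
      \<not> (passes l m X' Y' \<and> \<not> passes l h X' Y' \<and> \<not> passes m h X' Y')"
    and "passes l m X Y \<Longrightarrow> \<not> passes l h X Y \<Longrightarrow> \<not> passes m h X Y \<Longrightarrow>
      \<not> (passes l h X' Y' \<and> passes m h X' Y')"
proof -
  note s = passes_shapes[OF lmh X] and s' = passes_shapes[OF lmh X']
  show "\<not> (passes l h X Y \<and> passes m h X Y \<and> passes l m X Y)"
    using s(4,6) lmh by linarith
  show "\<not> (passes l m X' Y' \<and> \<not> passes l h X' Y' \<and> \<not> passes m h X' Y')"
    if "passes m h X Y" "\<not> passes l h X Y" "\<not> passes l m X Y"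
    using s(2)[OF that] s'(3) nc lmh by linarith
  show "\<not> (passes l m X' Y' \<and> passes l h X' Y')"
    if "passes m h X Y" "\<not> passes l h X Y" "\<not> passes l m X Y"
    using s(2)[OF that] s'(5) nc lmh by linarith
  show "\<not> (passes l h X' Y' \<and> passes m h X' Y')"
    if "passes l m X Y" "\<not> passes l h X Y" "\<not> passes m h X Y"
    using s(3)[OF that] s'(4) nc lmh by linarith
  assume p: "passes l h X Y" "\<not> passes m h X Y" "\<not> passes l m X Y"
  note sp = s(1)[OF p]
  show "\<not> (passes m h X' Y' \<and> passes l m X' Y')" using sp s'(6) nc lmh by linarith
  show "\<not> (passes m h X' Y' \<and> \<not> passes l h X' Y' \<and> \<not> passes l m X' Y')"
    using sp s'(2) nc lmh by linarith
  show "\<not> (passes l m X' Y' \<and> \<not> passes l h X' Y' \<and> \<not> passes m h X' Y')"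
    using sp s'(3) nc lmh by linarith
qed

locale rooted_curves = rooted_dissection +
  fixes Cv :: "(nat \<times> nat) set" and mult :: "nat \<times> nat \<Rightarrow> nat"
  assumes finite_curves: "finite Cv"
    and curves_admissible: "(X, Y) \<in> Cv \<Longrightarrow> admissible X Y"
    and curves_noncrossing: "(X, Y) \<in> Cv \<Longrightarrow> (X', Y') \<in> Cv \<Longrightarrow> \<not> (X < X' \<and> X' < Y \<and> Y < Y')"
begin

text \<open>A curve of multiplicity \<open>m\<close> is replaced by \<open>m\<close> parallel copies, indexed by the last
  component.\<close>

definition copies :: "((nat \<times> nat) \<times> nat) set" where
  "copies = Sigma Cv (\<lambda>D. {..<mult D})"

fun crossing_set :: "(nat \<times> nat) \<times> nat \<Rightarrow> nat set" where
  "crossing_set ((X, Y), m) = crossed X Y"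

definition crossers :: "nat \<Rightarrow> ((nat \<times> nat) \<times> nat) set" where
  "crossers i = {c \<in> copies. i \<in> crossing_set c}"

text \<open>Orders the curves crossing the interval \<open>i\<close> from the endpoint \<open>hi i\<close> to the endpoint
  \<open>lo i\<close>: first by their endpoint inside the interval, then by the one outside. Parallel copies are
  passed in opposite orders by intervals that a curve crosses in opposite directions.\<close>

fun key :: "nat \<Rightarrow> (nat \<times> nat) \<times> nat \<Rightarrow> int \<times> int \<times> int" where
  "key i ((X, Y), m) = (if X < lo i then (- int Y, int X + int n + 3, int m)
     else (- int X, int Y, - int m))"

definition rank :: "nat \<Rightarrow> (nat \<times> nat) \<times> nat \<Rightarrow> nat" where
  "rank i c = card {c' \<in> crossers i. key i c' \<le> key i c}"

definition corank :: "nat \<Rightarrow> (nat \<times> nat) \<times> nat \<Rightarrow> nat" where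
  "corank i c = card {c' \<in> crossers i. key i c \<le> key i c'}"

lemma finite_copies: "finite copies"
  unfolding copies_def using finite_curves by simp

lemma finite_crossers: "finite (crossers i)"
  using finite_copies by (simp add: crossers_def)

lemma copiesE:
  assumes "c \<in> copies"
  obtains X Y m where "c = ((X, Y), m)" "(X, Y) \<in> Cv" "X + 2 \<le> Y" "Y \<le> n + 2"
proof -
  obtain X Y m where c: "c = ((X, Y), m)" by (metis prod.exhaust)
  then have "(X, Y) \<in> Cv" using assms by (auto simp: copies_def)
  moreover from this have "X + 2 \<le> Y" "Y \<le> n + 2"
    using curves_admissible unfolding admissible_def by blast+
  ultimately show thesis using that c by blast
qed

lemma crossersE:
  assumes "c \<in> crossers i"
  obtains X Y m where "c = ((X, Y), m)" "(X, Y) \<in> Cv" "X + 2 \<le> Y" "Y \<le> n + 2" "c \<in> copies"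
    "i \<in> {1..n}" "X < lo i \<and> lo i < Y \<and> Y < hi i \<or> lo i < X \<and> X < hi i \<and> hi i < Y"
proof -
  have "c \<in> copies" using assms by (simp add: crossers_def)
  then obtain X Y m where c: "c = ((X, Y), m)" "(X, Y) \<in> Cv" "X + 2 \<le> Y" "Y \<le> n + 2"
    by (rule copiesE)
  moreover have "i \<in> crossed X Y" using assms c by (simp add: crossers_def)
  ultimately show thesis using that \<open>c \<in> copies\<close> unfolding crossed_def by blast
qed

lemma crossers_passes:
  assumes "((X, Y), m) \<in> copies" "i \<in> {1..n}"
  shows "((X, Y), m) \<in> crossers i \<longleftrightarrow> passes (lo i) (hi i) X Y"
  using assms by (simp add: crossers_def crossed_def passes_def)

text \<open>The summand n + 3 in \<open>key\<close> continues the cyclic numbering beyond n + 2: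
  among curves with the same inner endpoint, the outer endpoints are then ordered counterclockwise
  from \<open>hi i\<close> round to \<open>lo i\<close>.\<close>

lemma key_precedes:
  assumes "Y \<le> n + 2" "Y' \<le> n + 2"
  shows "key i ((X', Y'), m') \<le> key i ((X, Y), m) \<longleftrightarrow> precedes (lo i) X' Y' m' X Y m"
  using assms by (cases "X' < lo i"; cases "X < lo i"; simp add: precedes_def; linarith)

lemma key_inj: "inj_on (key i) (crossers i)"
proof (rule inj_onI)
  fix c c' assume c0: "c \<in> crossers i" "c' \<in> crossers i" and eq: "key i c = key i c'"
  obtain X Y m where c: "c = ((X, Y), m)" "Y \<le> n + 2" using c0(1) by (rule crossersE)
  obtain X' Y' m' where c': "c' = ((X', Y'), m')" "Y' \<le> n + 2" using c0(2) by (rule crossersE)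
  show "c = c'" using eq c(2) c'(2) unfolding c(1) c'(1)
    by (cases "X < lo i"; cases "X' < lo i") auto
qed

lemma rank_bij_betw: "bij_betw (rank i) (crossers i) {1..card (crossers i)}"
  unfolding rank_def[abs_def] by (rule rank_bij[OF finite_crossers key_inj])

lemma rank_corank: "c \<in> crossers i \<Longrightarrow> rank i c + corank i c = card (crossers i) + 1"
  unfolding rank_def corank_def by (rule rank_reverse[OF finite_crossers key_inj])

lemma noncrossing_copies:
  assumes "((X, Y), m) \<in> copies" "((X', Y'), m') \<in> copies"
  shows "\<not> (X < X' \<and> X' < Y \<and> Y < Y')" "\<not> (X' < X \<and> X < Y' \<and> Y' < Y)"
  using curves_noncrossing assms by (auto simp: copies_def)

lemma match_sets:
  assumes t: "tri p q r"
  shows "c \<in> crossers p \<Longrightarrow> c \<in> crossers q \<Longrightarrow>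
      {c' \<in> crossers p. key p c' \<le> key p c} = {c' \<in> crossers q. key q c' \<le> key q c}"
    and "c \<in> crossers r \<Longrightarrow> c \<in> crossers p \<Longrightarrow>
      {c' \<in> crossers r. key r c \<le> key r c'} = {c' \<in> crossers p. key p c \<le> key p c'}"
    and "c \<in> crossers q \<Longrightarrow> c \<in> crossers r \<Longrightarrow>
      {c' \<in> crossers q. key q c \<le> key q c'} = {c' \<in> crossers r. key r c' \<le> key r c}"
proof -
  note d = triD[OF t]
  have lmh: "lo p < hi r" "hi r < hi p" using d by auto
  {
    fix c' assume "c \<in> copies" "c' \<in> copies"
    obtain X Y m where c: "c = ((X, Y), m)" "X + 2 \<le> Y" "Y \<le> n + 2"
      using \<open>c \<in> copies\<close> by (rule copiesE)
    obtain X' Y' m' where c': "c' = ((X', Y'), m')" "X' + 2 \<le> Y'" "Y' \<le> n + 2"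
      using \<open>c' \<in> copies\<close> by (rule copiesE)
    have cc: "((X, Y), m) \<in> copies" "((X', Y'), m') \<in> copies"
      using \<open>c \<in> copies\<close> \<open>c' \<in> copies\<close> c c' by auto
    have lt: "X < Y" "X' < Y'" using c c' by auto
    note nc = noncrossing_copies[OF cc]
    note cr = crossers_passes[OF cc(1)] crossers_passes[OF cc(2)]
    note ke = key_precedes[OF c(3) c'(3)] key_precedes[OF c'(3) c(3)]
    have "c \<in> crossers p \<Longrightarrow> c \<in> crossers q \<Longrightarrow>
        c' \<in> crossers p \<and> key p c' \<le> key p c \<longleftrightarrow> c' \<in> crossers q \<and> key q c' \<le> key q c"
      using precedes_right[OF _ _ nc lmh lt, of m' m]
      unfolding c(1) c'(1) cr[OF d(1)] cr[OF d(2)] ke d(4-6) .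
    moreover have "c \<in> crossers r \<Longrightarrow> c \<in> crossers p \<Longrightarrow>
        c' \<in> crossers r \<and> key r c \<le> key r c' \<longleftrightarrow> c' \<in> crossers p \<and> key p c \<le> key p c'"
      using precedes_left[OF _ _ nc lmh lt, of m m']
      unfolding c(1) c'(1) cr[OF d(1)] cr[OF d(3)] ke d(4-6) by blast
    moreover have "c \<in> crossers q \<Longrightarrow> c \<in> crossers r \<Longrightarrow>
        c' \<in> crossers q \<and> key q c \<le> key q c' \<longleftrightarrow> c' \<in> crossers r \<and> key r c' \<le> key r c"
      using precedes_opposite[OF _ _ nc lmh lt, of m m']
      unfolding c(1) c'(1) cr[OF d(2)] cr[OF d(3)] ke d(4-6) .
    moreover note calculation
  }
  note all = this
  have copy: "c \<in> copies" if "c \<in> crossers i" for i c using that by (simp add: crossers_def)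
  show "{c' \<in> crossers p. key p c' \<le> key p c} = {c' \<in> crossers q. key q c' \<le> key q c}"
    if "c \<in> crossers p" "c \<in> crossers q"
    using all(1)[OF copy copy that] copy that by blast
  show "{c' \<in> crossers r. key r c \<le> key r c'} = {c' \<in> crossers p. key p c \<le> key p c'}"
    if "c \<in> crossers r" "c \<in> crossers p"
    using all(2)[OF copy copy that] copy that by blast
  show "{c' \<in> crossers q. key q c \<le> key q c'} = {c' \<in> crossers r. key r c' \<le> key r c}"
    if "c \<in> crossers q" "c \<in> crossers r"
    using all(3)[OF copy copy that] copy that by blast
qed

text \<open>Equal sets of predecessors or successors give equal positions: from the start on p and
  q, from the end on r and p, and from opposite ends on q and r. Closure under predecessors or
  successors makes these positions an initial block 1, ..., m.\<close>

lemma match_ranks: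
  assumes t: "tri p q r"
  shows "c \<in> crossers p \<Longrightarrow> c \<in> crossers q \<Longrightarrow> rank p c = rank q c"
    and "rank p ` (crossers p \<inter> crossers q) = {1..card (crossers p \<inter> crossers q)}"
    and "c \<in> crossers r \<Longrightarrow> c \<in> crossers p \<Longrightarrow> corank r c = corank p c"
    and "corank r ` (crossers r \<inter> crossers p) = {1..card (crossers r \<inter> crossers p)}"
    and "c \<in> crossers q \<Longrightarrow> c \<in> crossers r \<Longrightarrow> corank q c = rank r c"
    and "corank q ` (crossers q \<inter> crossers r) = {1..card (crossers q \<inter> crossers r)}"
proof -
  note m = match_sets[OF t]
  show "c \<in> crossers p \<Longrightarrow> c \<in> crossers q \<Longrightarrow> rank p c = rank q c"
    using m(1) unfolding rank_def by simp
  show "c \<in> crossers r \<Longrightarrow> c \<in> crossers p \<Longrightarrow> corank r c = corank p c"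
    using m(2) unfolding corank_def by simp
  show "c \<in> crossers q \<Longrightarrow> c \<in> crossers r \<Longrightarrow> corank q c = rank r c"
    using m(3) unfolding rank_def corank_def by simp
  show "rank p ` (crossers p \<inter> crossers q) = {1..card (crossers p \<inter> crossers q)}"
    unfolding rank_def[abs_def]
    by (rule rank_initial_segment[OF finite_crossers key_inj]) (use m(1) in blast)+
  show "corank r ` (crossers r \<inter> crossers p) = {1..card (crossers r \<inter> crossers p)}"
    unfolding corank_def[abs_def]
    by (rule corank_final_segment[OF finite_crossers key_inj]) (use m(2) in blast)+
  show "corank q ` (crossers q \<inter> crossers r) = {1..card (crossers q \<inter> crossers r)}"
    unfolding corank_def[abs_def]
    by (rule corank_final_segment[OF finite_crossers key_inj]) (use m(3) in blast)+
qed

abbreviation crossing_count :: "nat \<Rightarrow> nat" where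
  "crossing_count i \<equiv> card (crossers i)"

text \<open>A curve crossing a side of the triangle either cuts off one of the two adjacent corners
  or ends at the opposite vertex, and non-crossing constrains the counts as
  \<open>sigma_eq_corner_count\<close> requires.\<close>

lemma sigma_crossers:
  assumes "cyc i j k"
  shows "sigma (crossing_count i) (crossing_count j) (crossing_count k) =
    card (crossers i \<inter> crossers j)"
proof -
  have tri_case: "sigma (crossing_count p) (crossing_count q) (crossing_count r) =
      card (crossers p \<inter> crossers q) \<and>
      sigma (crossing_count q) (crossing_count r) (crossing_count p) =
      card (crossers q \<inter> crossers r) \<and>
      sigma (crossing_count r) (crossing_count p) (crossing_count q) =
      card (crossers r \<inter> crossers p)" if t: "tri p q r" for p q r
  proof -
    note d = triD[OF t]
    have lmh: "lo p < hi r" "hi r < hi p" using d by auto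
    let ?p = "crossers p" and ?q = "crossers q" and ?r = "crossers r"
    have excl: "\<not> (c \<in> ?p \<and> c \<in> ?q \<and> c \<in> ?r)"
      "c \<in> ?p - ?q - ?r \<Longrightarrow> c' \<notin> ?q \<inter> ?r \<and> c' \<notin> ?q - ?r - ?p \<and> c' \<notin> ?r - ?p - ?q"
      "c \<in> ?q - ?r - ?p \<Longrightarrow> c' \<notin> ?r \<inter> ?p \<and> c' \<notin> ?r - ?p - ?q"
      "c \<in> ?r - ?p - ?q \<Longrightarrow> c' \<notin> ?p \<inter> ?q"
      if "c \<in> copies" "c' \<in> copies" for c c'
    proof -
      obtain X Y m where c: "c = ((X, Y), m)" "X + 2 \<le> Y" "Y \<le> n + 2"
        using \<open>c \<in> copies\<close> by (rule copiesE)
      obtain X' Y' m' where c': "c' = ((X', Y'), m')" "X' + 2 \<le> Y'" "Y' \<le> n + 2"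
        using \<open>c' \<in> copies\<close> by (rule copiesE)
      have cc: "((X, Y), m) \<in> copies" "((X', Y'), m') \<in> copies"
        using \<open>c \<in> copies\<close> \<open>c' \<in> copies\<close> c c' by auto
      have lt: "X < Y" "X' < Y'" using c c' by auto
      have cr: "c \<in> ?p \<longleftrightarrow> passes (lo p) (hi p) X Y" "c \<in> ?q \<longleftrightarrow> passes (hi r) (hi p) X Y"
        "c \<in> ?r \<longleftrightarrow> passes (lo p) (hi r) X Y" "c' \<in> ?p \<longleftrightarrow> passes (lo p) (hi p) X' Y'"
        "c' \<in> ?q \<longleftrightarrow> passes (hi r) (hi p) X' Y'" "c' \<in> ?r \<longleftrightarrow> passes (lo p) (hi r) X' Y'"
        unfolding c(1) c'(1) using crossers_passes[OF cc(1)] crossers_passes[OF cc(2)] d by auto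
      note pe = passes_exclusive[OF lmh lt noncrossing_copies[OF cc]]
      show "\<not> (c \<in> ?p \<and> c \<in> ?q \<and> c \<in> ?r)"
        "c \<in> ?p - ?q - ?r \<Longrightarrow> c' \<notin> ?q \<inter> ?r \<and> c' \<notin> ?q - ?r - ?p \<and> c' \<notin> ?r - ?p - ?q"
        "c \<in> ?q - ?r - ?p \<Longrightarrow> c' \<notin> ?r \<inter> ?p \<and> c' \<notin> ?r - ?p - ?q"
        "c \<in> ?r - ?p - ?q \<Longrightarrow> c' \<notin> ?p \<inter> ?q"
        using pe unfolding Int_iff Diff_iff cr by blast+
    qed
    have copy: "c \<in> copies" if "c \<in> crossers i" for i c using that by (simp add: crossers_def)
    let ?A = "card (?p \<inter> ?q)" and ?B = "card (?q \<inter> ?r)" and ?C = "card (?r \<inter> ?p)"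
    let ?P = "card (?p - ?q - ?r)" and ?Q = "card (?q - ?r - ?p)" and ?R = "card (?r - ?p - ?q)"
    have three: "card U = card (U \<inter> V) + card (W \<inter> U) + card (U - V - W)"
      if "\<And>c. c \<in> copies \<Longrightarrow> \<not> (c \<in> U \<and> c \<in> V \<and> c \<in> W)" "U \<subseteq> copies" for U V W
    proof -
      have fin: "finite U" using that(2) finite_copies finite_subset by blast
      have e: "(U \<inter> V \<union> W \<inter> U) \<union> (U - V - W) = U" by blast
      have dis: "(U \<inter> V) \<inter> (W \<inter> U) = {}" using that by blast
      have "card U = card ((U \<inter> V \<union> W \<inter> U) \<union> (U - V - W))" unfolding e ..
      also have "\<dots> = card (U \<inter> V \<union> W \<inter> U) + card (U - V - W)"
        by (rule card_Un_disjoint) (use fin in auto)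
      also have "card (U \<inter> V \<union> W \<inter> U) = card (U \<inter> V) + card (W \<inter> U)"
        by (rule card_Un_disjoint) (use fin dis in auto)
      finally show ?thesis .
    qed
    have sub: "?p \<subseteq> copies" "?q \<subseteq> copies" "?r \<subseteq> copies" using copy by blast+
    have cp: "card ?p = ?A + ?C + ?P" by (rule three[OF _ sub(1)]) (use excl(1) in blast)
    have cq: "card ?q = ?B + ?A + ?Q" by (rule three[OF _ sub(2)]) (use excl(1) in blast)
    have cr: "card ?r = ?C + ?B + ?R" by (rule three[OF _ sub(3)]) (use excl(1) in blast)
    have eP: "?B = 0 \<and> ?Q = 0 \<and> ?R = 0" if pos: "?P > 0"
    proof -
      obtain c where c: "c \<in> ?p - ?q - ?r" using pos by (metis card_gt_0_iff ex_in_conv)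
      have "?q \<inter> ?r = {}" "?q - ?r - ?p = {}" "?r - ?p - ?q = {}"
        using excl(2)[OF _ _ c] copy c by blast+
      then show ?thesis by (simp only: card.empty)
    qed
    have eQ: "?C = 0 \<and> ?P = 0 \<and> ?R = 0" if pos: "?Q > 0"
    proof -
      obtain c where c: "c \<in> ?q - ?r - ?p" using pos by (metis card_gt_0_iff ex_in_conv)
      have "?r \<inter> ?p = {}" "?r - ?p - ?q = {}" using excl(3)[OF _ _ c] copy c by blast+
      then have "?C = 0" "?R = 0" by (simp_all only: card.empty)
      then show ?thesis using eP pos by auto
    qed
    have eR: "?A = 0 \<and> ?P = 0 \<and> ?Q = 0" if pos: "?R > 0"
    proof -
      obtain c where c: "c \<in> ?r - ?p - ?q" using pos by (metis card_gt_0_iff ex_in_conv)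
      have "?p \<inter> ?q = {}" using excl(4)[OF _ _ c] copy c by blast
      then have "?A = 0" by (simp only: card.empty)
      then show ?thesis using eP eQ pos by auto
    qed
    have alt: "?A + ?B + ?Q = card ?q" "?B + ?C + ?R = card ?r" "?C + ?A + ?P = card ?p"
      using cp cq cr by linarith+
    have "sigma (real (?A + ?C + ?P)) (real (?A + ?B + ?Q)) (real (?B + ?C + ?R)) = real ?A"
      by (rule sigma_eq_corner_count) (use eP eQ eR in blast)+
    moreover have "sigma (real (?B + ?A + ?Q)) (real (?B + ?C + ?R)) (real (?C + ?A + ?P)) = real ?B"
      by (rule sigma_eq_corner_count) (use eP eQ eR in blast)+
    moreover have "sigma (real (?C + ?B + ?R)) (real (?C + ?A + ?P)) (real (?A + ?B + ?Q)) = real ?C"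
      by (rule sigma_eq_corner_count) (use eP eQ eR in blast)+
    ultimately show ?thesis unfolding alt cp[symmetric] cq[symmetric] cr[symmetric] by blast
  qed
  show ?thesis using assms tri_case unfolding cyc_def by blast
qed

end

section \<open>Distances from the root\<close>

context rooted_dissection
begin

text \<open>An arrow into q belongs to the 3-cycle above q and comes from p, or to the one below q
  and comes from the left part of q. \<open>arrow_into_left\<close> is the analogue for r.\<close>

lemma arrow_into_right:
  assumes t: "tri p q r" and a: "arrows u q > 0"
  shows "u = p \<or> (\<exists>q'. tri q q' u)"
proof -
  obtain k where "cyc u q k" using a by (auto simp: arrows_def split: if_splits)
  then consider "tri u q k" | "tri q k u" | "tri k u q" unfolding cyc_def by blast
  then show ?thesis
  proof cases
    case 1
    then show ?thesis using tri_parent_unique(1)[OF t] by blast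
  next
    case 3
    then show ?thesis using tri_parent_unique(3)[OF t] by blast
  qed blast
qed

lemma arrow_into_left:
  assumes t: "tri p q r" and a: "arrows u r > 0"
  shows "u = q \<or> (\<exists>q'. tri r q' u)"
proof -
  obtain k where "cyc u r k" using a by (auto simp: arrows_def split: if_splits)
  then consider "tri u r k" | "tri r k u" | "tri k u r" unfolding cyc_def by blast
  then show ?thesis
  proof cases
    case 1
    then show ?thesis using tri_parent_unique(3)[OF _ t] by blast
  next
    case 3
    then have "p = k" using tri_parent_unique(2)[OF t] by blast
    then show ?thesis using 3 tri_unique[OF t] by blast
  qed blast
qed

abbreviation paths :: "nat \<Rightarrow> (nat \<times> nat) set" where
  "paths m \<equiv> {(p, q). arrows p q > 0} ^^ m"

text \<open>A path entering the part of the dissection below \<open>p\<close> does so through \<open>p\<close>.\<close>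

lemma path_through_parent:
  "tri p q r \<Longrightarrow>
    ((i0, q) \<in> paths m \<longrightarrow> (\<exists>m'<m. (i0, p) \<in> paths m')) \<and>
    ((i0, r) \<in> paths m \<longrightarrow> (\<exists>m'<m. (i0, q) \<in> paths m'))"
proof (induction m arbitrary: p q r rule: less_induct)
  case (less m)
  note t = less.prems
  note d = triD[OF t]
  show ?case
  proof (cases m)
    case 0
    have "i0 \<noteq> q" "i0 \<noteq> r" using root d by auto
    then show ?thesis using 0 by simp
  next
    case (Suc m0)
    have "\<exists>m'<m. (i0, p) \<in> paths m'" if path: "(i0, q) \<in> paths m"
    proof -
      obtain u where u: "(i0, u) \<in> paths m0" "arrows u q > 0" using path Suc by auto
      from arrow_into_right[OF t u(2)] show ?thesis
      proof
        assume "u = p"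
        then show ?thesis using u Suc by blast
      next
        assume "\<exists>q'. tri q q' u"
        then obtain q' where t': "tri q q' u" by blast
        \<comment> \<open>The last step came from below q. By induction the path visited the right
          part q' of q earlier, before that q itself, and before that p.\<close>
        obtain m1 where "m1 < m0" "(i0, q') \<in> paths m1" using less.IH[of m0, OF _ t'] u Suc by auto
        moreover from this obtain m2 where "m2 < m1" "(i0, q) \<in> paths m2"
          using less.IH[of m1, OF _ t'] Suc by auto
        moreover from this calculation obtain m3 where "m3 < m2" "(i0, p) \<in> paths m3"
          using less.IH[of m2, OF _ t] Suc by auto
        ultimately have "m3 < m" "(i0, p) \<in> paths m3" using Suc by auto
        then show ?thesis by blast
      qed
    qed
    moreover have "\<exists>m'<m. (i0, q) \<in> paths m'" if path: "(i0, r) \<in> paths m"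
    proof -
      obtain u where u: "(i0, u) \<in> paths m0" "arrows u r > 0" using path Suc by auto
      from arrow_into_left[OF t u(2)] show ?thesis
      proof
        assume "u = q"
        then show ?thesis using u Suc by blast
      next
        assume "\<exists>q'. tri r q' u"
        then obtain q' where t': "tri r q' u" by blast
        obtain m1 where "m1 < m0" "(i0, q') \<in> paths m1" using less.IH[of m0, OF _ t'] u Suc by auto
        moreover from this obtain m2 where "m2 < m1" "(i0, r) \<in> paths m2"
          using less.IH[of m1, OF _ t'] Suc by auto
        moreover from this calculation obtain m3 where "m3 < m2" "(i0, q) \<in> paths m3"
          using less.IH[of m2, OF _ t] Suc by auto
        ultimately have "m3 < m" "(i0, q) \<in> paths m3" using Suc by auto
        then show ?thesis by blast
      qed
    qed
    ultimately show ?thesis by blast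
  qed
qed

text \<open>From a parent the right part is one arrow away, and the left part two, via the right
  one.\<close>

lemma reachable: "i \<in> {1..n} \<Longrightarrow> \<exists>m. (i0, i) \<in> paths m"
proof (induction "n + 2 - len i" arbitrary: i rule: less_induct)
  case less
  show ?case
  proof (cases "i = i0")
    case True
    have "(i0, i) \<in> paths 0" using True by simp
    then show ?thesis by blast
  next
    case False
    then obtain p j where pj: "tri p i j \<or> tri p j i" using parent_exists less.prems by blast
    have "len p \<le> n + 2" using pj triD(10) unfolding len_def by (metis diff_le_self le_trans)
    moreover have "len i < len p" using pj tri_len by blast
    ultimately obtain m where m: "(i0, p) \<in> paths m"
      using less.hyps[of p] pj triD(1) by (metis diff_less_mono2 less_le_trans)
    from pj show ?thesis
    proof
      assume "tri p i j"
      then have "arrows p i > 0" by (auto simp: arrows_def cyc_def)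
      then have "(i0, i) \<in> paths (Suc m)" using m by auto
      then show ?thesis by blast
    next
      assume "tri p j i"
      then have "arrows p j > 0" "arrows j i > 0" by (auto simp: arrows_def cyc_def)
      then have "(i0, i) \<in> paths (Suc (Suc m))" using m by auto
      then show ?thesis by blast
    qed
  qed
qed

text \<open>A shortest path to q has visited p, and one to r has visited q. So each arrow of a
  3-cycle falls under exactly one of the three conditions in \<open>gcs\<close>.\<close>

lemma path_dist_tri:
  assumes t: "tri p q r"
  shows "path_dist arrows i0 p < path_dist arrows i0 q" "path_dist arrows i0 q < path_dist arrows i0 r"
proof -
  have path: "(i0, i) \<in> paths (path_dist arrows i0 i)" if "i \<in> {1..n}" for i
    using reachable[OF that] unfolding path_dist_def by (rule LeastI_ex)
  have le: "path_dist arrows i0 i \<le> m" if "(i0, i) \<in> paths m" for i m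
    using that unfolding path_dist_def by (rule Least_le)
  note d = triD[OF t]
  show "path_dist arrows i0 p < path_dist arrows i0 q"
    using path_through_parent[OF t] path[OF d(2)] le by (meson le_less_trans)
  show "path_dist arrows i0 q < path_dist arrows i0 r"
    using path_through_parent[OF t] path[OF d(3)] le by (meson le_less_trans)
qed

end

context rooted_curves
begin

text \<open>Transposes the data: the sequences attached to the diagonals become 0/1-states along the
  curves, by reading at i the position that the curve occupies there. \<open>state_sequences\<close>
  is the inverse.\<close>

definition curve_states :: "(nat \<Rightarrow> nat \<Rightarrow> nat) \<Rightarrow> (nat \<times> nat) \<times> nat \<Rightarrow> nat \<Rightarrow> nat" where
  "curve_states s = (\<lambda>c\<in>copies. \<lambda>i\<in>crossing_set c. s i (rank i c))"

definition state_sequences :: "((nat \<times> nat) \<times> nat \<Rightarrow> nat \<Rightarrow> nat) \<Rightarrow> nat \<Rightarrow> nat \<Rightarrow> nat" where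
  "state_sequences g = (\<lambda>i\<in>{1..n}. \<lambda>t\<in>{1..crossing_count i}. g (inv_into (crossers i) (rank i) t) i)"

lemma crossing_set_subset: "c \<in> copies \<Longrightarrow> crossing_set c \<subseteq> {1..n}"
  by (cases c rule: crossing_set.cases) (auto simp: crossed_def)

lemma curve_states_apply: "c \<in> crossers i \<Longrightarrow> curve_states s c i = s i (rank i c)"
  by (simp add: curve_states_def crossers_def)

text \<open>The positions t up to \<open>sigma\<close> enumerate the curves around the corner by
  rank or corank according to \<open>match_ranks\<close>, and the two entries compared at t belong
  to one curve.\<close>

lemma gcs_pair_conditions:
  assumes t: "tri p q r"
  shows "(\<forall>t\<ge>1. real t \<le> sigma (crossing_count p) (crossing_count q) (crossing_count r) \<longrightarrow>
        (s p t, s q t) \<noteq> (1, 0)) \<longleftrightarrow>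
      (\<forall>c\<in>crossers p \<inter> crossers q. (s p (rank p c), s q (rank q c)) \<noteq> (1, 0))"
      (is ?case1)
    and "(\<forall>t\<ge>1. real t \<le> sigma (crossing_count r) (crossing_count p) (crossing_count q) \<longrightarrow>
        (s r (crossing_count r + 1 - t), s p (crossing_count p + 1 - t)) \<noteq> (1, 0)) \<longleftrightarrow>
      (\<forall>c\<in>crossers r \<inter> crossers p. (s r (rank r c), s p (rank p c)) \<noteq> (1, 0))"
      (is ?case2)
    and "(\<forall>t\<ge>1. real t \<le> sigma (crossing_count q) (crossing_count r) (crossing_count p) \<longrightarrow>
        (s q (crossing_count q + 1 - t), s r t) \<noteq> (1, 0)) \<longleftrightarrow>
      (\<forall>c\<in>crossers q \<inter> crossers r. (s q (rank q c), s r (rank r c)) \<noteq> (1, 0))"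
      (is ?case3)
proof -
  have cyc: "cyc p q r" "cyc q r p" "cyc r p q" using t by (auto simp: cyc_def)
  note m = match_ranks[OF t]
  have rk: "crossing_count i + 1 - corank i c = rank i c" if "c \<in> crossers i" for i c
    using rank_corank[OF that] by simp
  have all: "(\<forall>t\<ge>1. real t \<le> real (card B) \<longrightarrow> R t) \<longleftrightarrow> (\<forall>c\<in>B. R (f c))"
    if "f ` B = {1..card B}" for f :: "(nat \<times> nat) \<times> nat \<Rightarrow> nat" and B R
  proof -
    have "(\<forall>t\<ge>1. real t \<le> real (card B) \<longrightarrow> R t) \<longleftrightarrow> (\<forall>t\<in>f ` B. R t)" unfolding that by auto
    then show ?thesis by simp
  qed
  show ?case1
    unfolding sigma_crossers[OF cyc(1)] all[OF m(2)] using m(1) by (intro ball_cong) auto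
  show ?case2
    unfolding sigma_crossers[OF cyc(3)] all[OF m(4)]
  proof (intro ball_cong refl)
    fix c assume "c \<in> crossers r \<inter> crossers p"
    then have "crossing_count r + 1 - corank r c = rank r c"
      "crossing_count p + 1 - corank r c = rank p c" using rk m(3) by (metis IntE)+
    then show "((s r (crossing_count r + 1 - corank r c), s p (crossing_count p + 1 - corank r c)) \<noteq> (1, 0)) =
        ((s r (rank r c), s p (rank p c)) \<noteq> (1, 0))" by (simp only:)
  qed
  show ?case3
    unfolding sigma_crossers[OF cyc(2)] all[OF m(6)]
  proof (intro ball_cong refl)
    fix c assume "c \<in> crossers q \<inter> crossers r"
    then have "crossing_count q + 1 - corank q c = rank q c" "corank q c = rank r c"
      using rk m(5) by (metis IntE)+
    then show "((s q (crossing_count q + 1 - corank q c), s r (corank q c)) \<noteq> (1, 0)) =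
        ((s q (rank q c), s r (rank r c)) \<noteq> (1, 0))" by (simp only:)
  qed
qed

text \<open>Neither distances nor the three ways of counting are left on the right-hand side: no
  curve has the states (1,0) along an arrow, which is the condition in
  \<open>compatible\<close>.\<close>

lemma gcs_iff:
  assumes s: "s \<in> (\<Pi>\<^sub>E i\<in>{1..n}. {1..crossing_count i} \<rightarrow>\<^sub>E {0, 1})"
  shows "s \<in> gcs n arrows i0 crossing_count \<longleftrightarrow>
    (\<forall>i j k. cyc i j k \<longrightarrow> (\<forall>c\<in>crossers i \<inter> crossers j. (s i (rank i c), s j (rank j c)) \<noteq> (1, 0)))"
    (is "_ \<longleftrightarrow> ?R")
proof -
  let ?d = "path_dist arrows i0" and ?a = crossing_count
  let ?C = "\<lambda>i j k. \<forall>t\<ge>1. real t \<le> sigma (?a i) (?a j) (?a k) \<longrightarrow>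
             (?d i < ?d j \<and> ?d j < ?d k \<longrightarrow> (s i t, s j t) \<noteq> (1, 0)) \<and>
             (?d j < ?d k \<and> ?d k < ?d i \<longrightarrow> (s i (?a i + 1 - t), s j (?a j + 1 - t)) \<noteq> (1, 0)) \<and>
             (?d k < ?d i \<and> ?d i < ?d j \<longrightarrow> (s i (?a i + 1 - t), s j t) \<noteq> (1, 0))"
  let ?G = "\<lambda>i j. \<forall>c\<in>crossers i \<inter> crossers j. (s i (rank i c), s j (rank j c)) \<noteq> (1, 0)"
  have gcs: "s \<in> gcs n arrows i0 ?a \<longleftrightarrow> (\<forall>i j k. cyc i j k \<longrightarrow> ?C i j k)"
    using s unfolding gcs_def three_cycle_arrows Let_def by blast
  have "?C i j k \<longleftrightarrow> ?G i j" if "cyc i j k" for i j k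
  proof -
    from that consider "tri i j k" | "tri j k i" | "tri k i j" unfolding cyc_def by blast
    then show ?thesis
    proof cases
      case 1
      note o = path_dist_tri[OF 1]
      show ?thesis unfolding gcs_pair_conditions(1)[OF 1, symmetric] using o by auto
    next
      case 2
      note o = path_dist_tri[OF 2]
      show ?thesis unfolding gcs_pair_conditions(2)[OF 2, symmetric] using o by auto
    next
      case 3
      note o = path_dist_tri[OF 3]
      show ?thesis unfolding gcs_pair_conditions(3)[OF 3, symmetric] using o by auto
    qed
  qed
  then show ?thesis unfolding gcs by blast
qed

end

section \<open>Globally compatible sequences\<close>

context rooted_curves
begin

lemma rank_crossers:
  assumes "c \<in> crossers i"
  shows "rank i c \<in> {1..crossing_count i}" "inv_into (crossers i) (rank i) (rank i c) = c"
  using rank_bij_betw[of i] assms by (auto simp: bij_betw_def)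

lemma inv_rank:
  assumes "t \<in> {1..crossing_count i}"
  shows "inv_into (crossers i) (rank i) t \<in> crossers i" "rank i (inv_into (crossers i) (rank i) t) = t"
  using rank_bij_betw[of i] assms
  by (metis bij_betw_def inv_into_into, metis bij_betw_def f_inv_into_f)

lemma crossers_carrier: "c \<in> crossers i \<Longrightarrow> c \<in> copies \<and> i \<in> crossing_set c \<and> i \<in> {1..n}"
  using crossing_set_subset unfolding crossers_def by blast

lemma state_sequences_rank: "c \<in> crossers i \<Longrightarrow> state_sequences g i (rank i c) = g c i"
  using rank_crossers crossers_carrier by (simp add: state_sequences_def)

lemma curve_states_inverse:
  assumes g: "g \<in> (\<Pi>\<^sub>E c\<in>copies. compatible (crossing_set c))"
  shows "curve_states (state_sequences g) = g"
proof (intro ext)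
  fix c i
  show "curve_states (state_sequences g) c i = g c i"
  proof (cases "c \<in> copies")
    case True
    then have gc: "g c \<in> crossing_set c \<rightarrow>\<^sub>E {0, 1}"
      using PiE_mem[OF g True] by (simp add: compatible_def)
    show ?thesis
    proof (cases "i \<in> crossing_set c")
      case i: True
      then have "c \<in> crossers i" using True by (simp add: crossers_def)
      then show ?thesis by (simp add: curve_states_apply state_sequences_rank)
    next
      case False
      then show ?thesis using gc True by (simp add: curve_states_def PiE_def extensional_def)
    qed
  next
    case False
    then show ?thesis using PiE_arb[OF g False] by (simp add: curve_states_def)
  qed
qed

lemma state_sequences_in_gcs:
  assumes g: "g \<in> (\<Pi>\<^sub>E c\<in>copies. compatible (crossing_set c))"
  shows "state_sequences g \<in> gcs n arrows i0 crossing_count"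
proof -
  have g_comp: "g c \<in> compatible (crossing_set c)" if "c \<in> copies" for c using g that by auto
  have val: "g c i \<in> {0, 1}" if "c \<in> crossers i" for c i
    using g_comp[of c] crossers_carrier[OF that] unfolding compatible_def by (blast dest: PiE_mem)
  have "state_sequences g \<in> (\<Pi>\<^sub>E i\<in>{1..n}. {1..crossing_count i} \<rightarrow>\<^sub>E {0, 1})"
    unfolding state_sequences_def restrict_PiE_iff by (intro ballI val inv_rank(1))
  moreover have "(state_sequences g i (rank i c), state_sequences g j (rank j c)) \<noteq> (1, 0)"
    if "cyc i j k" "c \<in> crossers i \<inter> crossers j" for i j k c
  proof -
    have "c \<in> crossers i" "c \<in> crossers j" using that by auto
    then have "\<not> bad (crossing_set c) (g c) i j" "i \<in> crossing_set c" "j \<in> crossing_set c"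
      using g_comp[of c] crossers_carrier that(1) unfolding compatible_def by blast+
    then show ?thesis
      using \<open>c \<in> crossers i\<close> \<open>c \<in> crossers j\<close> by (simp add: state_sequences_rank bad_def)
  qed
  ultimately show ?thesis using gcs_iff by blast
qed

lemma gcs_sequences: "s \<in> gcs n arrows i0 crossing_count \<Longrightarrow>
    s \<in> (\<Pi>\<^sub>E i\<in>{1..n}. {1..crossing_count i} \<rightarrow>\<^sub>E {0, 1})"
  unfolding gcs_def by blast

lemma gcs_value:
  assumes "s \<in> gcs n arrows i0 crossing_count" "i \<in> {1..n}" "t \<in> {1..crossing_count i}"
  shows "s i t \<in> {0, 1}"
  using PiE_mem[OF PiE_mem[OF gcs_sequences[OF assms(1)] assms(2)] assms(3)] .

lemma state_sequences_inverse:
  assumes s: "s \<in> gcs n arrows i0 crossing_count"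
  shows "state_sequences (curve_states s) = s"
proof (intro ext)
  fix i t
  note s' = gcs_sequences[OF s]
  show "state_sequences (curve_states s) i t = s i t"
  proof (cases "i \<in> {1..n}")
    case True
    have si: "s i \<in> {1..crossing_count i} \<rightarrow>\<^sub>E {0, 1}" using s' True by (rule PiE_mem)
    show ?thesis
    proof (cases "t \<in> {1..crossing_count i}")
      case t: True
      then have "state_sequences (curve_states s) i t =
          curve_states s (inv_into (crossers i) (rank i) t) i"
        using True by (simp add: state_sequences_def)
      then show ?thesis using curve_states_apply inv_rank[OF t] by simp
    next
      case False
      then have "s i t = undefined" using PiE_arb[OF si] by blast
      then show ?thesis using False True by (simp add: state_sequences_def del: atLeastAtMost_iff)
    qed
  next
    case False
    then have "s i = undefined" using PiE_arb[OF s'] by blast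
    then show ?thesis using False by (simp add: state_sequences_def del: atLeastAtMost_iff)
  qed
qed

lemma curve_states_compatible:
  assumes s: "s \<in> gcs n arrows i0 crossing_count"
  shows "curve_states s \<in> (\<Pi>\<^sub>E c\<in>copies. compatible (crossing_set c))"
proof (rule PiE_I)
  fix c assume c: "c \<in> copies"
  have mem: "c \<in> crossers i" if "i \<in> crossing_set c" for i using c that by (simp add: crossers_def)
  have "curve_states s c \<in> crossing_set c \<rightarrow>\<^sub>E {0, 1}"
  proof (rule PiE_I)
    fix i assume "i \<in> crossing_set c"
    then have "c \<in> crossers i" by (rule mem)
    then show "curve_states s c i \<in> {0, 1}"
      using gcs_value[OF s] rank_crossers(1) crossers_carrier curve_states_apply by metis
  next
    fix i assume "i \<notin> crossing_set c"
    then show "curve_states s c i = undefined" using c by (simp add: curve_states_def)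
  qed
  moreover have "\<not> bad (crossing_set c) (curve_states s c) i j" if "cyc i j k" for i j k
  proof
    assume b: "bad (crossing_set c) (curve_states s c) i j"
    then have "c \<in> crossers i" "c \<in> crossers j" using mem by (auto simp: bad_def)
    moreover from this have "(s i (rank i c), s j (rank j c)) \<noteq> (1, 0)"
      using s gcs_iff[OF gcs_sequences[OF s]] that by blast
    ultimately show False using b by (simp add: bad_def curve_states_apply)
  qed
  ultimately show "curve_states s c \<in> compatible (crossing_set c)" by (auto simp: compatible_def)
next
  fix c assume "c \<notin> copies"
  then show "curve_states s c = undefined" by (simp add: curve_states_def)
qed

lemma sum_gcs:
  "(\<Sum>g\<in>(\<Pi>\<^sub>E c\<in>copies. compatible (crossing_set c)). F g) =
    (\<Sum>s\<in>gcs n arrows i0 crossing_count. F (curve_states s))"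
  by (rule sum.reindex_bij_witness[where i = curve_states and j = state_sequences])
    (simp_all add: curve_states_inverse state_sequences_in_gcs state_sequences_inverse
      curve_states_compatible)

text \<open>An integer by construction, whereas \<open>gcs_exponent\<close> is real because of the
  halves in \<open>sigma\<close>.\<close>

definition total_exponent :: "(nat \<Rightarrow> nat \<Rightarrow> nat) \<Rightarrow> nat \<Rightarrow> int" where
  "total_exponent s i = (\<Sum>c\<in>copies. curve_exponent (crossing_set c) (curve_states s c) i)"

lemma ones_eq: "ones crossing_count s i = (\<Sum>c\<in>crossers i. s i (rank i c))"
  unfolding ones_def using sum.reindex_bij_betw[OF rank_bij_betw] by metis

lemma ones_le:
  assumes "s \<in> gcs n arrows i0 crossing_count" "i \<in> {1..n}"
  shows "ones crossing_count s i \<le> crossing_count i"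
proof -
  have "(\<Sum>t=1..crossing_count i. s i t) \<le> (\<Sum>t=1..crossing_count i. 1)"
    using gcs_value[OF assms] by (intro sum_mono) fastforce
  then show ?thesis by (simp add: ones_def)
qed

text \<open>Over all curves, the three terms of \<open>corner_exponent\<close> count the zeros at j,
  the ones at k and the curves crossing both; the last number is a \<open>sigma\<close> by
  \<open>sigma_crossers\<close>.\<close>

lemma sum_corner_exponents:
  assumes s: "s \<in> gcs n arrows i0 crossing_count" and jk: "j \<in> {1..n}" "k \<in> {1..n}"
  shows "(\<Sum>c\<in>copies. corner_exponent (crossing_set c) (curve_states s c) j k) =
    int (zeros crossing_count s j) + int (ones crossing_count s k) - int (card (crossers j \<inter> crossers k))"
proof -
  have "corner_exponent (crossing_set c) (curve_states s c) j k =
      (if c \<in> crossers j then 1 - int (s j (rank j c)) else 0) +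
      (if c \<in> crossers k then int (s k (rank k c)) else 0) -
      (if c \<in> crossers j \<inter> crossers k then 1 else 0)" if "c \<in> copies" for c
    using that by (auto simp: corner_exponent_def crossers_def curve_states_def)
  then have "(\<Sum>c\<in>copies. corner_exponent (crossing_set c) (curve_states s c) j k) =
      (\<Sum>c\<in>copies. if c \<in> crossers j then 1 - int (s j (rank j c)) else 0) +
      (\<Sum>c\<in>copies. if c \<in> crossers k then int (s k (rank k c)) else 0) -
      (\<Sum>c\<in>copies. if c \<in> crossers j \<inter> crossers k then 1 else 0)"
    by (simp add: sum.distrib sum_subtractf)
  also have "(\<Sum>c\<in>copies. if c \<in> crossers j then 1 - int (s j (rank j c)) else 0) =
      (\<Sum>c\<in>crossers j. 1 - int (s j (rank j c)))"
    by (rule sum.mono_neutral_cong_right) (auto simp: finite_copies crossers_def)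
  also have "(\<Sum>c\<in>copies. if c \<in> crossers k then int (s k (rank k c)) else 0) =
      (\<Sum>c\<in>crossers k. int (s k (rank k c)))"
    by (rule sum.mono_neutral_cong_right) (auto simp: finite_copies crossers_def)
  also have "(\<Sum>c\<in>copies. if c \<in> crossers j \<inter> crossers k then 1 else 0) =
      (\<Sum>c\<in>crossers j \<inter> crossers k. 1 :: int)"
    by (rule sum.mono_neutral_cong_right) (auto simp: finite_copies crossers_def)
  also have "(\<Sum>c\<in>crossers j. 1 - int (s j (rank j c))) = int (zeros crossing_count s j)"
    using ones_le[OF s jk(1)] by (simp add: zeros_def ones_eq sum_subtractf of_nat_diff)
  finally show ?thesis by (simp add: ones_eq)
qed

lemma total_exponent_eq:
  assumes s: "s \<in> gcs n arrows i0 crossing_count"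
  shows "real_of_int (total_exponent s i) = gcs_exponent n arrows crossing_count s i"
proof -
  have sig: "sigma (real (crossing_count j)) (real (crossing_count k)) (real (crossing_count i)) =
      real (card (crossers j \<inter> crossers k))" if "(j, k) \<in> cyc_pairs i" for j k
    using that sigma_crossers[of j k i] cyc_rotate by (auto simp: cyc_pairs_def)
  have "total_exponent s i =
      (\<Sum>(j, k)\<in>cyc_pairs i. \<Sum>c\<in>copies. corner_exponent (crossing_set c) (curve_states s c) j k)"
    unfolding total_exponent_def curve_exponent_def case_prod_unfold by (rule sum.swap)
  also have "\<dots> = (\<Sum>(j, k)\<in>cyc_pairs i. int (zeros crossing_count s j) + int (ones crossing_count s k)
      - int (card (crossers j \<inter> crossers k)))"
    using sum_corner_exponents[OF s] cyc_carrier by (intro sum.cong refl) (auto simp: cyc_pairs_def)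
  finally have "real_of_int (total_exponent s i) =
      (\<Sum>(j, k)\<in>cyc_pairs i. real (zeros crossing_count s j) + real (ones crossing_count s k)
      - sigma (crossing_count j) (crossing_count k) (crossing_count i))"
    using sig by (auto intro!: sum.cong)
  then show ?thesis
    unfolding gcs_exponent_def sum_arrows_out sum_arrows_in sum_arrows_cycle
    by (simp add: case_prod_unfold sum.distrib sum_subtractf)
qed

text \<open>The product over curves of sums over states is a sum over families of states, and these
  correspond to globally compatible sequences. The denominators of the single curves multiply to one
  factor \<open>x i\<close> per crossing.\<close>

theorem multicurve_expansion:
  "(\<Prod>(X, Y)\<in>Cv. lam X Y ^ mult (X, Y)) =
    (\<Prod>l=1..n. x l powi (- int (crossing_count l))) *
    (\<Sum>s\<in>gcs n arrows i0 crossing_count. \<Prod>i=1..n. x i powi total_exponent s i)"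
proof -
  define length where "length = (\<lambda>c :: (nat \<times> nat) \<times> nat. lam (fst (fst c)) (snd (fst c)))"
  have "(\<Prod>(X, Y)\<in>Cv. lam X Y ^ mult (X, Y)) = (\<Prod>D\<in>Cv. \<Prod>m<mult D. length (D, m))"
    by (simp add: length_def case_prod_unfold)
  also have "\<dots> = (\<Prod>c\<in>copies. length c)"
    unfolding copies_def by (subst prod.Sigma) (auto simp: finite_curves)
  finally have lengths: "(\<Prod>(X, Y)\<in>Cv. lam X Y ^ mult (X, Y)) = (\<Prod>c\<in>copies. length c)" .
  have fin: "finite (crossing_set c)" for c
    by (cases c rule: crossing_set.cases) (simp add: finite_crossed)
  have fin_compatible: "finite (compatible (crossing_set c))" for c
  proof (rule finite_subset)
    show "compatible (crossing_set c) \<subseteq> crossing_set c \<rightarrow>\<^sub>E {0, 1}"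
      unfolding compatible_def by (rule Collect_restrict)
    show "finite (crossing_set c \<rightarrow>\<^sub>E {0, 1 :: nat})" by (rule finite_PiE) (simp_all add: fin)
  qed
  have "(\<Prod>c\<in>copies. \<Prod>i\<in>crossing_set c. x i) = (\<Prod>c\<in>copies. \<Prod>i=1..n. if c \<in> crossers i then x i else 1)"
  proof (rule prod.cong[OF refl])
    fix c assume "c \<in> copies"
    then show "(\<Prod>i\<in>crossing_set c. x i) = (\<Prod>i=1..n. if c \<in> crossers i then x i else 1)"
      using crossing_set_subset by (intro prod.mono_neutral_cong_left) (auto simp: crossers_def)
  qed
  also have "\<dots> = (\<Prod>i=1..n. \<Prod>c\<in>copies. if c \<in> crossers i then x i else 1)" by (rule prod.swap)
  also have "\<dots> = (\<Prod>i=1..n. x i ^ crossing_count i)"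
  proof (intro prod.cong refl)
    fix i
    have "(\<Prod>c\<in>copies. if c \<in> crossers i then x i else 1) = (\<Prod>c\<in>crossers i. x i)"
      by (rule prod.mono_neutral_cong_right) (auto simp: finite_copies crossers_def)
    then show "(\<Prod>c\<in>copies. if c \<in> crossers i then x i else 1) = x i ^ crossing_count i" by simp
  qed
  finally have crossings: "(\<Prod>c\<in>copies. \<Prod>i\<in>crossing_set c. x i) = (\<Prod>i=1..n. x i ^ crossing_count i)" .
  have single: "length c * (\<Prod>i\<in>crossing_set c. x i) =
      (\<Sum>s\<in>compatible (crossing_set c). \<Prod>i=1..n. x i powi curve_exponent (crossing_set c) s i)"
    if c: "c \<in> copies" for c
  proof -
    obtain X Y m where "c = ((X, Y), m)" "(X, Y) \<in> Cv" using c by (rule copiesE)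
    then show ?thesis using curve_expansion_monomials curves_admissible by (simp add: length_def)
  qed
  have "(\<Prod>c\<in>copies. length c) * (\<Prod>i=1..n. x i ^ crossing_count i) =
      (\<Prod>c\<in>copies. \<Sum>s\<in>compatible (crossing_set c). \<Prod>i=1..n. x i powi curve_exponent (crossing_set c) s i)"
    unfolding crossings[symmetric] prod.distrib[symmetric] by (rule prod.cong[OF refl single])
  also have "\<dots> = (\<Sum>g\<in>(\<Pi>\<^sub>E c\<in>copies. compatible (crossing_set c)).
      \<Prod>c\<in>copies. \<Prod>i=1..n. x i powi curve_exponent (crossing_set c) (g c) i)"
    by (rule prod_sum_PiE[OF finite_copies fin_compatible])
  also have "\<dots> = (\<Sum>s\<in>gcs n arrows i0 crossing_count.
      \<Prod>c\<in>copies. \<Prod>i=1..n. x i powi curve_exponent (crossing_set c) (curve_states s c) i)"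
    by (rule sum_gcs)
  also have "\<dots> = (\<Sum>s\<in>gcs n arrows i0 crossing_count. \<Prod>i=1..n. x i powi total_exponent s i)"
    unfolding total_exponent_def using x_nonzero
    by (intro sum.cong refl) (subst prod.swap, simp add: power_int_sum)
  finally have expansion: "(\<Prod>c\<in>copies. length c) * (\<Prod>i=1..n. x i ^ crossing_count i) =
    (\<Sum>s\<in>gcs n arrows i0 crossing_count. \<Prod>i=1..n. x i powi total_exponent s i)" .
  have "(\<Prod>l=1..n. x l powi (- int (crossing_count l))) * (\<Prod>i=1..n. x i ^ crossing_count i) = 1"
    unfolding prod.distrib[symmetric] using x_nonzero by (intro prod.neutral) (simp add: power_int_minus)
  then have "(\<Prod>c\<in>copies. length c) = ((\<Prod>l=1..n. x l powi (- int (crossing_count l))) *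
      (\<Prod>i=1..n. x i ^ crossing_count i)) * (\<Prod>c\<in>copies. length c)" by simp
  also have "\<dots> = (\<Prod>l=1..n. x l powi (- int (crossing_count l))) *
      ((\<Prod>c\<in>copies. length c) * (\<Prod>i=1..n. x i ^ crossing_count i))" by (simp only: mult_ac)
  finally show ?thesis unfolding lengths expansion .
qed

end

section \<open>Choosing the root\<close>

text \<open>The other conceivable 3-cycle consists of three edges at the common vertex a. Each arrow
  turns counterclockwise about a, so their far ends would have to return to the start within less
  than a full turn. Otherwise Y and Z meet at c, and uniqueness of the third vertex applies.\<close>

lemma third_side:
  assumes S: "triangulation n S" and abc: "ccw a b c" "X = {a, b}" "Y = {a, c}" "{b, c} \<in> edges n S"
    and E: "X \<in> edges n S" "Z \<in> edges n S"
    and YZ: "triangle_arrow n S Y Z" and ZX: "triangle_arrow n S Z X"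
  shows "Z = {b, c}"
proof -
  obtain p q r where 1: "ccw p q r" "Y = {p, q}" "Z = {p, r}" "{q, r} \<in> edges n S"
    using YZ unfolding triangle_arrow_def by blast
  have ne: "a \<noteq> b" "b \<noteq> c" "a \<noteq> c" using abc ccw_distinct by blast+
  have "{a, c} = {p, q}" using abc 1 by metis
  then consider "p = c" "q = a" | "p = a" "q = c" unfolding doubleton_eq_iff by blast
  then show ?thesis
  proof cases
    case p: 1
    have ac: "ccw a r c" "ccw a b c" using 1(1) abc(1) ccw_rotate unfolding p by blast+
    moreover have "{a, r} \<in> edges n S" "{r, c} \<in> edges n S" "{a, b} \<in> edges n S"
      using 1 E abc unfolding p by (metis insert_commute)+
    ultimately have "r = b"
      using opposite_vertex_unique[OF S, of a r c b] abc(4) by (simp add: opposite_vertex_def)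
    then show ?thesis using 1(3) p by blast
  next
    case p: 2
    obtain u v w where 2: "ccw u v w" "Z = {u, v}" "X = {u, w}"
      using ZX unfolding triangle_arrow_def by blast
    have acr: "ccw a c r" using 1(1) p by simp
    then have "r \<noteq> b" using abc(1) ccw_asym by blast
    have "{a, r} = {u, v}" "{a, b} = {u, w}" using 1(3) 2 abc(2) p by metis+
    moreover have "v \<noteq> w" "u \<noteq> v" "u \<noteq> w" using 2(1) ccw_distinct by blast+
    ultimately have "u = a \<and> v = r \<and> w = b"
      using ne \<open>r \<noteq> b\<close> unfolding doubleton_eq_iff by metis
    then have "ccw a r b" using 2(1) by simp
    then show ?thesis using acr abc(1) unfolding ccw_def by linarith
  qed
qed

text \<open>Geometric form of the condition that every arrow of the quiver lies in a
  3-cycle.\<close>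

definition dense_triangulation :: "nat \<Rightarrow> (nat \<Rightarrow> nat set) \<Rightarrow> bool" where
  "dense_triangulation n S \<longleftrightarrow> triangulation n S \<and>
     (\<forall>a b c. ccw a b c \<longrightarrow> {a, b} \<in> S ` {1..n} \<longrightarrow> {a, c} \<in> S ` {1..n} \<longrightarrow>
        {b, c} \<in> edges n S \<longrightarrow> {b, c} \<in> S ` {1..n})"

lemma dense_triangulationI:
  assumes S: "triangulation n S"
    and d: "\<And>i j. triangulation_quiver n S i j > 0 \<Longrightarrow> \<exists>k. three_cycle (triangulation_quiver n S) i j k"
  shows "dense_triangulation n S"
  unfolding dense_triangulation_def
proof (intro conjI S allI impI)
  fix a b c
  assume abc: "ccw a b c" "{b, c} \<in> edges n S" and ab: "{a, b} \<in> S ` {1..n}" and ac: "{a, c} \<in> S ` {1..n}"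
  obtain i where i: "i \<in> {1..n}" "S i = {a, b}" using ab by (metis imageE)
  obtain j where j: "j \<in> {1..n}" "S j = {a, c}" using ac by (metis imageE)
  have "triangle_arrow n S (S i) (S j)" unfolding i j using abc by (intro triangle_arrowI) simp_all
  then have "triangulation_quiver n S i j > 0" using i j by (simp add: triangulation_quiver_arrow)
  then obtain k where "three_cycle (triangulation_quiver n S) i j k" using d by blast
  then have k: "k \<in> {1..n}" "triangle_arrow n S (S j) (S k)" "triangle_arrow n S (S k) (S i)"
    unfolding three_cycle_def triangulation_quiver_arrow by (metis less_irrefl_nat)+
  have "S k = {b, c}"
    by (rule third_side[OF S abc(1) i(2) j(2) abc(2)]) (use k i in \<open>auto simp: edges_def\<close>)
  then show "{b, c} \<in> S ` {1..n}" using k(1) by (metis imageI)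
qed

text \<open>Density, applied at the corners a and c, makes the two remaining sides of the triangle
  diagonals together.\<close>

lemma dense_triangle_sides:
  assumes D: "dense_triangulation n S" and ac: "{a, c} \<in> S ` {1..n}" and b: "opposite_vertex n S a b c"
  shows "{a, b} \<in> S ` {1..n} \<and> {b, c} \<in> S ` {1..n} \<or>
    {a, b} \<in> polygon_sides n \<and> {b, c} \<in> polygon_sides n"
proof -
  have b': "ccw a b c" "{a, b} \<in> edges n S" "{b, c} \<in> edges n S"
    using b by (auto simp: opposite_vertex_def)
  have ba: "{b, a} = {a, b}" "{c, b} = {b, c}" "{c, a} = {a, c}" by blast+
  have "{b, c} \<in> S ` {1..n}" if "{a, b} \<in> S ` {1..n}"
    using D that ac b' unfolding dense_triangulation_def by blast
  moreover have "{a, b} \<in> S ` {1..n}" if "{b, c} \<in> S ` {1..n}"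
  proof -
    have "ccw c a b" using b'(1) ccw_rotate by blast
    then show ?thesis using D that ac b'(2) ba unfolding dense_triangulation_def by metis
  qed
  ultimately show ?thesis using b' unfolding edges_def by blast
qed

text \<open>If neither triangle at the diagonal is an ear, density turns all four sides of its
  quadrilateral into diagonals, each joined to it by an arrow, and the degree is at least 4.\<close>

lemma ear_exists:
  assumes D: "dense_triangulation n S" and i0: "i0 \<in> {1..n}"
    and deg: "vertex_degree n (triangulation_quiver n S) i0 = 2"
  shows "\<exists>u v w. S i0 = {u, w} \<and> u \<noteq> w \<and> {u, v} \<in> polygon_sides n \<and> {v, w} \<in> polygon_sides n"
proof (rule ccontr)
  assume no_ear: "\<not> ?thesis"
  have S: "triangulation n S" using D by (simp add: dense_triangulation_def)
  obtain a b c d where q: "quadrilateral n S i0 a b c d" using quadrilateral_exists[OF S i0] by blast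
  note q' = q[unfolded quadrilateral_def]
  have ne: "a \<noteq> b" "b \<noteq> c" "a \<noteq> c" "c \<noteq> d" "d \<noteq> a" using q' ccw_distinct by blast+
  have "b \<noteq> d" using q' unfolding ccw_def by linarith
  have ac: "{a, c} \<in> S ` {1..n}" using q' by (metis imageI)
  have ca: "{c, a} \<in> S ` {1..n}" using ac by (metis insert_commute)
  have ob: "opposite_vertex n S a b c" "opposite_vertex n S c d a"
    using q' by (auto simp: opposite_vertex_def)
  have "S i0 = {a, c}" "S i0 = {c, a}" using q' by (metis insert_commute)+
  then have "\<not> ({a, b} \<in> polygon_sides n \<and> {b, c} \<in> polygon_sides n)"
    "\<not> ({c, d} \<in> polygon_sides n \<and> {d, a} \<in> polygon_sides n)"
    using no_ear ne(3) by blast+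
  then have sides: "{a, b} \<in> S ` {1..n}" "{b, c} \<in> S ` {1..n}" "{c, d} \<in> S ` {1..n}" "{d, a} \<in> S ` {1..n}"
    using dense_triangle_sides[OF D ac ob(1)] dense_triangle_sides[OF D ca ob(2)] by argo+
  obtain j1 where j1: "j1 \<in> {1..n}" "S j1 = {a, b}" using sides(1) by (metis imageE)
  obtain j2 where j2: "j2 \<in> {1..n}" "S j2 = {b, c}" using sides(2) by (metis imageE)
  obtain j3 where j3: "j3 \<in> {1..n}" "S j3 = {c, d}" using sides(3) by (metis imageE)
  obtain j4 where j4: "j4 \<in> {1..n}" "S j4 = {d, a}" using sides(4) by (metis imageE)
  note j = j1 j2 j3 j4
  let ?Q = "triangulation_quiver n S"
  have E: "S j \<in> edges n S" if "j \<in> {1..n}" for j using that by (auto simp: edges_def)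
  have Qp: "?Q i0 j + ?Q j i0 \<ge> 1" if "j \<in> {j1, j2, j3, j4}" for j
  proof -
    have jn: "j \<in> {1..n}" using that j by blast
    have "S j = {a, b} \<or> S j = {c, d} \<or> S j = {d, a} \<or> S j = {b, c}"
      using that by (elim insertE) (simp_all add: j)
    then have "triangle_arrow n S (S j) {a, c} \<or> triangle_arrow n S {a, c} (S j)"
      using triangle_arrow_from[OF S q E[OF jn]] triangle_arrow_to[OF S q E[OF jn]] by blast
    moreover have "S i0 = {a, c}" using q' by blast
    ultimately show ?thesis using jn i0 unfolding triangulation_quiver_arrow by auto
  qed
  have "j1 \<noteq> j2 \<and> j1 \<noteq> j3 \<and> j1 \<noteq> j4 \<and> j2 \<noteq> j3 \<and> j2 \<noteq> j4 \<and> j3 \<noteq> j4"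
    using j ne \<open>b \<noteq> d\<close> by (metis doubleton_eq_iff)
  then have "card {j1, j2, j3, j4} = 4" by simp
  then have "4 \<le> (\<Sum>j\<in>{j1, j2, j3, j4}. ?Q i0 j + ?Q j i0)"
    using sum_mono[of "{j1, j2, j3, j4}" "\<lambda>_. 1" "\<lambda>j. ?Q i0 j + ?Q j i0"] Qp by simp
  also have "\<dots> \<le> vertex_degree n ?Q i0"
    unfolding vertex_degree_def using j by (intro sum_mono2) auto
  finally show False using deg by simp
qed

section \<open>Relabelling the polygon from the tip of the root ear\<close>

definition rotate_vertex :: "nat \<Rightarrow> nat \<Rightarrow> nat \<Rightarrow> nat" where
  "rotate_vertex n v p = (p + v) mod (n + 3)"

lemma rotate_vertex_less: "rotate_vertex n v p < n + 3"
  by (simp add: rotate_vertex_def)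

lemma rotate_vertex_cases:
  assumes "v < n + 3" "p < n + 3"
  shows "rotate_vertex n v p = (if p + v < n + 3 then p + v else p + v - (n + 3))"
proof (cases "p + v < n + 3")
  case False
  then have "p + v - (n + 3) < n + 3" using assms by linarith
  then show ?thesis using False unfolding rotate_vertex_def
    by (metis le_mod_geq mod_less not_less)
qed (simp add: rotate_vertex_def)

lemma ccw_rotate_vertex:
  assumes "v < n + 3" "a < n + 3" "b < n + 3" "c < n + 3"
  shows "ccw (rotate_vertex n v a) (rotate_vertex n v b) (rotate_vertex n v c) \<longleftrightarrow> ccw a b c"
proof -
  have fwd: "ccw (rotate_vertex n v a) (rotate_vertex n v b) (rotate_vertex n v c)"
    if "ccw a b c" "a < n + 3" "b < n + 3" "c < n + 3" for a b c
    unfolding rotate_vertex_cases[OF assms(1) that(2)] rotate_vertex_cases[OF assms(1) that(3)]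
      rotate_vertex_cases[OF assms(1) that(4)]
    using that assms(1) unfolding ccw_def by (simp split: if_split; linarith)
  show ?thesis
  proof
    assume r: "ccw (rotate_vertex n v a) (rotate_vertex n v b) (rotate_vertex n v c)"
    then have "a \<noteq> b" "b \<noteq> c" "a \<noteq> c" using ccw_distinct by blast+
    then consider "ccw a b c" | "ccw a c b" using ccw_total by blast
    then show "ccw a b c"
      using fwd[of a c b] r assms ccw_asym by cases blast+
  qed (use fwd assms in blast)
qed

lemma rotate_vertex_inj:
  assumes "v < n + 3" "a < n + 3" "b < n + 3" "rotate_vertex n v a = rotate_vertex n v b"
  shows "a = b"
  using assms(4) unfolding rotate_vertex_cases[OF assms(1,2)] rotate_vertex_cases[OF assms(1,3)]
  using assms(1-3) by (simp split: if_splits)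

lemma rotate_vertex_surj:
  assumes "v < n + 3" "p < n + 3"
  shows "\<exists>q<n + 3. p = rotate_vertex n v q"
proof (cases "v \<le> p")
  case True
  then show ?thesis using assms rotate_vertex_cases[OF assms(1), of "p - v"]
    by (intro exI[of _ "p - v"]) simp
next
  case False
  then show ?thesis using assms rotate_vertex_cases[OF assms(1), of "p + (n + 3) - v"]
    by (intro exI[of _ "p + (n + 3) - v"]) simp
qed

lemma crosses_rotate_vertex:
  assumes "v < n + 3" "a < n + 3" "b < n + 3" "c < n + 3" "d < n + 3"
  shows "crosses {rotate_vertex n v a, rotate_vertex n v c} {rotate_vertex n v b, rotate_vertex n v d} \<longleftrightarrow>
    crosses {a, c} {b, d}"
  unfolding crosses_ccw using assms by (simp only: ccw_rotate_vertex)

lemma side_rotate_vertex: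
  assumes v: "v < n + 3" and pq: "p < q" "q < n + 3"
  shows "{rotate_vertex n v p, rotate_vertex n v q} \<in> polygon_sides n \<longleftrightarrow> {p, q} \<in> polygon_sides n"
proof -
  have p: "p < n + 3" using pq by simp
  have "rotate_vertex n v p \<noteq> rotate_vertex n v q" using rotate_vertex_inj[OF v p pq(2)] pq by auto
  then consider "rotate_vertex n v p < rotate_vertex n v q" | "rotate_vertex n v q < rotate_vertex n v p"
    by linarith
  then show ?thesis
  proof cases
    case 1
    show ?thesis
      unfolding polygon_sides_linear[OF 1] polygon_sides_linear[OF pq(1)]
      using 1 pq p v unfolding rotate_vertex_cases[OF v p] rotate_vertex_cases[OF v pq(2)]
      by (auto split: if_splits)
  next
    case 2
    have "{rotate_vertex n v p, rotate_vertex n v q} = {rotate_vertex n v q, rotate_vertex n v p}" by blast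
    then show ?thesis
      unfolding polygon_sides_linear[OF pq(1)]
      using polygon_sides_linear[OF 2, of n] 2 pq p v
      unfolding rotate_vertex_cases[OF v p] rotate_vertex_cases[OF v pq(2)]
      by (auto split: if_splits)
  qed
qed

lemma side_neighbours:
  assumes "{u, v} \<in> polygon_sides n"
  shows "v < n + 3 \<and> (u = rotate_vertex n v 1 \<or> u = rotate_vertex n v (n + 2))"
proof -
  obtain p q where pq: "{u, v} = {p, q}" "p < q" "q < n + 3" "q = p + 1 \<or> p = 0 \<and> q = n + 2"
    using assms by (rule polygon_sidesE)
  from pq(1) consider "u = p" "v = q" | "u = q" "v = p" unfolding doubleton_eq_iff by blast
  then show ?thesis
  proof cases
    case 1
    then have "v < n + 3" using pq by simp
    moreover from this have "u = rotate_vertex n v 1 \<or> u = rotate_vertex n v (n + 2)"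
      using 1 pq by (auto simp: rotate_vertex_cases)
    ultimately show ?thesis by blast
  next
    case 2
    then have "v < n + 3" using pq by simp
    moreover from this have "u = rotate_vertex n v 1 \<or> u = rotate_vertex n v (n + 2)"
      using 2 pq by (auto simp: rotate_vertex_cases)
    ultimately show ?thesis by blast
  qed
qed

text \<open>The tip v of the ear has the neighbours v + 1 and v - 1, the latter being v + (n + 2)
  modulo n + 3.\<close>

lemma ear_rotation:
  assumes "dense_triangulation n S" "i0 \<in> {1..n}" "vertex_degree n (triangulation_quiver n S) i0 = 2"
  shows "\<exists>v<n + 3. S i0 = {rotate_vertex n v 1, rotate_vertex n v (n + 2)}"
proof -
  obtain u v w where *: "S i0 = {u, w}" "u \<noteq> w" "{u, v} \<in> polygon_sides n" "{v, w} \<in> polygon_sides n"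
    using ear_exists[OF assms] by blast
  have "{w, v} \<in> polygon_sides n" using *(4) by (metis insert_commute)
  then have "{u, w} = {rotate_vertex n v 1, rotate_vertex n v (n + 2)}" "v < n + 3"
    using side_neighbours[OF *(3)] side_neighbours[of w v n] *(2) by blast+
  then show ?thesis using *(1) by auto
qed

text \<open>\<open>lo i\<close> and \<open>hi i\<close> are labels counted from the tip v, while T
  keeps the original ones; \<open>rt\<close> leads from the former to the latter.\<close>

locale rotated_triangulation =
  fixes n v i0 :: nat and T :: "nat \<Rightarrow> nat set" and lo hi :: "nat \<Rightarrow> nat" and L :: "nat set \<Rightarrow> 'k::field"
  assumes dense: "dense_triangulation n T" and v: "v < n + 3"
    and root_index: "i0 \<in> {1..n}" and root_lo: "lo i0 = 1" and root_hi: "hi i0 = n + 2"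
    and coords: "i \<in> {1..n} \<Longrightarrow> lo i < hi i \<and> hi i < n + 3 \<and>
          T i = {rotate_vertex n v (lo i), rotate_vertex n v (hi i)}"
    and lengths: "lambda_lengths n L"
begin

abbreviation rt :: "nat \<Rightarrow> nat" where
  "rt \<equiv> rotate_vertex n v"

lemma triangulation_T: "triangulation n T"
  using dense by (simp add: dense_triangulation_def)

lemma chord_eq:
  assumes "a < b" "b < n + 3" "c < d" "d < n + 3" "{rt a, rt b} = {rt c, rt d}"
  shows "a = c \<and> b = d"
proof -
  have lt: "a < n + 3" "c < n + 3" using assms by auto
  from assms(5) consider "rt a = rt c" "rt b = rt d" | "rt a = rt d" "rt b = rt c"
    unfolding doubleton_eq_iff by blast
  then show ?thesis
  proof cases
    case 1
    then show ?thesis using rotate_vertex_inj[OF v] lt assms by blast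
  next
    case 2
    then have "a = d" "b = c" using rotate_vertex_inj[OF v] lt assms by blast+
    then show ?thesis using assms by simp
  qed
qed

lemma coords_eq: "i \<in> {1..n} \<Longrightarrow> a < b \<Longrightarrow> b < n + 3 \<Longrightarrow> T i = {rt a, rt b} \<Longrightarrow> lo i = a \<and> hi i = b"
  using coords[of i] chord_eq by metis

lemma rt_chord: "a < b \<Longrightarrow> b < n + 3 \<Longrightarrow> {rt a, rt b} \<in> chords n"
  using rotate_vertex_inj[OF v, of a b] by (auto simp: chords_iff rotate_vertex_less)

lemma rt_crosses:
  assumes "a < c" "c < n + 3" "b < d" "d < n + 3"
  shows "crosses {rt a, rt c} {rt b, rt d} \<longleftrightarrow> a < b \<and> b < c \<and> c < d \<or> b < a \<and> a < d \<and> d < c"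
proof -
  have lt: "a < n + 3" "b < n + 3" using assms by auto
  show ?thesis
    unfolding crosses_rotate_vertex[OF v lt assms(2,4)] by (rule crosses_linear[OF assms(1,3)])
qed

lemma not_side: "i \<in> {1..n} \<Longrightarrow> {lo i, hi i} \<notin> polygon_sides n"
proof
  assume i: "i \<in> {1..n}" and "{lo i, hi i} \<in> polygon_sides n"
  then have "{rt (lo i), rt (hi i)} \<in> polygon_sides n"
    using side_rotate_vertex[OF v] coords[OF i] by blast
  then have "T i \<in> polygon_sides n" using coords[OF i] by simp
  moreover have "T i \<in> diagonals n" using triangulation_T i by (simp add: triangulation_def)
  ultimately show False by (simp add: diagonals_eq)
qed

lemma not_crossing: "i \<in> {1..n} \<Longrightarrow> j \<in> {1..n} \<Longrightarrow> \<not> (lo i < lo j \<and> lo j < hi i \<and> hi i < hi j)"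
proof -
  assume i: "i \<in> {1..n}" and j: "j \<in> {1..n}"
  have "\<not> crosses (T i) (T j)" using triangulation_T i j by (simp add: triangulation_def)
  then show ?thesis
    using rt_crosses[of "lo i" "hi i" "lo j" "hi j"] coords[OF i] coords[OF j] by metis
qed

lemma interval_bounds:
  assumes i: "i \<in> {1..n}"
  shows "1 \<le> lo i \<and> lo i + 2 \<le> hi i \<and> hi i \<le> n + 2"
proof -
  have c: "lo i < hi i" "hi i < n + 3" using coords[OF i] by auto
  have ns: "hi i \<noteq> lo i + 1" "\<not> (lo i = 0 \<and> hi i = n + 2)"
    using not_side[OF i] polygon_sides_linear[OF c(1)] c(2) by auto
  \<comment> \<open>A diagonal at the tip 0 would cross the root diagonal, which cuts the tip
    off.\<close>
  have "lo i \<noteq> 0"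
  proof
    assume z: "lo i = 0"
    then show False using not_crossing[OF i root_index] root_lo root_hi ns c by linarith
  qed
  then show ?thesis using ns(1) c by linarith
qed

text \<open>The triangle on the side of the diagonal away from the tip has, by density, two more
  diagonals or two polygon sides; in the latter case the interval has length 2.\<close>

lemma triangle_below:
  assumes i: "i \<in> {1..n}"
  shows "hi i = lo i + 2 \<or> (\<exists>q\<in>{1..n}. \<exists>r\<in>{1..n}. hi q = hi i \<and> lo r = lo i \<and> lo q = hi r)"
proof -
  note c = coords[OF i]
  note S = triangulation_T
  have Ti: "{rt (lo i), rt (hi i)} \<in> T ` {1..n}" using c i by (metis imageI)
  then have E: "{rt (lo i), rt (hi i)} \<in> edges n T" by (simp add: edges_def)
  have "ccw (lo i) (lo i + 1) (hi i)" using interval_bounds[OF i] by (simp add: ccw_def)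
  then have "ccw (rt (lo i)) (rt (lo i + 1)) (rt (hi i))"
    using ccw_rotate_vertex[OF v] c by simp
  then obtain b where b: "opposite_vertex n T (rt (lo i)) b (rt (hi i))"
    using opposite_vertex_exists[OF S E] rotate_vertex_less by blast
  then have "{rt (lo i), b} \<in> chords n"
    using edges_subset_chords[OF S] by (auto simp: opposite_vertex_def)
  then have "b < n + 3" by (simp add: chords_iff)
  then obtain m where m: "m < n + 3" "b = rt m" using rotate_vertex_surj[OF v] by blast
  have "lo i < n + 3" using c by linarith
  moreover have "ccw (rt (lo i)) (rt m) (rt (hi i))" using b m by (simp add: opposite_vertex_def)
  ultimately have "ccw (lo i) m (hi i)" using ccw_rotate_vertex[OF v] m c by blast
  then have lm: "lo i < m" "m < hi i" using c by (auto simp: ccw_def)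
  from dense_triangle_sides[OF dense Ti b] show ?thesis unfolding m(2)
  proof
    assume *: "{rt (lo i), rt m} \<in> T ` {1..n} \<and> {rt m, rt (hi i)} \<in> T ` {1..n}"
    obtain r where r: "r \<in> {1..n}" "T r = {rt (lo i), rt m}" using * by (metis imageE)
    obtain q where q: "q \<in> {1..n}" "T q = {rt m, rt (hi i)}" using * by (metis imageE)
    have "lo r = lo i \<and> hi r = m" "lo q = m \<and> hi q = hi i"
      using coords_eq r q lm m c by blast+
    then show ?thesis using r q by auto
  next
    assume "{rt (lo i), rt m} \<in> polygon_sides n \<and> {rt m, rt (hi i)} \<in> polygon_sides n"
    then have "{lo i, m} \<in> polygon_sides n" "{m, hi i} \<in> polygon_sides n"
      using side_rotate_vertex[OF v] lm m c by blast+
    then show ?thesis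
      using polygon_sides_linear[OF lm(1)] polygon_sides_linear[OF lm(2)] interval_bounds[OF i] lm
      by auto
  qed
qed

definition lam :: "nat \<Rightarrow> nat \<Rightarrow> 'k" where
  "lam a b = L {rt a, rt b}"

sublocale rooted_dissection n i0 lo hi lam
proof
  show "i \<in> {1..n} \<Longrightarrow> 1 \<le> lo i \<and> lo i + 2 \<le> hi i \<and> hi i \<le> n + 2" for i
    by (rule interval_bounds)
  show "i = j" if "i \<in> {1..n}" "j \<in> {1..n}" "lo i = lo j" "hi i = hi j" for i j
  proof -
    have "T i = T j" using coords that by metis
    then show ?thesis using triangulation_T that(1,2) unfolding triangulation_def by (metis inj_onD)
  qed
  show "\<not> (lo i < lo j \<and> lo j < hi i \<and> hi i < hi j)" if "i \<in> {1..n}" "j \<in> {1..n}" for i j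
    by (rule not_crossing[OF that])
  show "i0 \<in> {1..n}" "lo i0 = 1" "hi i0 = n + 2" by (rule root_index root_lo root_hi)+
  show "hi i = lo i + 2 \<or> (\<exists>q\<in>{1..n}. \<exists>r\<in>{1..n}. hi q = hi i \<and> lo r = lo i \<and> lo q = hi r)"
    if "i \<in> {1..n}" for i by (rule triangle_below[OF that])
  show "lam a c * lam b d = lam a b * lam c d + lam a d * lam b c"
    if "a < b" "b < c" "c < d" "d \<le> n + 2" for a b c d
  proof -
    have lt: "a < n + 3" "b < n + 3" "c < n + 3" "d < n + 3" using that by auto
    have "ccw (rt a) (rt b) (rt c)" "ccw (rt c) (rt d) (rt a)"
      using ccw_rotate_vertex[OF v] lt that by (auto simp: ccw_def)
    moreover have "{rt a, rt c} \<in> chords n" "{rt b, rt d} \<in> chords n" using rt_chord that lt by auto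
    ultimately show ?thesis using lengths unfolding lambda_lengths_def lam_def by blast
  qed
  have side: "lam a b = 1" if "{a, b} \<in> polygon_sides n" "a < b" "b < n + 3" for a b
    using that side_rotate_vertex[OF v that(2,3)] lengths by (auto simp: lam_def lambda_lengths_def)
  show "lam a (Suc a) = 1" if "a \<le> n + 1" for a
    by (rule side) (use that polygon_sides_linear[of a "Suc a" n] in auto)
  show "lam 0 (n + 2) = 1"
    by (rule side) (use polygon_sides_linear[of 0 "n + 2" n] in auto)
  show "lam (lo i) (hi i) \<noteq> 0" if "i \<in> {1..n}" for i
    using rt_chord[of "lo i" "hi i"] coords[OF that] lengths by (auto simp: lam_def lambda_lengths_def)
qed

lemma x_eq: "i \<in> {1..n} \<Longrightarrow> x i = L (T i)"
  using coords[of i] by (simp add: x_def lam_def)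

text \<open>Density provides the third diagonal of the triangle behind an arrow. Which of a, b, c
  has the smallest new label decides which side is the top one, and so which rotation of
  \<open>tri\<close> occurs.\<close>

lemma triangle_arrow_cyc:
  assumes i: "i \<in> {1..n}" and j: "j \<in> {1..n}"
  shows "triangle_arrow n T (T i) (T j) \<longleftrightarrow> (\<exists>k. cyc i j k)"
proof
  assume "triangle_arrow n T (T i) (T j)"
  then obtain a b c where abc: "ccw a b c" "T i = {a, b}" "T j = {a, c}" "{b, c} \<in> edges n T"
    unfolding triangle_arrow_def by blast
  have "{a, b} \<in> T ` {1..n}" "{a, c} \<in> T ` {1..n}" using i j abc by (metis imageI)+
  then have "{b, c} \<in> T ` {1..n}" using dense abc unfolding dense_triangulation_def by blast
  then obtain k where k: "k \<in> {1..n}" "T k = {b, c}" by (metis imageE)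
  have "T i \<in> chords n" "T k \<in> chords n"
    using triangulation_T i k(1) by (auto simp: triangulation_def diagonals_eq)
  then have "a < n + 3" "b < n + 3" "c < n + 3" unfolding abc(2) k(2) chords_iff by auto
  note lt = this
  obtain a' where a': "a' < n + 3" "a = rt a'" using rotate_vertex_surj[OF v lt(1)] by blast
  obtain b' where b': "b' < n + 3" "b = rt b'" using rotate_vertex_surj[OF v lt(2)] by blast
  obtain c' where c': "c' < n + 3" "c = rt c'" using rotate_vertex_surj[OF v lt(3)] by blast
  have "ccw a' b' c'"
    using abc(1) ccw_rotate_vertex[OF v a'(1) b'(1) c'(1)] unfolding a'(2) b'(2) c'(2) by blast
  then have order: "a' < b' \<and> b' < c' \<or> b' < c' \<and> c' < a' \<or> c' < a' \<and> a' < b'" by (simp add: ccw_def)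
  have eq: "T i = {rt a', rt b'}" "T j = {rt a', rt c'}" "T k = {rt b', rt c'}"
    using abc(2,3) k(2) unfolding a'(2) b'(2) c'(2) .
  have eq': "T i = {rt b', rt a'}" "T j = {rt c', rt a'}" "T k = {rt c', rt b'}"
    unfolding eq by blast+
  from order consider
      "a' < b'" "b' < c'" "lo i = a' \<and> hi i = b'" "lo j = a' \<and> hi j = c'" "lo k = b' \<and> hi k = c'"
    | "b' < c'" "c' < a'" "lo i = b' \<and> hi i = a'" "lo j = c' \<and> hi j = a'" "lo k = b' \<and> hi k = c'"
    | "c' < a'" "a' < b'" "lo i = a' \<and> hi i = b'" "lo j = c' \<and> hi j = a'" "lo k = c' \<and> hi k = b'"
    using coords_eq[OF i _ b'(1) eq(1)] coords_eq[OF i _ a'(1) eq'(1)] coords_eq[OF j _ c'(1) eq(2)]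
      coords_eq[OF j _ a'(1) eq'(2)] coords_eq[OF k(1) _ c'(1) eq(3)] coords_eq[OF k(1) _ b'(1) eq'(3)]
    by (meson less_trans)
  then have "tri j k i \<or> tri i j k \<or> tri k i j"
    by cases (use i j k in \<open>simp_all add: tri_def\<close>)
  then show "\<exists>k. cyc i j k" unfolding cyc_def by blast
next
  have arrows: "triangle_arrow n T (T p) (T q) \<and> triangle_arrow n T (T q) (T r) \<and>
      triangle_arrow n T (T r) (T p)" if t: "tri p q r" for p q r
  proof -
    note d = triD[OF t]
    have E: "T p \<in> edges n T" "T q \<in> edges n T" "T r \<in> edges n T" using d by (auto simp: edges_def)
    let ?l = "rt (lo p)" and ?m = "rt (hi r)" and ?h = "rt (hi p)"
    have T: "T p = {?l, ?h}" "T q = {?m, ?h}" "T r = {?l, ?m}"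
      using coords[OF d(1)] coords[OF d(2)] coords[OF d(3)] d(4-6) by auto
    have lt: "lo p < n + 3" "hi r < n + 3" "hi p < n + 3" using d by auto
    have "ccw (lo p) (hi r) (hi p)" using d by (simp add: ccw_def)
    then have c: "ccw ?l ?m ?h" using ccw_rotate_vertex[OF v lt] by blast
    then have c': "ccw ?m ?h ?l" "ccw ?h ?l ?m" using ccw_rotate by blast+
    have T': "T p = {?h, ?l}" "T q = {?h, ?m}" "T r = {?m, ?l}" unfolding T by blast+
    have "triangle_arrow n T (T p) (T q)"
      by (rule triangle_arrowI[OF c'(2) _ T'(1,2)]) (use E(3) T(3) in simp)
    moreover have "triangle_arrow n T (T q) (T r)"
      by (rule triangle_arrowI[OF c'(1) _ T(2) T'(3)]) (use E(1) T'(1) in simp)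
    moreover have "triangle_arrow n T (T r) (T p)"
      by (rule triangle_arrowI[OF c _ T(3,1)]) (use E(2) T(2) in simp)
    ultimately show ?thesis by blast
  qed
  assume "\<exists>k. cyc i j k"
  then show "triangle_arrow n T (T i) (T j)" using arrows unfolding cyc_def by blast
qed

lemma triangulation_quiver_arrows: "triangulation_quiver n T = arrows"
proof (intro ext)
  fix i j
  show "triangulation_quiver n T i j = arrows i j"
  proof (cases "i \<in> {1..n} \<and> j \<in> {1..n}")
    case True
    then show ?thesis using triangle_arrow_cyc[of i j]
      by (simp add: triangulation_quiver_arrow arrows_def del: atLeastAtMost_iff)
  next
    case False
    then have "\<nexists>k. cyc i j k" using cyc_carrier by blast
    then show ?thesis using False
      by (auto simp: triangulation_quiver_arrow arrows_def simp del: atLeastAtMost_iff)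
  qed
qed

text \<open>\<open>multicurve_expansion\<close> carried back to the original labels. The exponents
  are given by existence because \<open>total_exponent\<close> belongs to the relabelled family of
  curves that the proof constructs.\<close>

lemma laminar_family_expansion:
  assumes C: "C \<subseteq> diagonals n" "\<And>D E. D \<in> C \<Longrightarrow> E \<in> C \<Longrightarrow> \<not> crosses D E"
    and CT: "\<And>i. i \<in> {1..n} \<Longrightarrow> T i \<notin> C"
    and a: "\<And>i. i \<in> {1..n} \<Longrightarrow> a i = (\<Sum>D | D \<in> C \<and> crosses D (T i). mult D)"
  shows "\<exists>e. (\<forall>s\<in>gcs n arrows i0 a. \<forall>i\<in>{1..n}. real_of_int (e s i) = gcs_exponent n arrows a s i) \<and>
    (\<Prod>D\<in>C. L D ^ mult D) = (\<Prod>l=1..n. L (T l) powi (- int (a l))) *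
      (\<Sum>s\<in>gcs n arrows i0 a. \<Prod>i=1..n. L (T i) powi (e s i))"
proof -
  define Cv where "Cv = {(X, Y). X < Y \<and> Y < n + 3 \<and> {rt X, rt Y} \<in> C}"
  define mu where "mu = (\<lambda>(X, Y). mult {rt X, rt Y})"
  let ?f = "\<lambda>(X, Y). {rt X, rt Y}"
  have bij: "bij_betw ?f Cv C"
    unfolding bij_betw_def
  proof (intro conjI equalityI subsetI)
    show "inj_on ?f Cv" using chord_eq by (auto simp: inj_on_def Cv_def)
    fix D assume "D \<in> C"
    then have "D \<in> chords n" using C(1) diagonals_eq by blast
    then obtain p q where pq: "D = {p, q}" "p < q" "q < n + 3" by (rule chordsE)
    then have "p < n + 3" by simp
    then obtain X where X: "X < n + 3" "p = rt X" using rotate_vertex_surj[OF v] by blast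
    obtain Y where Y: "Y < n + 3" "q = rt Y" using rotate_vertex_surj[OF v pq(3)] by blast
    have D: "D = {rt X, rt Y}" using pq(1) X(2) Y(2) by simp
    then have D': "D = {rt Y, rt X}" by blast
    have "X \<noteq> Y" using pq(2) X(2) Y(2) by blast
    then consider "X < Y" | "Y < X" by linarith
    then show "D \<in> ?f ` Cv"
    proof cases
      case 1
      then have "(X, Y) \<in> Cv" using \<open>D \<in> C\<close> Y unfolding D by (simp add: Cv_def)
      then show ?thesis by (rule rev_image_eqI) (simp add: D)
    next
      case 2
      then have "(Y, X) \<in> Cv" using \<open>D \<in> C\<close> X unfolding D' by (simp add: Cv_def)
      then show ?thesis by (rule rev_image_eqI) (simp add: D')
    qed
  qed (auto simp: Cv_def)
  have adm: "admissible X Y" if "(X, Y) \<in> Cv" for X Y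
  proof -
    have XY: "X < Y" "Y < n + 3" "{rt X, rt Y} \<in> C" using that by (auto simp: Cv_def)
    then have "{rt X, rt Y} \<notin> polygon_sides n" using C(1) diagonals_eq by blast
    then have "{X, Y} \<notin> polygon_sides n" using side_rotate_vertex[OF v XY(1,2)] by blast
    then have "Y \<noteq> X + 1 \<and> \<not> (X = 0 \<and> Y = n + 2)" using polygon_sides_linear[OF XY(1)] XY(2) by auto
    moreover have "(X, Y) \<noteq> (lo i, hi i)" if "i \<in> {1..n}" for i
      using CT[OF that] coords[OF that] XY(3) by (metis Pair_inject)
    ultimately show ?thesis using XY(1,2) unfolding admissible_def by simp
  qed
  interpret R: rooted_curves n i0 lo hi lam Cv mu
  proof
    show "finite Cv"
      using bij_betw_finite[OF bij] C(1) finite_diagonals finite_subset by blast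
    show "(X, Y) \<in> Cv \<Longrightarrow> admissible X Y" for X Y by (rule adm)
    show "\<not> (X < X' \<and> X' < Y \<and> Y < Y')" if "(X, Y) \<in> Cv" "(X', Y') \<in> Cv" for X Y X' Y'
    proof -
      have *: "X < Y" "Y < n + 3" "{rt X, rt Y} \<in> C" "X' < Y'" "Y' < n + 3" "{rt X', rt Y'} \<in> C"
        using that by (auto simp: Cv_def)
      then show ?thesis using C(2) rt_crosses[of X Y X' Y'] by blast
    qed
  qed
  \<comment> \<open>The entry \<open>a i\<close>, a sum of multiplicities, becomes the number of
    parallel copies that cross \<open>T i\<close>.\<close>
  have count: "R.crossing_count i = a i" if i: "i \<in> {1..n}" for i
  proof -
    have cr: "i \<in> crossed X Y \<longleftrightarrow> crosses {rt X, rt Y} (T i)" if "(X, Y) \<in> Cv" for X Y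
    proof -
      have Ti: "T i = {rt (lo i), rt (hi i)}" and lt: "lo i < hi i" "hi i < n + 3"
        using coords[OF i] by auto
      have "X < Y" "Y < n + 3" using that by (auto simp: Cv_def)
      then show ?thesis using rt_crosses[OF _ _ lt] i unfolding Ti crossed_def by simp
    qed
    let ?K = "{D \<in> Cv. i \<in> crossed (fst D) (snd D)}"
    have "R.crossers i = Sigma ?K (\<lambda>D. {..<mu D})"
      by (auto simp: R.crossers_def R.copies_def)
    moreover have "finite ?K" using R.finite_curves by simp
    ultimately have "R.crossing_count i = (\<Sum>D\<in>?K. mu D)" by (simp add: card_SigmaI)
    also have "\<dots> = (\<Sum>D\<in>?K. mult (?f D))" by (simp add: mu_def case_prod_unfold)
    also have "\<dots> = (\<Sum>D | D \<in> C \<and> crosses D (T i). mult D)"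
    proof (rule sum.reindex_bij_betw, rule bij_betw_imageI)
      show "inj_on ?f ?K" using bij inj_on_subset[of ?f Cv ?K] unfolding bij_betw_def by blast
      show "?f ` ?K = {D \<in> C. crosses D (T i)}"
      proof (intro equalityI subsetI)
        fix D assume "D \<in> ?f ` ?K"
        then obtain X Y where XY: "(X, Y) \<in> Cv" "i \<in> crossed X Y" "D = {rt X, rt Y}" by auto
        then have "D \<in> C" by (simp add: Cv_def)
        then show "D \<in> {D \<in> C. crosses D (T i)}" using XY cr by simp
      next
        fix D assume D: "D \<in> {D \<in> C. crosses D (T i)}"
        then have "D \<in> ?f ` Cv" using bij by (simp add: bij_betw_def)
        then obtain X Y where XY: "(X, Y) \<in> Cv" "D = {rt X, rt Y}" by auto
        then have "(X, Y) \<in> ?K" using D cr by simp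
        then show "D \<in> ?f ` ?K" by (rule rev_image_eqI) (simp add: XY(2))
      qed
    qed
    finally show ?thesis using a[OF i] by simp
  qed
  have pos: "i \<in> {1..n} \<and> j \<in> {1..n} \<and> k \<in> {1..n}" if "three_cycle arrows i j k" for i j k
    using that cyc_carrier by (simp add: three_cycle_arrows)
  have gcs_eq: "gcs n arrows i0 a = gcs n arrows i0 R.crossing_count"
  proof -
    have seqs: "(\<Pi>\<^sub>E i\<in>{1..n}. {1..a i} \<rightarrow>\<^sub>E {0, 1 :: nat}) =
        (\<Pi>\<^sub>E i\<in>{1..n}. {1..R.crossing_count i} \<rightarrow>\<^sub>E {0, 1})"
      using count by (intro PiE_cong) simp
    have counts: "R.crossing_count i = a i \<and> R.crossing_count j = a j \<and> R.crossing_count k = a k"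
      if "three_cycle arrows i j k" for i j k using pos[OF that] count by blast
    show ?thesis unfolding gcs_def seqs
      by (intro Collect_cong conj_cong refl all_cong1 imp_cong) (simp add: counts)
  qed
  have exp_eq: "gcs_exponent n arrows a s i = gcs_exponent n arrows R.crossing_count s i"
    if "i \<in> {1..n}" for s i
    using that count by (simp add: gcs_exponent_def zeros_def ones_def)
  have "(\<Prod>D\<in>C. L D ^ mult D) = (\<Prod>D\<in>Cv. L (?f D) ^ mult (?f D))"
    by (rule prod.reindex_bij_betw[OF bij, symmetric])
  also have "\<dots> = (\<Prod>(X, Y)\<in>Cv. lam X Y ^ mu (X, Y))"
    by (simp add: lam_def mu_def case_prod_unfold)
  also note R.multicurve_expansion
  finally have "(\<Prod>D\<in>C. L D ^ mult D) = (\<Prod>l=1..n. L (T l) powi (- int (a l))) *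
      (\<Sum>s\<in>gcs n arrows i0 a. \<Prod>i=1..n. L (T i) powi (R.total_exponent s i))"
    unfolding gcs_eq using count x_eq by simp
  moreover have "real_of_int (R.total_exponent s i) = gcs_exponent n arrows a s i"
    if "s \<in> gcs n arrows i0 a" "i \<in> {1..n}" for s i
    using R.total_exponent_eq that gcs_eq exp_eq by metis
  ultimately show ?thesis by blast
qed

end

lemma rotated_coordinates:
  assumes T: "triangulation n T" and v: "v < n + 3"
  shows "\<exists>lo hi. \<forall>i\<in>{1..n}. lo i < hi i \<and> hi i < n + 3 \<and>
    T i = {rotate_vertex n v (lo i), rotate_vertex n v (hi i)}"
proof -
  have "\<exists>l h. l < h \<and> h < n + 3 \<and> T i = {rotate_vertex n v l, rotate_vertex n v h}" if i: "i \<in> {1..n}" for i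
  proof -
    have "T i \<in> chords n" using T i by (auto simp: triangulation_def diagonals_eq)
    then obtain p q where pq: "T i = {p, q}" "p < q" "q < n + 3" by (rule chordsE)
    moreover from this have "p < n + 3" by simp
    ultimately obtain X Y where XY: "X < n + 3" "p = rotate_vertex n v X" "Y < n + 3" "q = rotate_vertex n v Y"
      using rotate_vertex_surj[OF v] by metis
    then consider "X < Y" | "Y < X" using pq by fastforce
    then show ?thesis
    proof cases
      case 1
      then show ?thesis using pq XY by blast
    next
      case 2
      moreover have "T i = {q, p}" using pq by blast
      ultimately show ?thesis using XY by blast
    qed
  qed
  then show ?thesis by metis
qed

text \<open>If \<open>T i\<close> belonged to the collection, no member would cross it, and the
  entry would be minus its multiplicity. Nonnegativity excludes this, and only crossings are left to
  count.\<close>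

lemma crossing_number_sum:
  assumes T: "triangulation n T" and i: "i \<in> {1..n}"
    and C: "C \<subseteq> diagonals n" "\<And>D E. D \<in> C \<Longrightarrow> E \<in> C \<Longrightarrow> \<not> crosses D E"
    and pos: "\<And>D. D \<in> C \<Longrightarrow> mult D > (0::nat)"
    and a: "int a = (\<Sum>D\<in>C. int (mult D) * crossing_number D (T i))"
  shows "T i \<notin> C" "a = (\<Sum>D | D \<in> C \<and> crosses D (T i). mult D)"
proof -
  have fin: "finite C" using C(1) finite_diagonals finite_subset by blast
  show *: "T i \<notin> C"
  proof
    assume Ti: "T i \<in> C"
    have "(\<Sum>D\<in>C. int (mult D) * crossing_number D (T i)) =
        int (mult (T i)) * crossing_number (T i) (T i) +
        (\<Sum>D\<in>C - {T i}. int (mult D) * crossing_number D (T i))"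
      using fin Ti by (rule sum.remove)
    also have "(\<Sum>D\<in>C - {T i}. int (mult D) * crossing_number D (T i)) = 0"
      using C(2) Ti by (intro sum.neutral) (auto simp: crossing_number_def)
    finally show False using a pos[OF Ti] by (simp add: crossing_number_def)
  qed
  have "int a = (\<Sum>D\<in>C. if crosses D (T i) then int (mult D) else 0)"
    unfolding a using * by (intro sum.cong refl) (auto simp: crossing_number_def)
  also have "\<dots> = (\<Sum>D | D \<in> C \<and> crosses D (T i). int (mult D))"
    by (rule sum.inter_filter[OF fin, symmetric])
  also have "\<dots> = int (\<Sum>D | D \<in> C \<and> crosses D (T i). mult D)" by simp
  finally show "a = (\<Sum>D | D \<in> C \<and> crosses D (T i). mult D)" by (simp only: of_nat_eq_iff)
qed

theorem theorem4p1:
  fixes n i0 :: nat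
    and Q :: quiver
    and T :: "nat \<Rightarrow> nat set"
    and a :: "nat \<Rightarrow> nat"
    and z :: ratfun
  assumes "n \<ge> 2"
    and "type_A n Q"
    and "\<And>i j. Q i j > 0 \<Longrightarrow> \<exists>k. three_cycle Q i j k"
    and "i0 \<in> {1..n}"
    and "vertex_degree n Q i0 = 2"
    and "triangulation n T"
    and "triangulation_quiver n T = Q"
    and "cluster_monomial n Q z"
    and "has_d_vector n Q T z (\<lambda>i. int (a i))"
  shows "\<exists>e :: (nat \<Rightarrow> nat \<Rightarrow> nat) \<Rightarrow> nat \<Rightarrow> int.
     (\<forall>s\<in>gcs n Q i0 a. \<forall>i\<in>{1..n}. real_of_int (e s i) = gcs_exponent n Q a s i) \<and>
     z = (\<Prod>l=1..n. xvar l powi (- int (a l))) *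
         (\<Sum>s\<in>gcs n Q i0 a. \<Prod>i=1..n. xvar i powi (e s i))"
proof -
  note T = assms(6) and Q = assms(7)
  have dense: "dense_triangulation n T"
    using dense_triangulationI[OF T] assms(3) unfolding Q by blast
  obtain v where v: "v < n + 3" "T i0 = {rotate_vertex n v 1, rotate_vertex n v (n + 2)}"
    using ear_rotation[OF dense assms(4)] assms(5) unfolding Q by blast
  obtain L where L: "lambda_lengths n L" "\<And>i. i \<in> {1..n} \<Longrightarrow> L (T i) = xvar i"
    using lambda_lengths_exist[OF T positive_cone_ratfuns, of xvar] xvar_positive by blast
  obtain lo hi where coords: "\<And>i. i \<in> {1..n} \<Longrightarrow> lo i < hi i \<and> hi i < n + 3 \<and>
      T i = {rotate_vertex n v (lo i), rotate_vertex n v (hi i)}"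
    using rotated_coordinates[OF T v(1)] by blast
  have "lo i0 = 1 \<and> hi i0 = n + 2"
  proof -
    note c = coords[OF assms(4)]
    have eq: "{rotate_vertex n v (lo i0), rotate_vertex n v (hi i0)} =
        {rotate_vertex n v 1, rotate_vertex n v (n + 2)}" using c v(2) by metis
    have inj: "p = q" if "rotate_vertex n v p = rotate_vertex n v q" "p < n + 3" "q < n + 3" for p q
      using rotate_vertex_inj[OF v(1)] that by blast
    have "lo i0 < n + 3" using c by linarith
    moreover have "1 < n + 3" "n + 2 < n + 3" by simp_all
    ultimately have "lo i0 = 1 \<and> hi i0 = n + 2 \<or> lo i0 = n + 2 \<and> hi i0 = 1"
      using eq inj c unfolding doubleton_eq_iff by metis
    then show ?thesis using c by auto
  qed
  then interpret rotated_triangulation n v i0 T lo hi L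
    using dense v(1) assms(4) coords L(1) by unfold_locales auto
  have arrows: "arrows = Q" using triangulation_quiver_arrows Q by simp
  obtain C mult where C: "C \<subseteq> diagonals n" "\<And>D E. D \<in> C \<Longrightarrow> E \<in> C \<Longrightarrow> \<not> crosses D E"
    and pos: "\<And>D. D \<in> C \<Longrightarrow> mult D > (0::nat)" and z: "z = (\<Prod>D\<in>C. L D ^ mult D)"
    and d: "\<And>i. i \<in> {1..n} \<Longrightarrow> int (a i) = (\<Sum>D\<in>C. int (mult D) * crossing_number D (T i))"
    using has_d_vector_lambda_lengths[OF L(1) T L(2) Q assms(9)] by blast
  note cn = crossing_number_sum[OF T _ C pos d]
  obtain e where e: "\<forall>s\<in>gcs n Q i0 a. \<forall>i\<in>{1..n}. real_of_int (e s i) = gcs_exponent n Q a s i"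
    "z = (\<Prod>l=1..n. L (T l) powi (- int (a l))) * (\<Sum>s\<in>gcs n Q i0 a. \<Prod>i=1..n. L (T i) powi (e s i))"
    using laminar_family_expansion[OF C cn(1) cn(2)] unfolding arrows z by blast
  have "z = (\<Prod>l=1..n. xvar l powi (- int (a l))) * (\<Sum>s\<in>gcs n Q i0 a. \<Prod>i=1..n. xvar i powi (e s i))"
    unfolding e(2) using L(2) by simp
  then show ?thesis using e(1) by blast
qed

end
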